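(* Let $m,n\ge 2$ and $2\le k\le mn$ be integers, and let $\phi: M_{mn}\to M_{mn}$ be a (complex-)linear map. The following are equivalent. (a) $\|\phi(A\otimes B)\|_{(k)} = \|A\otimes B\|_{(k)}$ for all $A\in M_m$ and $B\in M_n$. (b) There are unitary matrices $U,V\in M_{mn}$, and maps $\varphi_1: M_m\to M_m$, $\varphi_2: M_n\to M_n$, where each $\varphi_s$ ($s=1,2$) is either the identity map $X\mapsto X$ or the transposition map $X\mapsto X^t$, such that $$\phi(A\otimes B)=U(\varphi_1(A)\otimes\varphi_2(B))V\quad\text{for all } A\in M_m \text{ and } B\in M_n.$$
   Context: $M_n$ denotes the set of $n\times n$ complex matrices. For $A\in M_m$, $B\in M_n$, $A\otimes B\in M_{mn}$ is the tensor (Kronecker) product. For $X\in M_N$ with singular values $s_1(X)\ge\cdots\ge s_N(X)$ and $1\le k\le N$, the Ky Fan $k$-norm is $\|X\|_{(k)}=s_1(X)+\cdots+s_k(X)$. $X^t$ is the transpose of $X$ (without conjugation). *)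

theory Defs
  imports "Jordan_Normal_Form.Schur_Decomposition"
begin

definition kronecker_product :: "'a :: times mat \<Rightarrow> 'a mat \<Rightarrow> 'a mat"  (infixl \<open>\<otimes>\<^sub>K\<close> 70) where
  "A \<otimes>\<^sub>K B = mat (dim_row A * dim_row B) (dim_col A * dim_col B)
     (\<lambda>(i, j). A $$ (i div dim_row B, j div dim_col B) * B $$ (i mod dim_row B, j mod dim_col B))"

definition unitary_mat :: "complex mat \<Rightarrow> bool" where
  "unitary_mat U \<longleftrightarrow> square_mat U \<and>
     U * mat_adjoint U = 1\<^sub>m (dim_row U) \<and> mat_adjoint U * U = 1\<^sub>m (dim_row U)"

text \<open>
  The square roots of the eigenvalues of \<open>X\<^sup>* X\<close>, repeated according to algebraic multiplicity and
  listed in decreasing order. These eigenvalues are nonnegative reals, but they have type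
  \<^typ>\<open>complex\<close> as roots of the characteristic polynomial, hence the \<^const>\<open>Re\<close>.
\<close>
definition singular_values :: "complex mat \<Rightarrow> real list" where
  "singular_values X = rev (sorted_list_of_multiset
     (image_mset (\<lambda>z. sqrt (Re z)) (proots (char_poly (mat_adjoint X * X)))))"

definition ky_fan_norm :: "nat \<Rightarrow> complex mat \<Rightarrow> real" where
  "ky_fan_norm k X = (\<Sum>i<k. singular_values X ! i)"

text \<open>Complex-linear maps from \<open>M\<^sub>N\<close> to itself; the values outside \<open>M\<^sub>N\<close> are irrelevant.\<close>
definition linear_on_mat :: "nat \<Rightarrow> (complex mat \<Rightarrow> complex mat) \<Rightarrow> bool" where
  "linear_on_mat N \<phi> \<longleftrightarrow>
     (\<forall>X \<in> carrier_mat N N. \<phi> X \<in> carrier_mat N N) \<and>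
     (\<forall>X \<in> carrier_mat N N. \<forall>Y \<in> carrier_mat N N. \<phi> (X + Y) = \<phi> X + \<phi> Y) \<and>
     (\<forall>c. \<forall>X \<in> carrier_mat N N. \<phi> (c \<cdot>\<^sub>m X) = c \<cdot>\<^sub>m \<phi> X)"

end

theory Submission
  imports Defs "Jordan_Normal_Form.Spectral_Radius"
begin

text \<open>
  Put \<open>F(A, B) = \<phi>(A \<otimes> B)\<close>. If \<open>\<parallel>\<alpha>X + \<beta>Y\<parallel> = |\<alpha>| + |\<beta>|\<close> in the Ky Fan norm for all complex \<open>\<alpha>\<close>, \<open>\<beta>\<close>,
  then \<open>X\<^sup>*Y = XY\<^sup>* = 0\<close>: for every \<open>|\<omega>| = 1\<close> some partial isometry of rank \<open>k\<close> norms both \<open>X\<close> and \<open>\<omega>Y\<close>,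
  and the equality case of the trace inequality determines how it acts on \<open>X\<close> and \<open>Y\<close>.
  Hence \<open>F(xx'\<^sup>*, yy'\<^sup>*)\<close> and \<open>F(xx'\<^sup>*, zz'\<^sup>*)\<close> are orthogonal whenever \<open>y \<bottom> z\<close> and \<open>y' \<bottom> z'\<close>.
  Polarizing in \<open>x\<close> and \<open>x'\<close> makes \<open>F(A, yy'\<^sup>*)\<close> and \<open>F(A', zz'\<^sup>*)\<close> orthogonal for all \<open>A\<close>, \<open>A'\<close>, and likewise
  for the other factor. So the \<open>mn\<close> matrices \<open>F(E\<^sub>i\<^sub>i, E\<^sub>r\<^sub>r)\<close> are mutually orthogonal in \<open>M\<^sub>m\<^sub>n\<close>, which forces
  them to be diagonal units after multiplication by two fixed unitaries; let \<open>T\<close> be the map so normalized. Then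
  \<open>T(A, B) = T(A, I) T(I, B)\<close> with commuting factors, the matrices \<open>T(E\<^sub>i\<^sub>j, I)\<close> multiply like matrix units or
  like transposed matrix units, and so do the \<open>T(I, E\<^sub>r\<^sub>s)\<close>; their joint orbit of one unit vector is an
  orthonormal basis in which \<open>T\<close> is the Kronecker product.
\<close>

section \<open>Complex matrices, adjoints and unitary completion\<close>

text \<open>The hypothesis concerns Kronecker products alone, so additivity of the norm is available
  only for sums whose terms share a factor, such as \<open>outer x x'\<close> times a combination of
  two orthogonal rank one matrices. Its singular values are |\<alpha>|, |\<beta>| and zeros, and k
  \<ge> 2 lets the norm see both. The equality case of the trace inequality splits on the k-th
  singular value. If it vanishes for X and Y, a norming isometry is pinned down on their supports,
  and varying \<omega> gives orthogonality. If it is positive, the isometry is a projection up to a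
  fixed unitary; positive values for both would make every unit \<omega> an eigenvalue of one
  matrix. The relations found for T(E_ij, I) hold for multiplicative and antimultiplicative maps
  alike, so by themselves they admit a map of one kind on one block and of the other kind on
  another. The second factor excludes this: after compression by T(I, E_00) each T(E_ii, I) has rank
  one, which leaves no room for two blocks, and an element commuting with all T(I, B) is zero once
  its compression is.\<close>

abbreviation (input) cmat :: "nat \<Rightarrow> complex mat set" where
  "cmat N \<equiv> carrier_mat N N"

abbreviation (input) cvec :: "nat \<Rightarrow> complex vec set" where
  "cvec N \<equiv> carrier_vec N"

abbreviation (input) adj :: "complex mat \<Rightarrow> complex mat" where
  "adj \<equiv> mat_adjoint"

abbreviation (input) real_diag :: "nat \<Rightarrow> (nat \<Rightarrow> real) \<Rightarrow> complex mat" where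
  "real_diag N d \<equiv> mat_diag N (\<lambda>i. complex_of_real (d i))"

abbreviation (input) two_diag :: "nat \<Rightarrow> nat \<Rightarrow> nat \<Rightarrow> complex \<Rightarrow> complex \<Rightarrow> complex mat" where
  "two_diag N p q \<alpha> \<beta> \<equiv> mat_diag N (\<lambda>i. if i = p then \<alpha> else if i = q then \<beta> else 0)"

lemma mult_cmat [simp]: "A \<in> cmat N \<Longrightarrow> B \<in> cmat N \<Longrightarrow> A * B \<in> cmat N"
  by auto

lemma mult_cmat_vec [simp]: "A \<in> cmat N \<Longrightarrow> v \<in> cvec N \<Longrightarrow> A *\<^sub>v v \<in> cvec N"
  by auto

lemmas cmat_assoc = assoc_mult_mat[of _ N N _ N _ N] for N

lemmas cmat_bilinear = add_mult_distrib_mat[of _ N N _ _ N] mult_add_distrib_mat[of _ N N _ N]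
  mult_smult_distrib[of _ N N _ N] mult_smult_assoc_mat[of _ N N _ N] for N

lemma dim_mat_adjoint [simp]:
  "dim_row (adj A) = dim_col A" "dim_col (adj A) = dim_row A"
  by (auto simp: mat_adjoint_def)

lemma index_mat_adjoint [simp]:
  "i < dim_col A \<Longrightarrow> j < dim_row A \<Longrightarrow> adj A $$ (i, j) = cnj (A $$ (j, i))"
  by (simp add: mat_adjoint_def mat_of_rows_def)

lemma mat_adjoint_carrier [simp]:
  "A \<in> carrier_mat m n \<Longrightarrow> adj A \<in> carrier_mat n m"
  by auto

lemma mat_adjoint_adjoint [simp]: "adj (adj (A :: complex mat)) = A"
  by (rule eq_matI) auto

lemma mat_adjoint_one [simp]: "adj (1\<^sub>m n :: complex mat) = 1\<^sub>m n"
  by (rule eq_matI) auto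

lemma mat_adjoint_zero [simp]: "adj (0\<^sub>m m n :: complex mat) = 0\<^sub>m n m"
  by (rule eq_matI) auto

lemma cmat_neutral [simp]:
  assumes "A \<in> cmat N"
  shows "0\<^sub>m N N * A = 0\<^sub>m N N" "A * 0\<^sub>m N N = 0\<^sub>m N N" "A * 1\<^sub>m N = A"
    "A + 0\<^sub>m N N = A" "0\<^sub>m N N + A = A"
  using assms by auto

lemma mat_adjoint_add:
  "\<lbrakk>A \<in> carrier_mat m n; B \<in> carrier_mat m n\<rbrakk> \<Longrightarrow>
   adj (A + B) = adj A + adj (B :: complex mat)"
  by (rule eq_matI) auto

lemma mat_adjoint_minus:
  "\<lbrakk>A \<in> carrier_mat m n; B \<in> carrier_mat m n\<rbrakk> \<Longrightarrow>
   adj (A - B) = adj A - adj (B :: complex mat)"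
  by (rule eq_matI) auto

lemma mat_adjoint_smult:
  "adj (c \<cdot>\<^sub>m A) = cnj c \<cdot>\<^sub>m adj (A :: complex mat)"
  by (rule eq_matI) auto

lemma index_mult_mat_sum:
  assumes "A \<in> carrier_mat m n" "B \<in> carrier_mat n p" "i < m" "j < p"
  shows "(A * B) $$ (i, j) = (\<Sum>k<n. A $$ (i, k) * B $$ (k, j))"
  using assms by (auto simp: scalar_prod_def lessThan_atLeast0 intro!: sum.cong)

lemma mat_adjoint_mult:
  assumes "A \<in> carrier_mat m n" "B \<in> carrier_mat n p"
  shows "adj (A * B) = adj B * adj (A :: complex mat)"
proof (rule eq_matI)
  fix i j assume "i < dim_row (adj B * adj A)"
    and "j < dim_col (adj B * adj A)"
  hence ij: "i < p" "j < m" using assms by auto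
  have "adj (A * B) $$ (i, j) = cnj ((A * B) $$ (j, i))"
    using ij assms by (subst index_mat_adjoint) auto
  also have "\<dots> = (\<Sum>k<n. adj B $$ (i, k) * adj A $$ (k, j))"
    using assms ij by (subst index_mult_mat_sum[OF assms ij(2,1)]) (auto intro!: sum.cong)
  also have "\<dots> = (adj B * adj A) $$ (i, j)"
    using assms ij by (subst index_mult_mat_sum[of _ p n _ m]) auto
  finally show "adj (A * B) $$ (i, j) = (adj B * adj A) $$ (i, j)" .
qed (use assms in auto)

lemma scalar_prod_c_sum: "v \<in> cvec n \<Longrightarrow> w \<in> cvec n \<Longrightarrow>
  v \<bullet>c w = (\<Sum>i<n. v $ i * cnj (w $ i))"
  by (auto simp: scalar_prod_def lessThan_atLeast0 intro!: sum.cong)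

lemma cscalar_self: "v \<in> cvec n \<Longrightarrow> v \<bullet>c v = of_real (\<Sum>i<n. (cmod (v $ i))\<^sup>2)"
  by (simp add: scalar_prod_c_sum complex_norm_square del: of_real_power)

lemma normalize_vec:
  assumes v: "v \<in> cvec n" "v \<noteq> 0\<^sub>v n"
  obtains c where "c > 0" "(complex_of_real c \<cdot>\<^sub>v v) \<bullet>c (complex_of_real c \<cdot>\<^sub>v v) = 1"
proof -
  define s where "s = (\<Sum>i<n. (cmod (v $ i))\<^sup>2)"
  have vs: "v \<bullet>c v = of_real s" using v by (simp add: cscalar_self s_def)
  have "s \<noteq> 0" using v vs conjugate_square_eq_0_vec[OF v(1)] by auto
  moreover have "s \<ge> 0" by (auto simp: s_def sum_nonneg)
  ultimately have s: "s > 0" by simp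
  define c where "c = 1 / sqrt s"
  have "(complex_of_real c \<cdot>\<^sub>v v) \<bullet>c (complex_of_real c \<cdot>\<^sub>v v) = of_real (c * c * s)"
    using v vs by (simp add: conjugate_smult_vec)
  also have "c * c * s = 1" using s by (simp add: c_def field_simps)
  finally show thesis using that[of c] s by (simp add: c_def)
qed

lemma unitary_matI:
  assumes "U \<in> cmat N" "adj U * U = 1\<^sub>m N"
  shows "unitary_mat U"
  using assms mat_mult_left_right_inverse[OF _ assms(1) assms(2)]
  by (auto simp: unitary_mat_def)

lemma unitary_matD:
  assumes "unitary_mat U" "U \<in> cmat N"
  shows "adj U * U = 1\<^sub>m N" "U * adj U = 1\<^sub>m N"
  using assms by (auto simp: unitary_mat_def)

lemma unitary_one [simp]: "unitary_mat (1\<^sub>m N)"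
  by (rule unitary_matI[of _ N]) auto

lemma unitary_adjoint: "unitary_mat U \<Longrightarrow> unitary_mat (adj U)"
  by (auto simp: unitary_mat_def)

lemma unitary_mult:
  assumes "unitary_mat U" "unitary_mat V" "U \<in> cmat N" "V \<in> cmat N"
  shows "unitary_mat (U * V)"
proof (rule unitary_matI[of _ N])
  have "adj (U * V) * (U * V) = adj V * ((adj U * U) * V)"
    using assms by (simp add: mat_adjoint_mult[of _ N N _ N] cmat_assoc[where N = N])
  thus "adj (U * V) * (U * V) = 1\<^sub>m N"
    using assms by (simp add: unitary_matD[of _ N])
qed (use assms in auto)

lemma unitary_cancel:
  assumes "unitary_mat U" "U \<in> cmat N" "A \<in> cmat N"
  shows "U * (adj U * A) = A" "adj U * (U * A) = A"
    "A * U * adj U = A" "A * adj U * U = A"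
  using assms unitary_matD[OF assms(1,2)]
  by (simp_all flip: cmat_assoc[where N = N]) (simp_all add: cmat_assoc[where N = N])

section \<open>Orthonormal families and their completion to unitary matrices\<close>

lemma unitary_of_cols:
  assumes f: "\<And>i. i < N \<Longrightarrow> f i \<in> cvec N"
    and o: "\<And>i j. i < N \<Longrightarrow> j < N \<Longrightarrow> f i \<bullet>c f j = (if i = j then 1 else (0::complex))"
  shows "unitary_mat (mat N N (\<lambda>(i, j). f j $ i))"
proof (rule unitary_matI[of _ N])
  let ?U = "mat N N (\<lambda>(i, j). f j $ i)"
  show "adj ?U * ?U = 1\<^sub>m N"
  proof (rule eq_matI)
    fix i j assume "i < dim_row (1\<^sub>m N :: complex mat)" "j < dim_col (1\<^sub>m N :: complex mat)"
    hence ij: "i < N" "j < N" by auto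
    have "(adj ?U * ?U) $$ (i, j) = (\<Sum>k<N. cnj (f i $ k) * f j $ k)"
      using ij by (subst index_mult_mat_sum[of _ N N _ N]) auto
    also have "\<dots> = f j \<bullet>c f i" using f ij by (simp add: scalar_prod_c_sum[of _ N] mult.commute)
    finally show "(adj ?U * ?U) $$ (i, j) = 1\<^sub>m N $$ (i, j)" using o ij by auto
  qed auto
qed auto

text \<open>Fewer than N homogeneous equations in N unknowns have a nonzero solution. Padding the
  system with zero rows makes it square, so that the determinant criterion applies; the coefficients
  are conjugated because \<open>\<bullet>c\<close> conjugates its second argument.\<close>

lemma orthonormal_extend:
  assumes f: "\<And>i. i < r \<Longrightarrow> f i \<in> cvec N" and r: "r < N"
  obtains v :: "complex vec"
    where "v \<in> cvec N" "v \<bullet>c v = 1" "\<And>i. i < r \<Longrightarrow> v \<bullet>c f i = 0"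
proof -
  define M where "M = mat N N (\<lambda>(i, j). if i < r then cnj (f i $ j) else 0)"
  have M: "M \<in> cmat N" by (simp add: M_def)
  have "M = mat\<^sub>r N N (\<lambda>i. if i = r then 0\<^sub>v N else row M i)"
    using r by (intro eq_matI) (auto simp: M_def)
  hence "det M = 0" using det_row_0[OF r, of "row M"] M by (metis (no_types, lifting) PiE Pi_I row_carrier carrier_matD(2))
  then obtain v where v: "v \<in> cvec N" "v \<noteq> 0\<^sub>v N" and Mv: "M *\<^sub>v v = 0\<^sub>v N"
    using det_0_iff_vec_prod_zero[OF M] by auto
  obtain c where c: "c > 0" "(complex_of_real c \<cdot>\<^sub>v v) \<bullet>c (complex_of_real c \<cdot>\<^sub>v v) = 1"
    using normalize_vec[OF v] .
  show thesis
  proof (rule that[OF _ c(2)])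
    fix i assume i: "i < r"
    have "(M *\<^sub>v v) $ i = 0" using Mv i r by simp
    hence "(\<Sum>j<N. cnj (f i $ j) * v $ j) = 0" using i r v
      by (simp add: M_def scalar_prod_def lessThan_atLeast0)
    hence "v \<bullet>c f i = 0" using v f[OF i] by (simp add: scalar_prod_c_sum[of _ N] mult.commute)
    thus "(complex_of_real c \<cdot>\<^sub>v v) \<bullet>c f i = 0" using v f[OF i] by simp
  qed (use v in auto)
qed

lemma orthonormal_completion:
  assumes "\<And>i. i < r \<Longrightarrow> f i \<in> cvec N" "r \<le> N"
    and "\<And>i j. i < r \<Longrightarrow> j < r \<Longrightarrow> f i \<bullet>c f j = (if i = j then 1 else (0::complex))"
  shows "\<exists>U \<in> cmat N. unitary_mat U \<and> (\<forall>i<r. col U i = f i)"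
  using assms
proof (induction "N - r" arbitrary: r f)
  case 0
  hence r: "r = N" by simp
  let ?U = "mat N N (\<lambda>(i, j). f j $ i)"
  have "unitary_mat ?U" using 0 r by (intro unitary_of_cols) auto
  moreover have "col ?U i = f i" if "i < r" for i
    using 0(2)[OF that] that r by (intro eq_vecI) auto
  ultimately show ?case by (intro bexI[of _ ?U]) auto
next
  case (Suc d)
  hence r: "r < N" by simp
  obtain v where v: "v \<in> cvec N" "v \<bullet>c v = 1" "\<And>i. i < r \<Longrightarrow> v \<bullet>c f i = 0"
    using orthonormal_extend[of r f N, OF Suc.prems(1) r] by metis
  have v': "f i \<bullet>c v = 0" if "i < r" for i
    using v(3)[OF that] conjugate_conjugate_sprod[OF v(1) Suc.prems(1)[OF that]] v(1) Suc.prems(1)[OF that]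
    by (metis conjugate_zero_iff conjugate_vec_sprod_comm)
  have "\<exists>U \<in> cmat N. unitary_mat U \<and> (\<forall>i<Suc r. col U i = (f(r := v)) i)"
  proof (rule Suc.hyps(1))
    show "d = N - Suc r" using Suc by simp
    show "(f(r := v)) i \<bullet>c (f(r := v)) j = (if i = j then 1 else 0)" if "i < Suc r" "j < Suc r" for i j
      using that v v' Suc.prems(3) by (auto simp: less_Suc_eq)
  qed (use v r Suc in \<open>auto simp: less_Suc_eq\<close>)
  thus ?case by fastforce
qed

section \<open>Singular value decomposition\<close>

lemma cscalar_mult_mat_vec:
  assumes "A \<in> carrier_mat m n" "v \<in> cvec n" "w \<in> cvec m"
  shows "(A *\<^sub>v v) \<bullet>c w = v \<bullet>c (adj A *\<^sub>v (w :: complex vec))"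
proof -
  have "(A *\<^sub>v v) \<bullet>c w = (\<Sum>i<m. (\<Sum>j<n. A $$ (i, j) * v $ j) * cnj (w $ i))"
    using assms by (subst scalar_prod_c_sum[of _ m]) (auto simp: scalar_prod_def lessThan_atLeast0 intro!: sum.cong)
  also have "\<dots> = (\<Sum>j<n. v $ j * (\<Sum>i<m. A $$ (i, j) * cnj (w $ i)))"
    unfolding sum_distrib_left sum_distrib_right
    by (subst sum.swap) (auto simp: mult_ac intro!: sum.cong)
  also have "\<dots> = v \<bullet>c (adj A *\<^sub>v w)"
    using assms mult_mat_vec_carrier[of "adj A" n m w]
    by (subst scalar_prod_c_sum[of _ n]) (auto simp: scalar_prod_def lessThan_atLeast0 intro!: sum.cong)
  finally show ?thesis .
qed

lemma adjoint_mult_entry: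
  assumes "U \<in> cmat N" "A \<in> cmat N" "i < N" "j < N"
  shows "(adj U * A) $$ (i, j) = col A j \<bullet>c col U i"
  using assms by (subst index_mult_mat_sum[of _ N N _ N]) (auto simp: scalar_prod_c_sum[of _ N] mult.commute intro!: sum.cong)

lemma unitary_cols:
  assumes "unitary_mat U" "U \<in> cmat N" "i < N" "j < N"
  shows "col U i \<bullet>c col U j = (if i = j then 1 else 0)"
proof -
  have "(adj U * U) $$ (j, i) = col U i \<bullet>c col U j"
    using assms by (intro adjoint_mult_entry)
  thus ?thesis using assms unitary_matD[OF assms(1,2)] by auto
qed

text \<open>The block diagonal matrix with corner \<open>c\<close> and block \<open>A\<close>, the
  shape to which the inductive step of the singular value decomposition reduces a matrix of size N +
  1.\<close>

definition border :: "nat \<Rightarrow> complex \<Rightarrow> complex mat \<Rightarrow> complex mat" where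
  "border N c A = four_block_mat (mat 1 1 (\<lambda>_. c)) (0\<^sub>m 1 N) (0\<^sub>m N 1) A"

lemma border_carrier [simp]: "A \<in> cmat N \<Longrightarrow> border N c A \<in> cmat (Suc N)"
  unfolding border_def using four_block_carrier_mat[of "mat 1 1 (\<lambda>_. c)" 1 1 A N N] by simp

lemma border_mult:
  assumes "A \<in> cmat N" "B \<in> cmat N"
  shows "border N c A * border N d B = border N (c * d) (A * B)"
proof -
  have *: "mat 1 1 (\<lambda>_. c) * mat 1 1 (\<lambda>_. d) = mat 1 1 (\<lambda>_. c * d)"
    by (rule eq_matI) (auto simp: scalar_prod_def)
  show ?thesis unfolding border_def
    by (subst mult_four_block_mat[of _ 1 1 _ N _ N _ _ 1 _ N])
       (use assms * in \<open>auto simp: left_add_zero_mat[of _ 1 1] left_add_zero_mat[of _ N N] right_add_zero_mat[of _ 1 1]\<close>)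
qed

lemma border_adjoint:
  "A \<in> cmat N \<Longrightarrow> adj (border N c A) = border N (cnj c) (adj A)"
  by (rule eq_matI) (auto simp: border_def)

lemma border_one: "border N 1 (1\<^sub>m N) = 1\<^sub>m (Suc N)"
  by (rule eq_matI) (auto simp: border_def)

lemma border_unitary:
  assumes "unitary_mat U" "U \<in> cmat N"
  shows "unitary_mat (border N 1 U)"
  by (rule unitary_matI[of _ "Suc N"])
     (use assms unitary_matD[OF assms] in \<open>simp_all add: border_adjoint border_mult border_one\<close>)

lemma border_mat_diag:
  "border N c (mat_diag N d) = mat_diag (Suc N) (case_nat c d)"
  by (rule eq_matI) (auto simp: border_def mat_diag_def split: nat.splits)

text \<open>\<open>v\<close> is a unit eigenvector of \<open>adj X * X\<close>, and \<open>u\<close>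
  is the normalized image of \<open>v\<close> under \<open>X\<close>. If that image vanishes,
  \<open>X\<close> is singular, hence so is its adjoint, and a unit kernel vector of the adjoint
  serves as \<open>u\<close>. The scalar \<open>t\<close> expresses that \<open>adj X\<close> maps
  \<open>u\<close> to a multiple of \<open>v\<close>.\<close>

lemma singular_vector_pair:
  assumes X: "X \<in> cmat N" and N: "N > 0"
  obtains u v s t where "u \<in> cvec N" "v \<in> cvec N" "u \<bullet>c u = 1" "v \<bullet>c v = 1"
    "s \<ge> 0" "X *\<^sub>v v = complex_of_real s \<cdot>\<^sub>v u" "adj X *\<^sub>v u = t \<cdot>\<^sub>v v"
proof -
  have H: "adj X * X \<in> cmat N" using X by auto
  obtain e where "e \<in> spectrum (adj X * X)" using spectrum_non_empty[OF H N] by auto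
  then obtain v0 where "eigenvector (adj X * X) v0 e"
    by (auto simp: spectrum_def eigenvalue_def)
  hence v0: "v0 \<in> cvec N" "v0 \<noteq> 0\<^sub>v N" "(adj X * X) *\<^sub>v v0 = e \<cdot>\<^sub>v v0"
    using X by (auto simp: eigenvector_def)
  obtain a where a: "a > 0" "(complex_of_real a \<cdot>\<^sub>v v0) \<bullet>c (complex_of_real a \<cdot>\<^sub>v v0) = 1"
    using normalize_vec[OF v0(1,2)] .
  define v where "v = complex_of_real a \<cdot>\<^sub>v v0"
  have v: "v \<in> cvec N" "v \<bullet>c v = 1" using v0 a by (auto simp: v_def)
  have "(adj X * X) *\<^sub>v v = e \<cdot>\<^sub>v v"
    unfolding v_def using v0 X H by (simp add: mult_mat_vec[of _ N N] smult_smult_assoc mult.commute)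
  hence ev: "adj X *\<^sub>v (X *\<^sub>v v) = e \<cdot>\<^sub>v v"
    using X v by (simp add: assoc_mult_mat_vec[of _ N N _ N])
  show thesis
  proof (cases "X *\<^sub>v v = 0\<^sub>v N")
    case True
    have "v \<noteq> 0\<^sub>v N" using v by auto
    hence "det X = 0" using True v det_0_iff_vec_prod_zero[OF X] by auto
    have "det (adj X) = 0"
    proof (rule ccontr)
      assume "det (adj X) \<noteq> 0"
      then obtain B where B: "B \<in> cmat N" "B * adj X = 1\<^sub>m N"
        using det_non_zero_imp_unit[of "adj X" N "()"] X by (auto simp: Units_def ring_mat_def)
      hence "adj (B * adj X) = 1\<^sub>m N" by simp
      hence *: "X * adj B = 1\<^sub>m N" using X B by (subst (asm) mat_adjoint_mult[of _ N N _ N]) auto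
      have "det X * det (adj B) = 1"
        using X B det_mult[of X N "adj B"] * by simp
      thus False using \<open>det X = 0\<close> by simp
    qed
    then obtain w where w: "w \<in> cvec N" "w \<noteq> 0\<^sub>v N" "adj X *\<^sub>v w = 0\<^sub>v N"
      using det_0_iff_vec_prod_zero[of "adj X" N] X by auto
    obtain b where b: "b > 0" "(complex_of_real b \<cdot>\<^sub>v w) \<bullet>c (complex_of_real b \<cdot>\<^sub>v w) = 1"
      using normalize_vec[OF w(1,2)] .
    show thesis
      by (rule that[of "complex_of_real b \<cdot>\<^sub>v w" v 0 0])
         (use True v w b X in \<open>auto simp: mult_mat_vec[of _ N N]\<close>)
  next
    case False
    have y: "X *\<^sub>v v \<in> cvec N" using X v by auto
    obtain b where b: "b > 0"
      "(complex_of_real b \<cdot>\<^sub>v (X *\<^sub>v v)) \<bullet>c (complex_of_real b \<cdot>\<^sub>v (X *\<^sub>v v)) = 1"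
      using normalize_vec[OF y False] .
    have "X *\<^sub>v v = complex_of_real (1 / b) \<cdot>\<^sub>v (complex_of_real b \<cdot>\<^sub>v (X *\<^sub>v v))"
      using b(1) by (simp add: smult_smult_assoc)
    moreover have "adj X *\<^sub>v (complex_of_real b \<cdot>\<^sub>v (X *\<^sub>v v)) = (complex_of_real b * e) \<cdot>\<^sub>v v"
      using ev X v by (simp add: mult_mat_vec[of _ N N] smult_smult_assoc)
    ultimately show thesis
      by (intro that[of "complex_of_real b \<cdot>\<^sub>v (X *\<^sub>v v)" v "1 / b" "complex_of_real b * e"])
         (use b v y in auto)
  qed
qed

text \<open>Complete \<open>u\<close> and \<open>v\<close> to unitaries \<open>U\<close> and
  \<open>V\<close>. In \<open>adj U * X * V\<close> the relation for \<open>X *\<^sub>v v\<close>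
  clears the first column below the corner, the relation for \<open>adj X *\<^sub>v u\<close> clears
  the first row, and the induction hypothesis treats the remaining block.\<close>

lemma singular_value_decomposition_unsorted:
  "X \<in> cmat N \<Longrightarrow> \<exists>U \<in> cmat N. \<exists>V \<in> cmat N. \<exists>d. unitary_mat U \<and> unitary_mat V \<and>
     (\<forall>i. 0 \<le> d i) \<and> X = U * real_diag N d * adj V"
proof (induction N arbitrary: X)
  case 0
  show ?case
    by (rule bexI[of _ "1\<^sub>m 0"], rule bexI[of _ "1\<^sub>m 0"], rule exI[of _ "\<lambda>_. 0"])
       (use 0 in \<open>auto simp: mat_diag_def intro!: eq_matI\<close>)
next
  case (Suc N)
  let ?N = "Suc N"
  note X = Suc.prems
  obtain u v s t where uv: "u \<in> carrier_vec ?N" "v \<in> carrier_vec ?N" "u \<bullet>c u = 1" "v \<bullet>c v = 1"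
    and s: "s \<ge> 0" and Xv: "X *\<^sub>v v = complex_of_real s \<cdot>\<^sub>v u" and Xu: "adj X *\<^sub>v u = t \<cdot>\<^sub>v v"
    by (rule singular_vector_pair[OF X zero_less_Suc])
  obtain U where U: "U \<in> cmat ?N" "unitary_mat U" "col U 0 = u"
    using orthonormal_completion[of 1 "\<lambda>_. u" ?N] uv by auto
  obtain V where V: "V \<in> cmat ?N" "unitary_mat V" "col V 0 = v"
    using orthonormal_completion[of 1 "\<lambda>_. v" ?N] uv by auto
  define Y where "Y = adj U * (X * V)"
  have Y: "Y \<in> cmat ?N" using U X V by (auto simp: Y_def)
  have Yij: "Y $$ (i, j) = (X *\<^sub>v col V j) \<bullet>c col U i" if "i < ?N" "j < ?N" for i j
    unfolding Y_def col_mult2[OF X V(1) that(2), symmetric] using U V X that by (intro adjoint_mult_entry) auto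
  have Y0: "Y $$ (i, 0) = (if i = 0 then complex_of_real s else 0)" if "i < ?N" for i
    using unitary_cols[OF U(2,1), of 0 i] that U V Xv uv by (auto simp: Yij)
  have Y1: "Y $$ (0, j) = 0" if j: "j < ?N" "j \<noteq> 0" for j
  proof -
    have "Y $$ (0, j) = col V j \<bullet>c (adj X *\<^sub>v u)"
      using j U V X uv by (subst Yij) (auto intro!: cscalar_mult_mat_vec)
    also have "\<dots> = cnj t * (col V j \<bullet>c col V 0)"
      using V uv by (simp add: Xu conjugate_smult_vec)
    also have "\<dots> = 0" using unitary_cols[OF V(2,1) j(1), of 0] j by simp
    finally show ?thesis .
  qed
  define X2 where "X2 = mat N N (\<lambda>(i, j). Y $$ (Suc i, Suc j))"
  have Yb: "Y = border N (complex_of_real s) X2"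
    by (rule eq_matI) (use Y Y0 Y1 in \<open>auto simp: border_def X2_def\<close>)
  have X2: "X2 \<in> cmat N" by (simp add: X2_def)
  obtain U2 V2 d where IH: "U2 \<in> cmat N" "V2 \<in> cmat N" "unitary_mat U2" "unitary_mat V2" "\<And>i. 0 \<le> (d i :: real)"
    "X2 = U2 * real_diag N d * adj V2"
    using Suc.IH[OF X2] by auto
  let ?D = "real_diag N d"
  let ?U = "U * border N 1 U2" and ?V = "V * border N 1 V2"
  define d' where "d' = case_nat s d"
  have D': "border N (complex_of_real s) ?D = mat_diag ?N (\<lambda>i. complex_of_real (d' i))"
    unfolding border_mat_diag d'_def by (rule arg_cong[of _ _ "mat_diag ?N"]) (auto split: nat.splits)
  have "Y = border N 1 U2 * border N (complex_of_real s) ?D * adj (border N 1 V2)"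
    using IH unfolding Yb IH(6) by (simp add: border_adjoint border_mult)
  moreover have "X = U * Y * adj V"
    unfolding Y_def using U V X
    by (simp add: unitary_cancel[of U ?N] unitary_cancel[of V ?N] cmat_assoc[where N = ?N] unitary_matD)
  ultimately have "X = ?U * mat_diag ?N (\<lambda>i. complex_of_real (d' i)) * adj ?V"
    unfolding D' using U V IH by (simp add: mat_adjoint_mult[of _ ?N ?N _ ?N] cmat_assoc[where N = ?N])
  moreover have "unitary_mat ?U" "unitary_mat ?V"
    using U V IH by (auto intro!: unitary_mult[of _ _ ?N] border_unitary)
  moreover have "0 \<le> d' i" for i using s IH by (auto simp: d'_def split: nat.splits)
  ultimately show ?case using U V IH
    by (intro bexI[of _ ?U] bexI[of _ ?V] exI[of _ d']) auto
qed

lemma diag_sandwich_entry: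
  assumes "U \<in> cmat N" "V \<in> cmat N" "i < N" "j < N"
  shows "(U * mat_diag N d * V) $$ (i, j) = (\<Sum>k<N. U $$ (i, k) * d k * V $$ (k, j))"
  using assms by (subst index_mult_mat_sum[of _ N N _ N]) (auto simp: mat_diag_mult_right[of _ N])

lemma singular_values_diag:
  assumes U: "U \<in> cmat N" "unitary_mat U" and V: "V \<in> cmat N" "unitary_mat V"
  shows "singular_values (U * mat_diag N d * adj V) =
    rev (sort (map (\<lambda>i. cmod (d i)) [0..<N]))"
proof -
  let ?D = "mat_diag N d" and ?E = "mat_diag N (\<lambda>i. complex_of_real ((cmod (d i))\<^sup>2))"
  let ?X = "U * ?D * adj V"
  have "adj ?D = mat_diag N (\<lambda>i. cnj (d i))"
    by (rule eq_matI) (auto simp: mat_diag_def)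
  hence DD: "adj ?D * ?D = ?E"
    by (simp add: complex_norm_square mult.commute del: of_real_power)
  have "adj ?X * ?X = V * (adj ?D * (adj U * (U * (?D * adj V))))"
    using U V by (simp add: mat_adjoint_mult[of _ N N _ N] cmat_assoc[where N = N])
  also have "\<dots> = V * (adj ?D * ?D * adj V)"
    using U V by (simp add: unitary_cancel[of U N] cmat_assoc[where N = N])
  also have "\<dots> = V * ?E * adj V"
    unfolding DD using V by (subst cmat_assoc[where N = N]) auto
  finally have "similar_mat (adj ?X * ?X) ?E"
    using U V unitary_matD[OF V(2,1)]
    by (intro similar_matI[of _ _ V "adj V" N]) auto
  hence "char_poly (adj ?X * ?X) = (\<Prod>a\<leftarrow>diag_mat ?E. [:- a, 1:])"
    by (subst char_poly_similar) (auto intro!: char_poly_upper_triangular[of _ N] simp: mat_diag_def upper_triangular_def)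
  also have "diag_mat ?E = map (\<lambda>i. complex_of_real ((cmod (d i))\<^sup>2)) [0..<N]"
    by (auto simp: diag_mat_def mat_diag_def intro!: nth_equalityI)
  finally have cp: "char_poly (adj ?X * ?X) = (\<Prod>a\<leftarrow>map (\<lambda>i. complex_of_real ((cmod (d i))\<^sup>2)) [0..<N]. [:- a, 1:])" .
  have pr: "proots (\<Prod>a\<leftarrow>as. [:- a, 1:]) = mset as" for as :: "complex list"
  proof (induction as)
    case (Cons a as)
    have "(\<Prod>a\<leftarrow>as. [:- a, 1:]) \<noteq> 0" by (auto simp: prod_list_zero_iff)
    thus ?case using Cons by (simp add: proots_mult del: mult_pCons_left)
  qed simp
  have "image_mset (\<lambda>z. sqrt (Re z)) (proots (char_poly (adj ?X * ?X))) =
     mset (map (\<lambda>i. cmod (d i)) [0..<N])"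
    unfolding cp pr by (simp add: image_mset.compositionality o_def)
  thus ?thesis by (simp only: singular_values_def sorted_list_of_multiset_mset)
qed

text \<open>Sorting the diagonal amounts to permuting the columns of \<open>U\<close> and
  \<open>V\<close> simultaneously; the permutation comes from the equality of multisets between the
  unsorted diagonal and its sorted list.\<close>

lemma singular_value_decomposition:
  assumes X: "X \<in> cmat N"
  obtains U V d where "U \<in> cmat N" "unitary_mat U" "V \<in> cmat N" "unitary_mat V"
    "\<forall>i<N. 0 \<le> (d i :: real)" "\<forall>i j. i \<le> j \<longrightarrow> j < N \<longrightarrow> d j \<le> d i"
    "X = U * real_diag N d * adj V"
    "singular_values X = map d [0..<N]"
proof -
  obtain U V d where U: "U \<in> cmat N" "unitary_mat U" and V: "V \<in> cmat N" "unitary_mat V"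
    and d: "\<And>i. 0 \<le> (d i :: real)" and Xeq: "X = U * real_diag N d * adj V"
    using singular_value_decomposition_unsorted[OF X] by auto
  define ys where "ys = rev (sort (map d [0..<N]))"
  have sv: "singular_values X = ys"
    unfolding Xeq ys_def using d by (subst singular_values_diag[OF U V]) auto
  have len: "length ys = N" by (simp add: ys_def)
  have "mset (map d [0..<N]) = mset ys" by (simp add: ys_def)
  hence "mset ys = mset (map d [0..<N])" by simp
  then obtain p where p: "p permutes {..<length (map d [0..<N])}" "permute_list p (map d [0..<N]) = ys"
    by (rule mset_eq_permutation)
  hence pN: "p permutes {..<N}" by simp
  have plt: "p i < N" if "i < N" for i using permutes_in_image[OF pN, of i] that by simp
  have ysi: "ys ! i = d (p i)" if "i < N" for i
    using p(2) that plt[OF that] by (auto simp: permute_list_def)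
  let ?U = "mat N N (\<lambda>(i, j). col U (p j) $ i)" and ?V = "mat N N (\<lambda>(i, j). col V (p j) $ i)"
  have inj: "p i = p j \<longleftrightarrow> i = j" for i j using permutes_inj[OF pN] by (auto dest: injD)
  have "X = ?U * mat_diag N (\<lambda>i. complex_of_real (d (p i))) * adj ?V"
  proof (rule eq_matI)
    fix i j assume "i < dim_row (?U * mat_diag N (\<lambda>i. complex_of_real (d (p i))) * adj ?V)"
      "j < dim_col (?U * mat_diag N (\<lambda>i. complex_of_real (d (p i))) * adj ?V)"
    hence ij: "i < N" "j < N" by auto
    have "X $$ (i, j) = (\<Sum>k<N. U $$ (i, k) * of_real (d k) * cnj (V $$ (j, k)))"
      unfolding Xeq using U V ij by (subst diag_sandwich_entry) auto
    also have "\<dots> = (\<Sum>k<N. U $$ (i, p k) * of_real (d (p k)) * cnj (V $$ (j, p k)))"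
      using sum.permute[OF pN, of "\<lambda>k. U $$ (i, k) * of_real (d k) * cnj (V $$ (j, k))"] by (simp add: o_def)
    also have "\<dots> = (?U * mat_diag N (\<lambda>i. complex_of_real (d (p i))) * adj ?V) $$ (i, j)"
      using U V ij plt by (subst diag_sandwich_entry) (auto intro!: sum.cong)
    finally show "X $$ (i, j) = (?U * mat_diag N (\<lambda>i. complex_of_real (d (p i))) * adj ?V) $$ (i, j)" .
  qed (use X in auto)
  moreover have "unitary_mat ?U" "unitary_mat ?V"
    using U V plt by (auto intro!: unitary_of_cols carrier_vecI simp: unitary_cols inj)
  moreover have "d (p j) \<le> d (p i)" if "i \<le> j" "j < N" for i j
  proof -
    have "sorted_wrt (\<ge>) ys" by (simp add: ys_def sorted_wrt_rev)
    hence "ys ! j \<le> ys ! i" using that len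
      by (cases "i = j") (auto simp: sorted_wrt_iff_nth_less)
    thus ?thesis using ysi that by simp
  qed
  moreover have "singular_values X = map (\<lambda>i. d (p i)) [0..<N]"
    unfolding sv using len ysi by (auto intro!: nth_equalityI)
  ultimately show thesis using d
    by (intro that[of ?U ?V "\<lambda>i. d (p i)"]) auto
qed

section \<open>Norming functionals of the Ky Fan norms\<close>

definition mtrace :: "complex mat \<Rightarrow> complex" where
  "mtrace A = (\<Sum>i<dim_row A. A $$ (i, i))"

lemma mtrace_comm:
  assumes "A \<in> cmat N" "B \<in> cmat N"
  shows "mtrace (A * B) = mtrace (B * A)"
proof -
  have "mtrace (A * B) = (\<Sum>i<N. \<Sum>j<N. A $$ (i, j) * B $$ (j, i))"
    using assms by (auto simp: mtrace_def index_mult_mat_sum[of _ N N _ N] simp del: index_mult_mat(1) intro!: sum.cong)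
  also have "\<dots> = (\<Sum>j<N. \<Sum>i<N. B $$ (j, i) * A $$ (i, j))"
    by (subst sum.swap) (simp add: mult.commute)
  also have "\<dots> = mtrace (B * A)"
    using assms by (auto simp: mtrace_def index_mult_mat_sum[of _ N N _ N] simp del: index_mult_mat(1) intro!: sum.cong)
  finally show ?thesis .
qed

lemma mtrace_add:
  assumes "A \<in> cmat N" "B \<in> cmat N"
  shows "mtrace (A + B) = mtrace A + mtrace B"
  using assms by (auto simp: mtrace_def sum.distrib)

definition partial_id :: "nat \<Rightarrow> nat \<Rightarrow> complex mat" where
  "partial_id N k = mat_diag N (\<lambda>i. if i < k then 1 else 0)"

lemma partial_id_carrier [simp]: "partial_id N k \<in> cmat N"
  by (simp add: partial_id_def)

text \<open>For k \<le> N these have k singular values 1 and the others 0. The maximum of Re tr (W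
  X) over them is the Ky Fan k-norm of X, so they are the norming functionals.\<close>

definition partial_isometry :: "nat \<Rightarrow> nat \<Rightarrow> complex mat \<Rightarrow> bool" where
  "partial_isometry N k W \<longleftrightarrow> (\<exists>A \<in> cmat N. \<exists>B \<in> cmat N. unitary_mat A \<and> unitary_mat B \<and>
     W = A * partial_id N k * B)"

lemma partial_isometry_carrier: "partial_isometry N k W \<Longrightarrow> W \<in> cmat N"
  by (auto simp: partial_isometry_def)

lemma partial_isometry_unitary:
  assumes "partial_isometry N k W" "U \<in> cmat N" "unitary_mat U" "V \<in> cmat N" "unitary_mat V"
  shows "partial_isometry N k (U * W * V)"
proof -
  obtain A B where "A \<in> cmat N" "B \<in> cmat N" "unitary_mat A" "unitary_mat B"
    "W = A * partial_id N k * B"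
    using assms(1) by (auto simp: partial_isometry_def)
  thus ?thesis unfolding partial_isometry_def using assms
    by (intro bexI[of _ "U * A"] bexI[of _ "B * V"])
       (auto simp: cmat_assoc[where N = N] intro!: unitary_mult[of _ _ N])
qed

lemma smult_smult_mat: "a \<cdot>\<^sub>m (b \<cdot>\<^sub>m A) = (a * b) \<cdot>\<^sub>m (A :: 'a :: semigroup_mult mat)"
  by (rule eq_matI) (auto simp: mult.assoc)

lemma one_smult_mat [simp]: "1 \<cdot>\<^sub>m A = (A :: 'a :: monoid_mult mat)"
  by (rule eq_matI) auto

lemma unitary_smult:
  assumes "U \<in> cmat N" "unitary_mat U" "cmod c = 1"
  shows "unitary_mat (c \<cdot>\<^sub>m U)"
proof (rule unitary_matI[of _ N])
  have "cnj c * c = 1" using assms(3) by (metis complex_norm_square mult.commute of_real_1 one_power2)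
  thus "adj (c \<cdot>\<^sub>m U) * (c \<cdot>\<^sub>m U) = 1\<^sub>m N"
    using assms unitary_matD[OF assms(2,1)]
    by (simp add: mat_adjoint_smult cmat_bilinear[where N = N] smult_smult_mat mult.commute)
qed (use assms in auto)

lemma partial_isometry_smult:
  assumes "partial_isometry N k W" "cmod c = 1"
  shows "partial_isometry N k (c \<cdot>\<^sub>m W)"
proof -
  have W: "W \<in> cmat N" using assms(1) by (rule partial_isometry_carrier)
  have "partial_isometry N k ((c \<cdot>\<^sub>m 1\<^sub>m N) * W * 1\<^sub>m N)"
    using assms by (intro partial_isometry_unitary unitary_smult[of _ N]) auto
  thus ?thesis using W by (simp add: mult_smult_assoc_mat[of _ N N _ N])
qed

lemma unitary_row_norm:
  assumes "A \<in> cmat N" "unitary_mat A" "i < N" "j < N"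
  shows "(\<Sum>l<N. A $$ (i, l) * cnj (A $$ (j, l))) = (if i = j then 1 else 0)"
proof -
  have "(A * adj A) $$ (i, j) = (\<Sum>l<N. A $$ (i, l) * cnj (A $$ (j, l)))"
    using assms by (subst index_mult_mat_sum[of _ N N _ N]) auto
  thus ?thesis using assms unitary_matD[OF assms(2,1)] by auto
qed

lemma unitary_col_norm:
  assumes "A \<in> cmat N" "unitary_mat A" "i < N" "j < N"
  shows "(\<Sum>l<N. cnj (A $$ (l, i)) * A $$ (l, j)) = (if i = j then 1 else 0)"
proof -
  have "(adj A * A) $$ (i, j) = (\<Sum>l<N. cnj (A $$ (l, i)) * A $$ (l, j))"
    using assms by (subst index_mult_mat_sum[of _ N N _ N]) auto
  thus ?thesis using assms unitary_matD[OF assms(2,1)] by auto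
qed

lemma unitary_row_norm_real:
  assumes "A \<in> cmat N" "unitary_mat A" "i < N"
  shows "(\<Sum>l<N. (cmod (A $$ (i, l)))\<^sup>2) = 1"
proof -
  have "complex_of_real (\<Sum>l<N. (cmod (A $$ (i, l)))\<^sup>2) = 1"
    using unitary_row_norm[OF assms assms(3)]
    by (simp add: complex_norm_square del: of_real_power)
  thus ?thesis using of_real_eq_1_iff by blast
qed

lemma unitary_col_norm_real:
  assumes "A \<in> cmat N" "unitary_mat A" "i < N"
  shows "(\<Sum>l<N. (cmod (A $$ (l, i)))\<^sup>2) = 1"
proof -
  have "complex_of_real (\<Sum>l<N. (cmod (A $$ (l, i)))\<^sup>2) = 1"
    using unitary_col_norm[OF assms assms(3)]
    by (simp add: complex_norm_square mult.commute del: of_real_power)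
  thus ?thesis using of_real_eq_1_iff by blast
qed

lemma partial_isometry_entry:
  assumes "A \<in> cmat N" "B \<in> cmat N" "i < N" "j < N" "k \<le> N"
  shows "(A * partial_id N k * B) $$ (i, j) = (\<Sum>l<k. A $$ (i, l) * B $$ (l, j))"
proof -
  have "(A * partial_id N k * B) $$ (i, j) =
      (\<Sum>l<N. A $$ (i, l) * (if l < k then 1 else 0) * B $$ (l, j))"
    unfolding partial_id_def using assms by (subst diag_sandwich_entry) auto
  also have "\<dots> = (\<Sum>l<k. A $$ (i, l) * B $$ (l, j))"
    using assms(5) by (intro sum.mono_neutral_cong_right) auto
  finally show ?thesis .
qed

text \<open>The numbers \<open>c i\<close> dominate the diagonal of the compressed partial isometry and are
  doubly substochastic with sum \<open>k\<close>; comparing the weighted sum with \<open>\<Sum>i<k. d i\<close>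
  is then a fractional knapsack estimate with threshold \<open>d (k - 1)\<close>.\<close>
lemma diag_norming:
  fixes d :: "nat \<Rightarrow> real"
  assumes A: "A \<in> cmat N" "unitary_mat A" and B: "B \<in> cmat N" "unitary_mat B"
    and d0: "\<And>i. i < N \<Longrightarrow> 0 \<le> d i" and dm: "\<And>i j. i \<le> j \<Longrightarrow> j < N \<Longrightarrow> d j \<le> d i"
    and k: "1 \<le> k" "k \<le> N"
  defines "M \<equiv> A * partial_id N k * B" and "D \<equiv> real_diag N d"
  shows "(\<Sum>i<N. d i * Re (M $$ (i, i))) \<le> (\<Sum>i<k. d i)"
    and "(\<Sum>i<N. d i * Re (M $$ (i, i))) = (\<Sum>i<k. d i) \<Longrightarrow> d (k - 1) > 0 \<Longrightarrow>
      adj M = M \<and> M * M = M"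
    and "(\<Sum>i<N. d i * Re (M $$ (i, i))) = (\<Sum>i<k. d i) \<Longrightarrow> d (k - 1) = 0 \<Longrightarrow>
      M * D = D \<and> D * M = D"
proof -
  define s where "s = d (k - 1)"
  \<comment> \<open>\<open>a i\<close> and \<open>b i\<close> are squared lengths of row i of
    \<open>A\<close> and column i of \<open>B\<close>, truncated to k places. \<open>e i\<close> is
    half the squared distance between that row and the conjugated column, so it measures the
    deviation of \<open>M\<close> from a matrix of the form
    \<open>A * partial_id N k * adj A\<close>.\<close>
  define a where "a i = (\<Sum>l<k. (cmod (A $$ (i, l)))\<^sup>2)" for i
  define b where "b i = (\<Sum>l<k. (cmod (B $$ (l, i)))\<^sup>2)" for i
  define c where "c i = (a i + b i) / 2" for i
  define e where "e i = (\<Sum>l<k. (cmod (A $$ (i, l) - cnj (B $$ (l, i))))\<^sup>2) / 2" for i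
  have k1: "k - 1 < N" using k by linarith
  have a1: "a i \<le> 1" if "i < N" for i
  proof -
    have "a i \<le> (\<Sum>l<N. (cmod (A $$ (i, l)))\<^sup>2)"
      unfolding a_def using k by (intro sum_mono2) auto
    thus ?thesis using unitary_row_norm_real[OF A that] by simp
  qed
  have b1: "b i \<le> 1" if "i < N" for i
  proof -
    have "b i \<le> (\<Sum>l<N. (cmod (B $$ (l, i)))\<^sup>2)"
      unfolding b_def using k by (intro sum_mono2) auto
    thus ?thesis using unitary_col_norm_real[OF B that] by simp
  qed
  have ab0: "a i \<ge> 0" "b i \<ge> 0" for i by (auto simp: a_def b_def sum_nonneg)
  have c01: "0 \<le> c i" "i < N \<Longrightarrow> c i \<le> 1" for i
    using a1[of i] b1[of i] ab0[of i] by (auto simp: c_def)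
  have e0: "e i \<ge> 0" for i by (auto simp: e_def sum_nonneg)
  have "(\<Sum>i<N. a i) = k"
    unfolding a_def using k unitary_col_norm_real[OF A] by (subst sum.swap) auto
  moreover have "(\<Sum>i<N. b i) = k"
    unfolding b_def using k unitary_row_norm_real[OF B] by (subst sum.swap) auto
  ultimately have csum: "(\<Sum>i<N. c i) = k"
    by (simp add: c_def sum.distrib flip: sum_divide_distrib)
  \<comment> \<open>Polarization; summed over l < k it shows that the real part of the i-th diagonal
    entry of \<open>M\<close> is c i - e i.\<close>
  have sq: "(cmod (z - cnj w))\<^sup>2 = (cmod z)\<^sup>2 + (cmod w)\<^sup>2 - 2 * Re (z * w)" for z w
    by (simp only: cmod_power2) (simp add: power2_eq_square algebra_simps)
  have Mii: "Re (M $$ (i, i)) = c i - e i" if "i < N" for i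
  proof -
    define S where "S = (\<Sum>l<k. Re (A $$ (i, l) * B $$ (l, i)))"
    have 1: "Re (M $$ (i, i)) = S"
      unfolding M_def partial_isometry_entry[OF A(1) B(1) that that k(2)] S_def by (rule Re_sum)
    have "2 * e i = (\<Sum>l<k. (cmod (A $$ (i, l)))\<^sup>2 + (cmod (B $$ (l, i)))\<^sup>2 - 2 * Re (A $$ (i, l) * B $$ (l, i)))"
      by (simp only: e_def sq)
    also have "\<dots> = a i + b i - 2 * S"
      by (simp only: sum.distrib sum_subtractf a_def b_def S_def flip: sum_distrib_left)
    finally have 2: "2 * e i = a i + b i - 2 * S" .
    show ?thesis using 2 unfolding 1 c_def by argo
  qed
  have split: "(\<Sum>i<N. f i) = (\<Sum>i<k. f i) + (\<Sum>i\<in>{k..<N}. f i)" for f :: "nat \<Rightarrow> real"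
    using k sum.union_disjoint[of "{..<k}" "{k..<N}" f] by (simp add: ivl_disj_un ivl_disj_int)
  \<comment> \<open>Since the \<open>c i\<close> add up to k, the threshold \<open>s\<close> can be
    subtracted from all weights at no cost. The deficit becomes a sum of three nonnegative sums, so
    equality makes every single summand vanish.\<close>
  have gap: "(\<Sum>i<k. d i) - (\<Sum>i<N. d i * Re (M $$ (i, i))) =
      (\<Sum>i<k. (d i - s) * (1 - c i)) + (\<Sum>i\<in>{k..<N}. (s - d i) * c i) + (\<Sum>i<N. d i * e i)"
  proof -
    have "(\<Sum>i<N. d i * Re (M $$ (i, i))) = (\<Sum>i<N. d i * c i) - (\<Sum>i<N. d i * e i)"
      by (simp add: Mii algebra_simps sum_subtractf)
    moreover have "(\<Sum>i<N. d i * c i) = (\<Sum>i<k. d i * c i) + (\<Sum>i\<in>{k..<N}. d i * c i)"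
      by (rule split)
    moreover have "s * (\<Sum>i<k. c i) + s * (\<Sum>i\<in>{k..<N}. c i) = s * k"
      using csum split[of c] by (simp flip: distrib_left)
    ultimately show ?thesis
      by (simp add: algebra_simps sum_subtractf sum.distrib flip: sum_distrib_left)
  qed
  have t1: "0 \<le> (d i - s) * (1 - c i)" if "i < k" for i
    using that k dm[of i "k - 1"] c01(2)[of i] by (auto simp: s_def)
  have t2: "0 \<le> (s - d i) * c i" if "i \<in> {k..<N}" for i
    using that k dm[of "k - 1" i] c01(1)[of i] by (auto simp: s_def)
  have t3: "0 \<le> d i * e i" if "i < N" for i using that d0 e0 by auto
  have n1: "(\<Sum>i<k. (d i - s) * (1 - c i)) \<ge> 0" using t1 by (auto intro!: sum_nonneg)
  have n2: "(\<Sum>i\<in>{k..<N}. (s - d i) * c i) \<ge> 0" using t2 by (intro sum_nonneg) auto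
  have n3: "(\<Sum>i<N. d i * e i) \<ge> 0" using t3 by (auto intro!: sum_nonneg)
  show "(\<Sum>i<N. d i * Re (M $$ (i, i))) \<le> (\<Sum>i<k. d i)" using gap n1 n2 n3 by linarith
  assume eq: "(\<Sum>i<N. d i * Re (M $$ (i, i))) = (\<Sum>i<k. d i)"
  have z1: "(d i - s) * (1 - c i) = 0" if "i < k" for i
  proof -
    have "(\<Sum>i<k. (d i - s) * (1 - c i)) = 0" using eq gap n1 n2 n3 by linarith
    thus ?thesis using that t1 by (subst (asm) sum_nonneg_eq_0_iff) auto
  qed
  have z2: "(s - d i) * c i = 0" if "k \<le> i" "i < N" for i
  proof -
    have "(\<Sum>i\<in>{k..<N}. (s - d i) * c i) = 0" using eq gap n1 n2 n3 by linarith
    thus ?thesis using that t2 by (subst (asm) sum_nonneg_eq_0_iff) auto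
  qed
  have z3: "d i * e i = 0" if "i < N" for i
  proof -
    have "(\<Sum>i<N. d i * e i) = 0" using eq gap n1 n2 n3 by linarith
    thus ?thesis using that t3 by (subst (asm) sum_nonneg_eq_0_iff) auto
  qed
  have AB: "A $$ (i, l) = cnj (B $$ (l, i))" if "e i = 0" "l < k" for i l
  proof -
    have "(\<Sum>l<k. (cmod (A $$ (i, l) - cnj (B $$ (l, i))))\<^sup>2) = 0" using that by (simp add: e_def)
    thus ?thesis using that by (subst (asm) sum_nonneg_eq_0_iff) auto
  qed
  have M: "M \<in> cmat N" using A B by (simp add: M_def)
  {
    assume sp: "d (k - 1) > 0"
    \<comment> \<open>Where d i = 0 the weighted term carries no information, but then i lies beyond
      the threshold, so c i = 0 and both truncated vectors vanish.\<close>
    have e00: "e i = 0" if i: "i < N" for i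
    proof (cases "d i = 0")
      case True
      hence "\<not> i \<le> k - 1" using sp dm[of i "k - 1"] k1 True by auto
      hence "k \<le> i" by linarith
      hence "c i = 0" using z2[of i] sp i True by (auto simp: s_def)
      hence "a i = 0" "b i = 0" using ab0[of i] by (auto simp: c_def)
      thus ?thesis by (auto simp: a_def b_def e_def sum_nonneg_eq_0_iff)
    qed (use z3[OF i] in auto)
    have Mij: "M $$ (i, j) = (\<Sum>l<k. A $$ (i, l) * cnj (A $$ (j, l)))" if "i < N" "j < N" for i j
      unfolding M_def partial_isometry_entry[OF A(1) B(1) that k(2)]
      using that by (auto simp: AB[OF e00] intro!: sum.cong)
    have M2: "M = A * partial_id N k * adj A"
      by (rule eq_matI) (use M A k in \<open>auto simp: Mij partial_isometry_entry simp del: index_mult_mat(1) intro!: sum.cong\<close>)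
    have adI: "adj (partial_id N k) = partial_id N k"
      by (rule eq_matI) (auto simp: partial_id_def mat_diag_def)
    have II: "partial_id N k * partial_id N k = partial_id N k"
      by (simp add: partial_id_def if_distrib cong: if_cong)
    have "adj M = M"
      unfolding M2 using A by (simp add: mat_adjoint_mult[of _ N N _ N] cmat_assoc[where N = N] adI)
    moreover have "M * M = A * (partial_id N k * partial_id N k) * adj A"
      unfolding M2 using A by (simp add: cmat_assoc[where N = N] unitary_cancel[of A N])
    ultimately show "adj M = M \<and> M * M = M" unfolding II M2[symmetric] by simp
  next
    assume sz: "d (k - 1) = 0"
    \<comment> \<open>With s = 0, a nonzero d i forces c i = 1. Row i of \<open>A\<close> and column
      i of \<open>B\<close> then live in the first k places, and the truncated sums become full
      orthonormality relations.\<close>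
    have MI: "M $$ (i, j) = (if i = j then 1 else 0) \<and> M $$ (j, i) = (if i = j then 1 else 0)"
      if i: "i < N" "d i \<noteq> 0" and j: "j < N" for i j
    proof -
      have "\<not> k - 1 < i" using i sz dm[of "k - 1" i] d0[of i] by auto
      hence ik: "i < k" using k by linarith
      hence "c i = 1" using z1[OF ik] sz i by (auto simp: s_def)
      hence ab: "a i = 1" "b i = 1" using a1[of i] b1[of i] i by (auto simp: c_def)
      have ei: "e i = 0" using z3[of i] i by auto
      have "(\<Sum>l\<in>{k..<N}. (cmod (A $$ (i, l)))\<^sup>2) = 0"
        using split[of "\<lambda>l. (cmod (A $$ (i, l)))\<^sup>2"] unitary_row_norm_real[OF A i(1)] ab by (simp add: a_def)
      hence A0: "A $$ (i, l) = 0" if "k \<le> l" "l < N" for l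
        using that by (subst (asm) sum_nonneg_eq_0_iff) auto
      have "(\<Sum>l\<in>{k..<N}. (cmod (B $$ (l, i)))\<^sup>2) = 0"
        using split[of "\<lambda>l. (cmod (B $$ (l, i)))\<^sup>2"] unitary_col_norm_real[OF B i(1)] ab by (simp add: b_def)
      hence B0: "B $$ (l, i) = 0" if "k \<le> l" "l < N" for l
        using that by (subst (asm) sum_nonneg_eq_0_iff) auto
      have "M $$ (i, j) = (\<Sum>l<k. cnj (B $$ (l, i)) * B $$ (l, j))"
        unfolding M_def partial_isometry_entry[OF A(1) B(1) i(1) j k(2)] by (simp add: AB[OF ei])
      also have "\<dots> = (\<Sum>l<N. cnj (B $$ (l, i)) * B $$ (l, j))"
        using k B0 by (intro sum.mono_neutral_left) auto
      also have "\<dots> = (if i = j then 1 else 0)" using unitary_col_norm[OF B i(1) j] .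
      finally have 1: "M $$ (i, j) = (if i = j then 1 else 0)" .
      have "M $$ (j, i) = (\<Sum>l<k. A $$ (j, l) * cnj (A $$ (i, l)))"
        unfolding M_def partial_isometry_entry[OF A(1) B(1) j i(1) k(2)] by (simp add: AB[OF ei])
      also have "\<dots> = (\<Sum>l<N. A $$ (j, l) * cnj (A $$ (i, l)))"
        using k A0 by (intro sum.mono_neutral_left) auto
      also have "\<dots> = (if i = j then 1 else 0)" using unitary_row_norm[OF A j i(1)] by auto
      finally show ?thesis using 1 by simp
    qed
    show "M * D = D \<and> D * M = D"
      unfolding D_def mat_diag_mult_left[OF M] mat_diag_mult_right[OF M]
      using MI by (auto simp: mat_diag_def intro!: eq_matI) metis+
  }
qed

text \<open>For X = U D adj V the unitary is R = U adj V, while H = V D adj V and K = U D adj U are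
  the moduli of X and of its adjoint. The first alternative belongs to a positive k-th singular
  value, the second to a vanishing one. The alternative and R, H, K depend on X alone and are fixed
  before W, which makes the norming isometries belonging to different phases comparable.\<close>

lemma ky_fan_norming:
  assumes X: "X \<in> cmat N" and k: "1 \<le> k" "k \<le> N"
  obtains R H K where "R \<in> cmat N" "unitary_mat R" "H \<in> cmat N" "K \<in> cmat N"
    and "\<And>W. partial_isometry N k W \<Longrightarrow> Re (mtrace (W * X)) \<le> ky_fan_norm k X"
    and "\<exists>W. partial_isometry N k W \<and> Re (mtrace (W * X)) = ky_fan_norm k X"
    and "(\<forall>W. partial_isometry N k W \<and> Re (mtrace (W * X)) = ky_fan_norm k X \<longrightarrow>
            adj (W * R) = W * R \<and> W * R * (W * R) = W * R) \<or>
         (\<forall>W. partial_isometry N k W \<and> Re (mtrace (W * X)) = ky_fan_norm k X \<longrightarrow>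
            W * X = H \<and> X * W = K \<and> adj W * W * X = X \<and> X * W * adj W = X)"
proof -
  obtain U V d where U: "U \<in> cmat N" "unitary_mat U" and V: "V \<in> cmat N" "unitary_mat V"
    and dd: "\<forall>i<N. 0 \<le> (d i :: real)" "\<forall>i j. i \<le> j \<longrightarrow> j < N \<longrightarrow> d j \<le> d i"
    and Xeq: "X = U * real_diag N d * adj V"
    and sv: "singular_values X = map d [0..<N]"
    by (rule singular_value_decomposition[OF X])
  have d: "\<And>i. i < N \<Longrightarrow> 0 \<le> d i" "\<And>i j. i \<le> j \<Longrightarrow> j < N \<Longrightarrow> d j \<le> d i"
    using dd by auto
  define D where "D = real_diag N d"
  have D: "D \<in> cmat N" by (simp add: D_def)
  have Xeq: "X = U * D * adj V" by (simp add: Xeq D_def)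
  have kf: "ky_fan_norm k X = (\<Sum>i<k. d i)"
    unfolding ky_fan_norm_def sv using k by (intro sum.cong) auto
  note ac = cmat_assoc[where N = N]
  have comp: thesis if "partial_isometry N k W"
    "\<And>A B. A \<in> cmat N \<Longrightarrow> unitary_mat A \<Longrightarrow> B \<in> cmat N \<Longrightarrow> unitary_mat B \<Longrightarrow>
      adj V * W * U = A * partial_id N k * B \<Longrightarrow> thesis" for W thesis
    using partial_isometry_unitary[OF that(1), of "adj V" U] that(2) U V unitary_adjoint[OF V(2)]
    by (auto simp: partial_isometry_def)
  have tr: "Re (mtrace (W * X)) = (\<Sum>i<N. d i * Re ((adj V * W * U) $$ (i, i)))"
    if W: "W \<in> cmat N" for W
  proof -
    have "mtrace (W * X) = mtrace (W * U * D * adj V)"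
      unfolding Xeq using W U V D by (simp add: ac)
    also have "\<dots> = mtrace (adj V * (W * U * D))"
      using W U V D by (intro mtrace_comm[of _ N]) auto
    also have "adj V * (W * U * D) = (adj V * W * U) * D"
      using W U V D by (simp add: ac)
    also have "mtrace \<dots> = (\<Sum>i<N. (adj V * W * U) $$ (i, i) * complex_of_real (d i))"
      unfolding D_def using W U V by (subst mat_diag_mult_right[of _ N]) (auto simp: mtrace_def simp del: index_mult_mat(1))
    finally show ?thesis by (simp add: mult.commute del: index_mult_mat(1))
  qed
  have le: "Re (mtrace (W * X)) \<le> ky_fan_norm k X" if "partial_isometry N k W" for W
  proof (rule comp[OF that])
    fix A B assume AB: "A \<in> cmat N" "unitary_mat A" "B \<in> cmat N" "unitary_mat B"
      "adj V * W * U = A * partial_id N k * B"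
    show ?thesis
      using diag_norming(1)[OF AB(1-4) d k] unfolding tr[OF partial_isometry_carrier[OF that]] kf AB(5) .
  qed
  have Weq: "W = V * (adj V * W * U) * adj U" if "W \<in> cmat N" for W
    using that U V by (simp add: ac unitary_cancel[of U N] unitary_cancel[of V N] unitary_matD[of _ N])
  have ex: "\<exists>W. partial_isometry N k W \<and> Re (mtrace (W * X)) = ky_fan_norm k X"
  proof (intro exI conjI)
    let ?W = "V * partial_id N k * adj U"
    show "partial_isometry N k ?W"
      unfolding partial_isometry_def using U V unitary_adjoint[OF U(2)]
      by (intro bexI[of _ V] bexI[of _ "adj U"]) auto
    have "adj V * ?W * U = partial_id N k"
      using U V by (simp add: ac unitary_cancel[of V N] unitary_matD[of _ N])
    hence "Re (mtrace (?W * X)) = (\<Sum>i<N. d i * (if i < k then 1 else 0))"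
      using U V by (subst tr) (auto simp: partial_id_def mat_diag_def intro!: sum.cong)
    also have "\<dots> = (\<Sum>i<k. d i)" using k by (intro sum.mono_neutral_cong_right) auto
    finally show "Re (mtrace (?W * X)) = ky_fan_norm k X" by (simp add: kf)
  qed
  \<comment> \<open>Indices start at 0, so \<open>d (k - 1)\<close> is the k-th largest singular
    value.\<close>
  have "0 \<le> d (k - 1)" using d k by auto
  hence "d (k - 1) > 0 \<or> d (k - 1) = 0" by auto
  hence dich: "(\<forall>W. partial_isometry N k W \<and> Re (mtrace (W * X)) = ky_fan_norm k X \<longrightarrow>
            adj (W * (U * adj V)) = W * (U * adj V) \<and> W * (U * adj V) * (W * (U * adj V)) = W * (U * adj V)) \<or>
         (\<forall>W. partial_isometry N k W \<and> Re (mtrace (W * X)) = ky_fan_norm k X \<longrightarrow>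
            W * X = V * D * adj V \<and> X * W = U * D * adj U \<and> adj W * W * X = X \<and> X * W * adj W = X)"
  proof
    assume pos: "d (k - 1) > 0"
    have "adj (W * (U * adj V)) = W * (U * adj V) \<and> W * (U * adj V) * (W * (U * adj V)) = W * (U * adj V)"
      if W: "partial_isometry N k W" "Re (mtrace (W * X)) = ky_fan_norm k X" for W
    proof -
      have Wc: "W \<in> cmat N" using W(1) by (rule partial_isometry_carrier)
      define M where "M = adj V * W * U"
      have M: "M \<in> cmat N" using Wc U V by (simp add: M_def)
      have MM: "adj M = M \<and> M * M = M"
      proof (rule comp[OF W(1)])
        fix A B assume AB: "A \<in> cmat N" "unitary_mat A" "B \<in> cmat N" "unitary_mat B"
          "adj V * W * U = A * partial_id N k * B"
        have eq: "(\<Sum>i<N. d i * Re ((A * partial_id N k * B) $$ (i, i))) = (\<Sum>i<k. d i)"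
          using W(2) unfolding tr[OF Wc] kf AB(5) .
        show ?thesis
          unfolding M_def AB(5) by (rule diag_norming(2)[where d = d, OF AB(1-4) d k eq pos])
      qed
      have WR: "W * (U * adj V) = V * M * adj V"
        unfolding M_def using Wc U V by (simp add: ac unitary_cancel[of V N])
      have "V * M * adj V * (V * M * adj V) = V * (M * M) * adj V"
        using M V by (simp add: ac unitary_cancel[of V N])
      thus ?thesis unfolding WR using MM M V by (simp add: mat_adjoint_mult[of _ N N _ N] ac)
    qed
    thus ?thesis by blast
  next
    assume zero: "d (k - 1) = 0"
    have "W * X = V * D * adj V \<and> X * W = U * D * adj U \<and> adj W * W * X = X \<and> X * W * adj W = X"
      if W: "partial_isometry N k W" "Re (mtrace (W * X)) = ky_fan_norm k X" for W
    proof -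
      have Wc: "W \<in> cmat N" using W(1) by (rule partial_isometry_carrier)
      define M where "M = adj V * W * U"
      have M: "M \<in> cmat N" using Wc U V by (simp add: M_def)
      have MD: "M * D = D" "D * M = D"
      proof -
        have "M * D = D \<and> D * M = D"
        proof (rule comp[OF W(1)])
          fix A B assume AB: "A \<in> cmat N" "unitary_mat A" "B \<in> cmat N" "unitary_mat B"
            "adj V * W * U = A * partial_id N k * B"
          have eq: "(\<Sum>i<N. d i * Re ((A * partial_id N k * B) $$ (i, i))) = (\<Sum>i<k. d i)"
            using W(2) unfolding tr[OF Wc] kf AB(5) .
          show ?thesis
            unfolding M_def D_def AB(5) by (rule diag_norming(3)[where d = d, OF AB(1-4) d k eq zero])
        qed
        thus "M * D = D" "D * M = D" by auto
      qed
      have "adj D = D" by (rule eq_matI) (auto simp: D_def mat_diag_def)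
      hence MD': "adj M * D = D" "D * adj M = D"
        using mat_adjoint_mult[OF D M] mat_adjoint_mult[OF M D] MD by auto
      have We: "W = V * M * adj U" unfolding M_def using Weq[OF Wc] .
      have aW: "adj W = U * adj M * adj V"
        unfolding We using M U V by (simp add: mat_adjoint_mult[of _ N N _ N] ac)
      have WX: "W * X = V * (M * D) * adj V"
        unfolding We Xeq using M U V D by (simp add: ac unitary_cancel[of U N])
      have XW: "X * W = U * (D * M) * adj U"
        unfolding We Xeq using M U V D by (simp add: ac unitary_cancel[of V N])
      have "adj W * W * X = adj W * (W * X)" using Wc X by (simp add: ac)
      also have "\<dots> = U * (adj M * D) * adj V"
        unfolding WX MD aW using M U V D by (simp add: ac unitary_cancel[of V N])
      finally have 1: "adj W * W * X = X" unfolding MD' Xeq .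
      have "X * W * adj W = U * (D * adj M) * adj V"
        unfolding XW MD aW using M U V D by (simp add: ac unitary_cancel[of U N])
      hence 2: "X * W * adj W = X" unfolding MD' Xeq .
      show ?thesis using WX XW 1 2 unfolding MD by blast
    qed
    thus ?thesis by blast
  qed
  have uR: "unitary_mat (U * adj V)" using U V unitary_adjoint[OF V(2)] by (auto intro!: unitary_mult[of _ _ N])
  show thesis
    by (rule that[OF _ uR _ _ le ex dich]) (use U V D in auto)
qed

section \<open>Orthogonality of two matrices with additive Ky Fan norm\<close>

lemma nonzero_col:
  assumes X: "X \<in> cmat N" "X \<noteq> 0\<^sub>m N N"
  shows "\<exists>j<N. col X j \<noteq> 0\<^sub>v N"
proof (rule ccontr)
  assume "\<not> (\<exists>j<N. col X j \<noteq> 0\<^sub>v N)"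
  hence "X $$ (i, j) = 0" if "i < N" "j < N" for i j
    using that X(1) by (metis carrier_matD index_col index_zero_vec(1))
  thus False using X by (auto intro!: eq_matI)
qed

lemma cnj_mult_self: "cmod w = 1 \<Longrightarrow> cnj w * w = 1"
  by (metis complex_norm_square of_real_1 one_power2 mult.commute)

text \<open>A nonzero column of \<open>P\<close> is an eigenvector, so every unit complex number
  would be an eigenvalue of \<open>G\<close>. The N + 1 roots of unity of order N + 1 already
  outnumber the eigenvalues of a matrix of size N.\<close>

lemma no_full_circle_of_projections:
  assumes N: "N > 0" and G: "G \<in> cmat N"
    and *: "\<And>w. cmod w = 1 \<Longrightarrow> \<exists>P \<in> cmat N. P \<noteq> 0\<^sub>m N N \<and> G * P = w \<cdot>\<^sub>m P"
  shows False
proof -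
  have "w \<in> spectrum G" if w: "cmod w = 1" for w
  proof -
    obtain P where P: "P \<in> cmat N" "P \<noteq> 0\<^sub>m N N" "G * P = w \<cdot>\<^sub>m P" using *[OF w] by auto
    have "\<exists>j<N. col P j \<noteq> 0\<^sub>v N" using P(1,2) by (rule nonzero_col)
    then obtain j where j: "j < N" "col P j \<noteq> 0\<^sub>v N" by auto
    have "G *\<^sub>v col P j = w \<cdot>\<^sub>v col P j"
      using P(3) col_mult2[OF G P(1) j(1)] P(1) j(1) by auto
    moreover have "col P j \<in> cvec N" using P(1) by (auto intro: carrier_vecI)
    ultimately show ?thesis using j G
      by (auto simp: spectrum_def eigenvalue_def eigenvector_def)
  qed
  hence "{z. z ^ Suc N = 1} \<subseteq> spectrum G"
    using power_eq_1_iff by blast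
  hence "card {z::complex. z ^ Suc N = 1} \<le> N"
    using card_finite_spectrum[OF G] card_mono le_trans by blast
  thus False using card_roots_unity_eq[of "Suc N"] by simp
qed

text \<open>The two alternatives of the equality case, taken for \<open>X\<close> and for
  \<open>Y\<close>, combine in three ways. Two vanishing k-th singular values give the
  orthogonality, the mixed case forces one matrix to be zero, and two positive ones are
  contradictory.\<close>

theorem ky_fan_parallel_orthogonal:
  assumes X: "X \<in> cmat N" and Y: "Y \<in> cmat N" and k: "1 \<le> k" "k \<le> N"
    and norm: "\<And>\<alpha> \<beta>. ky_fan_norm k (\<alpha> \<cdot>\<^sub>m X + \<beta> \<cdot>\<^sub>m Y) = cmod \<alpha> + cmod \<beta>"
  shows "adj X * Y = 0\<^sub>m N N" "X * adj Y = 0\<^sub>m N N"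
proof -
  note ac = cmat_assoc[where N = N]
  have z: "0 \<cdot>\<^sub>m A = 0\<^sub>m N N" if "A \<in> cmat N" for A :: "complex mat"
    using that by (auto intro!: eq_matI)
  have kX: "ky_fan_norm k X = 1" using norm[of 1 0] X Y by (simp add: z)
  have kY: "ky_fan_norm k Y = 1" using norm[of 0 1] X Y by (simp add: z)
  \<comment> \<open>The alternatives of the equality case, detached from the decomposition that
    produced them; a matrix \<open>Z\<close> of norm 1 satisfies at least one.\<close>
  define P where "P Z \<longleftrightarrow> (\<exists>R \<in> cmat N. unitary_mat R \<and> (\<forall>W. partial_isometry N k W \<and> Re (mtrace (W * Z)) = 1 \<longrightarrow>
            adj (W * R) = W * R \<and> W * R * (W * R) = W * R))" for Z
  define Q where "Q Z \<longleftrightarrow> (\<exists>H \<in> cmat N. \<exists>K \<in> cmat N. (\<forall>W. partial_isometry N k W \<and> Re (mtrace (W * Z)) = 1 \<longrightarrow>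
            W * Z = H \<and> Z * W = K \<and> adj W * W * Z = Z \<and> Z * W * adj W = Z))" for Z
  have PQ: "P Z \<or> Q Z" if "Z \<in> cmat N" "ky_fan_norm k Z = 1" for Z
    by (rule ky_fan_norming[OF that(1) k]) (unfold P_def Q_def that(2), blast)
  have le: "Re (mtrace (W * Z)) \<le> ky_fan_norm k Z" if "Z \<in> cmat N" "partial_isometry N k W" for W Z
    by (rule ky_fan_norming[OF that(1) k]) (use that(2) in blast)
  have ex: "\<exists>W. partial_isometry N k W \<and> Re (mtrace (W * Z)) = ky_fan_norm k Z" if "Z \<in> cmat N" for Z
    by (rule ky_fan_norming[OF that(1) k])
  define good where "good W w Z1 Z2 \<longleftrightarrow> partial_isometry N k W \<and> partial_isometry N k (w \<cdot>\<^sub>m W) \<and>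
     Re (mtrace (W * Z1)) = 1 \<and> Re (mtrace (w \<cdot>\<^sub>m W * Z2)) = 1" for W w Z1 Z2
  have good: "\<exists>W. good W w X Y" if w: "cmod w = 1" for w
  proof -
    have Z: "X + w \<cdot>\<^sub>m Y \<in> cmat N" using X Y by auto
    have "ky_fan_norm k (X + w \<cdot>\<^sub>m Y) = 2" using norm[of 1 w] w by simp
    then obtain W where W: "partial_isometry N k W" "Re (mtrace (W * (X + w \<cdot>\<^sub>m Y))) = 2"
      using ex[OF Z] by auto
    have Wc: "W \<in> cmat N" using W(1) by (rule partial_isometry_carrier)
    have wW: "partial_isometry N k (w \<cdot>\<^sub>m W)" using partial_isometry_smult[OF W(1) w] .
    have "W * (X + w \<cdot>\<^sub>m Y) = W * X + w \<cdot>\<^sub>m W * Y"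
      using Wc X Y by (simp add: cmat_bilinear[where N = N])
    hence "Re (mtrace (W * X)) + Re (mtrace (w \<cdot>\<^sub>m W * Y)) = 2"
      using W(2) mtrace_add[of "W * X" N "w \<cdot>\<^sub>m W * Y"] Wc X Y by simp
    moreover have "Re (mtrace (W * X)) \<le> 1" "Re (mtrace (w \<cdot>\<^sub>m W * Y)) \<le> 1"
      using le[OF X W(1)] le[OF Y wW] kX kY by auto
    ultimately have "good W w X Y" using W(1) wW unfolding good_def by linarith
    thus ?thesis ..
  qed
  \<comment> \<open>Exchanging \<open>X\<close> and \<open>Y\<close> conjugates the phase:
    \<open>cnj w\<close> times an isometry that is good for \<open>cnj w\<close> is good for
    \<open>w\<close> in the exchanged order.\<close>
  have good': "\<exists>W. good W w Y X" if w: "cmod w = 1" for w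
  proof -
    obtain W where W: "good W (cnj w) X Y" using good[of "cnj w"] w by auto
    have "w * cnj w = 1" using w by (metis complex_norm_square of_real_1 one_power2)
    hence "w \<cdot>\<^sub>m (cnj w \<cdot>\<^sub>m W) = W" by (simp add: smult_smult_mat)
    thus ?thesis using W by (auto simp: good_def intro!: exI[of _ "cnj w \<cdot>\<^sub>m W"])
  qed
  have mixed: "Z2 = 0\<^sub>m N N"
    if Z: "Z1 \<in> cmat N" "Z2 \<in> cmat N" and P1: "P Z1" and Q2: "Q Z2"
      and g: "\<And>w. cmod w = 1 \<Longrightarrow> \<exists>W. good W w Z1 Z2" for Z1 Z2
  proof -
    obtain R where R: "R \<in> cmat N" "unitary_mat R"
      "\<And>W. partial_isometry N k W \<Longrightarrow> Re (mtrace (W * Z1)) = 1 \<Longrightarrow>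
            adj (W * R) = W * R \<and> W * R * (W * R) = W * R" using P1 unfolding P_def by blast
    obtain H where H: "H \<in> cmat N" "\<And>W. partial_isometry N k W \<Longrightarrow> Re (mtrace (W * Z2)) = 1 \<Longrightarrow>
            W * Z2 = H \<and> adj W * W * Z2 = Z2" using Q2 unfolding Q_def by blast
    \<comment> \<open>p = W R is a projection, so adj W = R p. Inserting this in Z2 = adj W W Z2
      gives adj R Z2 = p W Z2 = W Z2, which equals \<open>cnj w\<close> times \<open>H\<close>. The
      left side is independent of \<open>w\<close>, and comparing w = 1 with w = -1 makes
      \<open>H\<close> vanish.\<close>
    have key: "adj R * Z2 = cnj w \<cdot>\<^sub>m H \<and> Z2 = R * (cnj w \<cdot>\<^sub>m H)" if w: "cmod w = 1" for w
    proof -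
      obtain W where W: "good W w Z1 Z2" using g[OF w] by auto
      have Wc: "W \<in> cmat N" using W unfolding good_def by (blast intro: partial_isometry_carrier)
      note ww = cnj_mult_self[OF w]
      have WR: "adj (W * R) = W * R" "W * R * (W * R) = W * R"
        using R(3) W unfolding good_def by blast+
      have *: "w \<cdot>\<^sub>m W * Z2 = H" "adj (w \<cdot>\<^sub>m W) * (w \<cdot>\<^sub>m W) * Z2 = Z2"
        using H(2) W unfolding good_def by blast+
      have "cnj w \<cdot>\<^sub>m (w \<cdot>\<^sub>m W * Z2) = W * Z2"
        using Wc Z ww by (simp add: mult_smult_assoc_mat[of _ N N _ N] smult_smult_mat)
      hence WZ: "W * Z2 = cnj w \<cdot>\<^sub>m H" using * by simp
      have "adj (w \<cdot>\<^sub>m W) * (w \<cdot>\<^sub>m W) * Z2 = adj W * (W * Z2)"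
        using Wc Z ww by (simp add: mat_adjoint_smult cmat_bilinear[where N = N] smult_smult_mat mult.commute ac)
      hence Z2: "Z2 = adj W * (W * Z2)" using * by simp
      have W': "W = (W * R) * adj R" using Wc R by (simp add: unitary_cancel[of R N])
      have aW: "adj W = R * (W * R)"
        using arg_cong[OF W', of adj] WR Wc R by (simp add: mat_adjoint_mult[of "W * R" N N _ N])
      have "adj R * Z2 = (W * R) * (W * Z2)"
        by (subst Z2) (use aW R Wc Z in \<open>simp add: ac unitary_cancel[of R N]\<close>)
      also have "W * Z2 = (W * R) * (adj R * Z2)"
        using Wc R Z by (simp add: ac unitary_cancel[of R N])
      also have "(W * R) * \<dots> = ((W * R) * (W * R)) * (adj R * Z2)"
        using Wc R Z by (simp add: ac)
      also have "\<dots> = W * Z2" unfolding WR using Wc R Z by (simp add: ac unitary_cancel[of R N])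
      finally have 1: "adj R * Z2 = cnj w \<cdot>\<^sub>m H" by (simp add: WZ)
      have "Z2 = R * (adj R * Z2)" using R Z by (simp add: unitary_cancel[of R N])
      thus ?thesis using 1 by simp
    qed
    have "adj R * Z2 = cnj 1 \<cdot>\<^sub>m H" "adj R * Z2 = cnj (- 1) \<cdot>\<^sub>m H"
      by (rule key[THEN conjunct1], simp)+
    hence "1 \<cdot>\<^sub>m H = - 1 \<cdot>\<^sub>m H" by simp
    hence "H = 0\<^sub>m N N" using H(1) by (auto simp: mat_eq_iff)
    thus ?thesis using key[of 1] R by simp
  qed
  have "adj X * Y = 0\<^sub>m N N \<and> X * adj Y = 0\<^sub>m N N"
    using PQ[OF X kX] PQ[OF Y kY]
  proof (elim disjE)
    assume "P X" "Q Y"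
    hence "Y = 0\<^sub>m N N" using mixed[OF X Y] good by blast
    thus ?thesis using X by simp
  next
    assume "Q X" "P Y"
    hence "X = 0\<^sub>m N N" using mixed[OF Y X] good' by blast
    thus ?thesis using Y by simp
  next
    assume QQ: "Q X" "Q Y"
    obtain H K where H: "H \<in> cmat N" "K \<in> cmat N" "\<And>W. partial_isometry N k W \<Longrightarrow> Re (mtrace (W * X)) = 1 \<Longrightarrow>
            W * X = H \<and> X * W = K \<and> adj W * W * X = X \<and> X * W * adj W = X"
      using QQ(1) unfolding Q_def by blast
    obtain H' K' where H': "H' \<in> cmat N" "K' \<in> cmat N" "\<And>W. partial_isometry N k W \<Longrightarrow> Re (mtrace (W * Y)) = 1 \<Longrightarrow>
            W * Y = H' \<and> Y * W = K'"
      using QQ(2) unfolding Q_def by blast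
    \<comment> \<open>\<open>adj W * W\<close> fixes \<open>X\<close>, so \<open>adj X * Y\<close>
      equals \<open>adj (W * X) * (W * Y)\<close>. Here W X = \<open>H\<close> for every
      \<open>w\<close>, whereas W Y carries the factor \<open>cnj w\<close>; the values at 1 and -1
      differ in sign, so the product is zero. The other product is treated alike from the
      right.\<close>
    have key: "adj X * Y = cnj w \<cdot>\<^sub>m (adj H * H') \<and> X * adj Y = w \<cdot>\<^sub>m (K * adj K')"
      if w: "cmod w = 1" for w
    proof -
      obtain W where W: "good W w X Y" using good[OF w] by auto
      have Wc: "W \<in> cmat N" using W unfolding good_def by (blast intro: partial_isometry_carrier)
      note ww = cnj_mult_self[OF w]
      have WX: "W * X = H" "X * W = K" "adj W * W * X = X" "X * W * adj W = X"
        using H(3) W unfolding good_def by blast+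
      have WY: "w \<cdot>\<^sub>m W * Y = H'" "Y * (w \<cdot>\<^sub>m W) = K'"
        using H'(3) W unfolding good_def by blast+
      have "cnj w \<cdot>\<^sub>m (w \<cdot>\<^sub>m W * Y) = W * Y"
        using Wc Y ww by (simp add: mult_smult_assoc_mat[of _ N N _ N] smult_smult_mat)
      hence WY1: "W * Y = cnj w \<cdot>\<^sub>m H'" using WY by simp
      have "cnj w \<cdot>\<^sub>m (Y * (w \<cdot>\<^sub>m W)) = Y * W"
        using Wc Y ww by (simp add: mult_smult_distrib[of _ N N _ N] smult_smult_mat)
      hence WY2: "Y * W = cnj w \<cdot>\<^sub>m K'" using WY by simp
      have "adj X * Y = adj (adj W * W * X) * Y" by (simp only: WX)
      also have "\<dots> = adj (W * X) * (W * Y)"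
        using Wc X Y by (simp add: mat_adjoint_mult[of _ N N _ N] ac)
      also have "\<dots> = cnj w \<cdot>\<^sub>m (adj H * H')"
        unfolding WX WY1 using H H' by (simp add: mult_smult_distrib[of _ N N _ N])
      finally have 1: "adj X * Y = cnj w \<cdot>\<^sub>m (adj H * H')" .
      have "X * adj Y = (X * W * adj W) * adj Y" by (simp only: WX(4))
      also have "\<dots> = (X * W) * adj (Y * W)"
        using Wc X Y by (simp add: mat_adjoint_mult[of _ N N _ N] ac)
      also have "\<dots> = w \<cdot>\<^sub>m (K * adj K')"
        unfolding WX WY2 using H H' by (simp add: mat_adjoint_smult mult_smult_distrib[of _ N N _ N])
      finally show ?thesis using 1 by simp
    qed
    have sgn: "A = 0\<^sub>m N N" if "A = 1 \<cdot>\<^sub>m B" "A = - 1 \<cdot>\<^sub>m B" "B \<in> cmat N" for A B :: "complex mat"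
      using that by (auto simp: mat_eq_iff)
    show ?thesis
      using sgn[of _ "adj H * H'"] sgn[of _ "K * adj K'"] key[of 1] key[of "-1"] H H' by simp
  next
    assume PP: "P X" "P Y"
    obtain R where R: "R \<in> cmat N" "unitary_mat R"
      "\<And>W. partial_isometry N k W \<Longrightarrow> Re (mtrace (W * X)) = 1 \<Longrightarrow>
            adj (W * R) = W * R \<and> W * R * (W * R) = W * R" using PP(1) unfolding P_def by blast
    obtain R' where R': "R' \<in> cmat N" "unitary_mat R'"
      "\<And>W. partial_isometry N k W \<Longrightarrow> Re (mtrace (W * Y)) = 1 \<Longrightarrow>
            adj (W * R') = W * R' \<and> W * R' * (W * R') = W * R'" using PP(2) unfolding P_def by blast
    let ?G = "adj R * R'"
    \<comment> \<open>With projections p = W R, p' = w W R' and the unitary G = adj R R', one has p'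
      = w p G. Hence p' = p' adj p' = p, and taking adjoints of p = w p G yields adj G p = w p, an
      eigenvalue equation for each unit \<open>w\<close>.\<close>
    have "False"
    proof (rule no_full_circle_of_projections[of N "adj ?G"])
      show "0 < N" using k by simp
      show "adj ?G \<in> cmat N" using R R' by simp
      fix w :: complex assume w: "cmod w = 1"
      obtain W where W: "good W w X Y" using good[OF w] by auto
      have Wc: "W \<in> cmat N" using W unfolding good_def by (blast intro: partial_isometry_carrier)
      note ww = cnj_mult_self[OF w]
      define p where "p = W * R"
      define p' where "p' = w \<cdot>\<^sub>m W * R'"
      have pc: "p \<in> cmat N" "p' \<in> cmat N" using Wc R R' by (auto simp: p_def p'_def)
      have p: "adj p = p" "p * p = p"
        using R(3) W unfolding good_def p_def by blast+
      have p': "adj p' = p'" "p' * p' = p'"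
        using R'(3) W unfolding good_def p'_def by blast+
      have Wp: "W = p * adj R" using Wc R by (simp add: p_def unitary_cancel[of R N])
      have pG: "p' = w \<cdot>\<^sub>m (p * ?G)"
        unfolding p'_def using Wc R R' pc by (subst Wp) (simp add: mult_smult_assoc_mat[of _ N N _ N] ac)
      have "p' = p' * adj p'" using p' by simp
      also have "\<dots> = p * (?G * adj ?G) * p"
        unfolding pG using pc R R' p ww
        by (simp add: mat_adjoint_smult mat_adjoint_mult[of _ N N _ N] cmat_bilinear[where N = N] smult_smult_mat ac)
      also have "?G * adj ?G = 1\<^sub>m N"
        using R R' unitary_mult[of "adj R" R' N] unitary_adjoint[of R] by (intro unitary_matD) auto
      finally have "p' = p" using pc p by simp
      hence "p = w \<cdot>\<^sub>m (p * ?G)" using pG by simp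
      from arg_cong[OF this, of "\<lambda>A. w \<cdot>\<^sub>m adj A"]
      have "w \<cdot>\<^sub>m p = adj ?G * p"
        using ww p pc R R' by (simp add: mat_adjoint_smult smult_smult_mat mult.commute mat_adjoint_mult[of p N N _ N])
      moreover have "p \<noteq> 0\<^sub>m N N"
      proof
        assume "p = 0\<^sub>m N N"
        hence "W * X = 0\<^sub>m N N" using Wp R X by simp
        thus False using W by (simp add: good_def mtrace_def)
      qed
      ultimately show "\<exists>P\<in>cmat N. P \<noteq> 0\<^sub>m N N \<and> adj ?G * P = w \<cdot>\<^sub>m P"
        using pc by (intro bexI[of _ p]) auto
    qed
    thus ?thesis ..
  qed
  thus "adj X * Y = 0\<^sub>m N N" "X * adj Y = 0\<^sub>m N N" by auto
qed

section \<open>Kronecker products and rank one matrices\<close>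

lemma div_mod_lt: "i < m * n \<Longrightarrow> i div n < m" "i < m * n \<Longrightarrow> i mod n < (n :: nat)"
  by (auto simp: less_mult_imp_div_less intro!: mod_less_divisor gr0I)

lemma kron_dim [simp]:
  "dim_row (A \<otimes>\<^sub>K B) = dim_row A * dim_row B" "dim_col (A \<otimes>\<^sub>K B) = dim_col A * dim_col B"
  by (auto simp: kronecker_product_def)

lemma kron_index:
  "i < dim_row A * dim_row B \<Longrightarrow> j < dim_col A * dim_col B \<Longrightarrow>
   (A \<otimes>\<^sub>K B) $$ (i, j) = A $$ (i div dim_row B, j div dim_col B) * B $$ (i mod dim_row B, j mod dim_col B)"
  by (simp add: kronecker_product_def)

lemma kron_carrier [simp]: "A \<in> cmat m \<Longrightarrow> B \<in> cmat n \<Longrightarrow> A \<otimes>\<^sub>K B \<in> cmat (m * n)"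
  by (intro carrier_matI) auto

lemma kron_add_left: "A \<in> cmat m \<Longrightarrow> A' \<in> cmat m \<Longrightarrow> B \<in> cmat n \<Longrightarrow>
    (A + A') \<otimes>\<^sub>K B = A \<otimes>\<^sub>K B + A' \<otimes>\<^sub>K B"
  by (rule eq_matI) (auto simp: kron_index algebra_simps div_mod_lt)

lemma kron_add_right: "A \<in> cmat m \<Longrightarrow> B \<in> cmat n \<Longrightarrow> B' \<in> cmat n \<Longrightarrow>
    A \<otimes>\<^sub>K (B + B') = A \<otimes>\<^sub>K B + A \<otimes>\<^sub>K B'"
  by (rule eq_matI) (auto simp: kron_index algebra_simps div_mod_lt)

lemma kron_smult_left: "A \<in> cmat m \<Longrightarrow> B \<in> cmat n \<Longrightarrow> (c \<cdot>\<^sub>m A) \<otimes>\<^sub>K B = c \<cdot>\<^sub>m (A \<otimes>\<^sub>K B)"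
  by (rule eq_matI) (auto simp: kron_index div_mod_lt)

lemma kron_smult_right: "A \<in> cmat m \<Longrightarrow> B \<in> cmat n \<Longrightarrow> A \<otimes>\<^sub>K (c \<cdot>\<^sub>m B) = c \<cdot>\<^sub>m (A \<otimes>\<^sub>K B)"
  by (rule eq_matI) (auto simp: kron_index div_mod_lt)

lemma kron_adjoint: "A \<in> cmat m \<Longrightarrow> B \<in> cmat n \<Longrightarrow>
    adj (A \<otimes>\<^sub>K B) = adj A \<otimes>\<^sub>K adj B"
  by (rule eq_matI) (auto simp: kron_index div_mod_lt)

lemma kron_one: "1\<^sub>m m \<otimes>\<^sub>K 1\<^sub>m n = (1\<^sub>m (m * n) :: complex mat)"
proof (rule eq_matI)
  fix i j assume "i < dim_row (1\<^sub>m (m * n) :: complex mat)" "j < dim_col (1\<^sub>m (m * n) :: complex mat)"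
  hence ij: "i < m * n" "j < m * n" by auto
  have "(i div n = j div n \<and> i mod n = j mod n) \<longleftrightarrow> i = j"
    by (metis div_mult_mod_eq)
  thus "(1\<^sub>m m \<otimes>\<^sub>K 1\<^sub>m n) $$ (i, j) = (1\<^sub>m (m * n) :: complex mat) $$ (i, j)"
    using ij by (auto simp: kron_index div_mod_lt)
qed auto

lemma sum_div_mod:
  fixes f :: "nat \<Rightarrow> nat \<Rightarrow> 'a :: comm_monoid_add"
  shows "(\<Sum>k<m * n. f (k div n) (k mod n)) = (\<Sum>i<m. \<Sum>j<n. f i j)"
proof -
  have "(\<Sum>k<m * n. f (k div n) (k mod n)) = (\<Sum>i<m. \<Sum>k\<in>{i * n..<i * n + n}. f (k div n) (k mod n))"
    by (rule sum.nat_group[symmetric])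
  also have "\<dots> = (\<Sum>i<m. \<Sum>j<n. f i j)"
  proof (rule sum.cong[OF refl])
    fix i
    have "(\<Sum>k\<in>{i * n..<i * n + n}. f (k div n) (k mod n)) = (\<Sum>j\<in>{0..<n}. f ((j + i * n) div n) ((j + i * n) mod n))"
      using sum.shift_bounds_nat_ivl[of "\<lambda>k. f (k div n) (k mod n)" 0 "i * n" n] by (simp add: add.commute)
    also have "\<dots> = (\<Sum>j<n. f i j)" unfolding atLeast0LessThan by (intro sum.cong) auto
    finally show "(\<Sum>k\<in>{i * n..<i * n + n}. f (k div n) (k mod n)) = (\<Sum>j<n. f i j)" .
  qed
  finally show ?thesis .
qed

lemma kron_mult:
  assumes "A \<in> cmat m" "A' \<in> cmat m" "B \<in> cmat n" "B' \<in> cmat n"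
  shows "(A \<otimes>\<^sub>K B) * (A' \<otimes>\<^sub>K B') = (A * A') \<otimes>\<^sub>K (B * B')"
proof (rule eq_matI)
  fix i j assume "i < dim_row ((A * A') \<otimes>\<^sub>K (B * B'))" "j < dim_col ((A * A') \<otimes>\<^sub>K (B * B'))"
  hence ij: "i < m * n" "j < m * n" using assms by auto
  note b = div_mod_lt[OF ij(1)] div_mod_lt[OF ij(2)]
  have "((A \<otimes>\<^sub>K B) * (A' \<otimes>\<^sub>K B')) $$ (i, j) =
      (\<Sum>k<m * n. (A $$ (i div n, k div n) * B $$ (i mod n, k mod n)) * (A' $$ (k div n, j div n) * B' $$ (k mod n, j mod n)))"
    using assms ij by (subst index_mult_mat_sum[of _ "m * n" "m * n" _ "m * n"]) (auto simp: kron_index)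
  also have "\<dots> = (\<Sum>k<m. \<Sum>l<n. (A $$ (i div n, k) * A' $$ (k, j div n)) * (B $$ (i mod n, l) * B' $$ (l, j mod n)))"
    by (subst sum_div_mod[of "\<lambda>k l. (A $$ (i div n, k) * B $$ (i mod n, l)) * (A' $$ (k, j div n) * B' $$ (l, j mod n))"]) (simp add: mult_ac)
  also have "\<dots> = (A * A') $$ (i div n, j div n) * (B * B') $$ (i mod n, j mod n)"
    using assms b by (simp add: index_mult_mat_sum[of _ m m _ m] index_mult_mat_sum[of _ n n _ n] sum_product del: index_mult_mat(1))
  also have "\<dots> = ((A * A') \<otimes>\<^sub>K (B * B')) $$ (i, j)"
    using assms ij by (subst kron_index) auto
  finally show "((A \<otimes>\<^sub>K B) * (A' \<otimes>\<^sub>K B')) $$ (i, j) = ((A * A') \<otimes>\<^sub>K (B * B')) $$ (i, j)" .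
qed (use assms in auto)

lemma kron_unitary:
  assumes "A \<in> cmat m" "unitary_mat A" "B \<in> cmat n" "unitary_mat B"
  shows "unitary_mat (A \<otimes>\<^sub>K B)"
  by (rule unitary_matI[of _ "m * n"])
     (use assms unitary_matD[OF assms(2,1)] unitary_matD[OF assms(4,3)] in \<open>simp_all add: kron_adjoint[of _ m _ n] kron_mult[of _ m _ _ n] kron_one\<close>)

text \<open>Here 2 \<le> k is decisive: for k = 1 the value would be the larger of the two moduli
  instead of their sum.\<close>

lemma ky_fan_two:
  assumes U: "U \<in> cmat N" "unitary_mat U" and V: "V \<in> cmat N" "unitary_mat V"
    and pq: "p < N" "q < N" "p \<noteq> q" and k: "2 \<le> k" "k \<le> N"
  shows "ky_fan_norm k (U * two_diag N p q \<alpha> \<beta> * adj V) =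
    cmod \<alpha> + cmod \<beta>"
proof -
  let ?f = "\<lambda>i. cmod (if i = p then \<alpha> else if i = q then \<beta> else 0)"
  define hi where "hi = max (cmod \<alpha>) (cmod \<beta>)"
  define lo where "lo = min (cmod \<alpha>) (cmod \<beta>)"
  define ys where "ys = hi # lo # replicate (N - 2) 0"
  have sp: "{0..<N} = insert p (insert q ({0..<N} - {p, q}))" using pq by auto
  have c: "card ({0..<N} - {p, q}) = N - 2" using pq by (subst card_Diff_subset) auto
  have "mset (map ?f [0..<N]) = image_mset ?f (mset_set {0..<N})" by simp
  also have "\<dots> = {#cmod \<alpha>, cmod \<beta>#} + image_mset ?f (mset_set ({0..<N} - {p, q}))"
    using pq by (subst sp) simp
  also have "image_mset ?f (mset_set ({0..<N} - {p, q})) = image_mset (\<lambda>_. 0) (mset_set ({0..<N} - {p, q}))"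
    by (intro image_mset_cong) auto
  also have "\<dots> = replicate_mset (N - 2) 0" by (simp add: image_mset_const_eq c)
  also have "{#cmod \<alpha>, cmod \<beta>#} + replicate_mset (N - 2) 0 = mset (rev ys)"
    by (auto simp: ys_def hi_def lo_def max_def min_def)
  finally have "sort (map ?f [0..<N]) = rev ys"
    by (intro properties_for_sort) (auto simp: ys_def hi_def lo_def sorted_wrt_rev sorted_wrt_append le_max_iff_disj)
  hence "singular_values (U * two_diag N p q \<alpha> \<beta> * adj V) = ys"
    unfolding singular_values_diag[OF U V] by simp
  hence "ky_fan_norm k (U * two_diag N p q \<alpha> \<beta> * adj V) = (\<Sum>i<k. ys ! i)"
    by (simp add: ky_fan_norm_def)
  also have "\<dots> = (\<Sum>i\<in>{0, 1}. ys ! i)"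
    using k by (intro sum.mono_neutral_right) (auto simp: ys_def nth_Cons split: nat.splits)
  also have "\<dots> = cmod \<alpha> + cmod \<beta>" by (simp add: ys_def hi_def lo_def)
  finally show ?thesis .
qed

section \<open>Rank one matrices, matrix units and test matrices with two terms\<close>

definition outer :: "complex vec \<Rightarrow> complex vec \<Rightarrow> complex mat" where
  "outer y z = mat (dim_vec y) (dim_vec z) (\<lambda>(i, j). y $ i * cnj (z $ j))"

abbreviation (input) munit :: "nat \<Rightarrow> nat \<Rightarrow> nat \<Rightarrow> complex mat" where
  "munit n i j \<equiv> outer (unit_vec n i) (unit_vec n j)"

lemma outer_carrier [simp]: "y \<in> cvec n \<Longrightarrow> z \<in> cvec n \<Longrightarrow> outer y z \<in> cmat n"
  by (auto simp: outer_def)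

lemma outer_adjoint: "adj (outer y z) = outer z y"
  by (rule eq_matI) (auto simp: outer_def)

lemma outer_smult: "outer (c \<cdot>\<^sub>v y) (d \<cdot>\<^sub>v z) = (c * cnj d) \<cdot>\<^sub>m outer y z"
  by (rule eq_matI) (auto simp: outer_def)

lemma outer_smult_left: "outer (c \<cdot>\<^sub>v y) z = c \<cdot>\<^sub>m outer y z"
  by (rule eq_matI) (auto simp: outer_def)

lemma outer_smult_right: "outer y (c \<cdot>\<^sub>v z) = cnj c \<cdot>\<^sub>m outer y z"
  by (rule eq_matI) (auto simp: outer_def)

lemma outer_add_left: "y \<in> cvec n \<Longrightarrow> y' \<in> cvec n \<Longrightarrow> outer (y + y') z = outer y z + outer y' z"
  by (rule eq_matI) (auto simp: outer_def algebra_simps)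

lemma outer_add_right: "z \<in> cvec n \<Longrightarrow> z' \<in> cvec n \<Longrightarrow> outer y (z + z') = outer y z + outer y z'"
  by (rule eq_matI) (auto simp: outer_def algebra_simps)

lemma mult_outer:
  assumes "A \<in> cmat n" "y \<in> cvec n" "z \<in> cvec n"
  shows "A * outer y z = outer (A *\<^sub>v y) z"
  by (rule eq_matI) (use assms in \<open>auto simp: outer_def scalar_prod_def sum_distrib_right mult.assoc intro!: sum.cong\<close>)

lemma outer_mult:
  assumes "A \<in> cmat n" "y \<in> cvec n" "z \<in> cvec n"
  shows "outer y z * A = outer y (adj A *\<^sub>v z)"
proof -
  have "outer y z * A = adj (adj A * outer z y)"
    using assms by (simp add: mat_adjoint_mult[of _ n n _ n] outer_adjoint)
  thus ?thesis using assms by (simp add: mult_outer[of _ n] outer_adjoint)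
qed

lemma outer_mult_vec:
  assumes "y \<in> cvec n" "z \<in> cvec n" "v \<in> cvec n"
  shows "outer y z *\<^sub>v v = (v \<bullet>c z) \<cdot>\<^sub>v y"
  by (rule eq_vecI) (use assms in \<open>auto simp: outer_def scalar_prod_def sum_distrib_left sum_distrib_right mult_ac intro!: sum.cong\<close>)

lemma cscalar_conj:
  "v \<in> cvec n \<Longrightarrow> w \<in> cvec n \<Longrightarrow> w \<bullet>c v = cnj (v \<bullet>c (w :: complex vec))"
  by (simp add: scalar_prod_c_sum[of _ n] mult.commute)

lemma unit_vec_c: "i < n \<Longrightarrow> j < n \<Longrightarrow> unit_vec n i \<bullet>c (unit_vec n j :: complex vec) = (if i = j then 1 else 0)"
  by (subst scalar_prod_c_sum[of _ n]) (auto simp: unit_vec_def if_distrib sum.delta cong: if_cong)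

lemma kron_index_lt:
  assumes "i < m" "r < (n :: nat)"
  shows "i * n + r < m * n"
proof -
  have "i * n + r < Suc i * n" using assms by simp
  also have "\<dots> \<le> m * n" using assms by (intro mult_right_mono) auto
  finally show ?thesis .
qed

text \<open>Induction on the set of entries already copied from \<open>A\<close>, where
  \<open>R S\<close> keeps the entries in \<open>S\<close>. Linear statements can thus be checked on
  matrix units without writing a double sum.\<close>

lemma mat_span_induct [consumes 1, case_names zero add smult unit]:
  assumes A: "(A :: complex mat) \<in> cmat n"
    and zero: "P (0\<^sub>m n n)"
    and add: "\<And>A B. A \<in> cmat n \<Longrightarrow> B \<in> cmat n \<Longrightarrow> P A \<Longrightarrow> P B \<Longrightarrow> P (A + B)"
    and smult: "\<And>c A. A \<in> cmat n \<Longrightarrow> P A \<Longrightarrow> P (c \<cdot>\<^sub>m A)"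
    and unit: "\<And>i j. i < n \<Longrightarrow> j < n \<Longrightarrow> P (munit n i j)"
  shows "P A"
proof -
  define R where "R S = mat n n (\<lambda>(i, j). if (i, j) \<in> S then A $$ (i, j) else 0)" for S
  have Rc: "R S \<in> cmat n" for S by (simp add: R_def)
  have "P (R S)" if "finite S" "S \<subseteq> {..<n} \<times> {..<n}" for S
    using that
  proof (induction S rule: finite_induct)
    case empty
    have "R {} = 0\<^sub>m n n" by (rule eq_matI) (auto simp: R_def)
    thus ?case using zero by simp
  next
    case (insert s S)
    obtain i j where s: "s = (i, j)" by (cases s)
    have ij: "i < n" "j < n" using insert s by auto
    have "R (insert s S) = R S + A $$ (i, j) \<cdot>\<^sub>m munit n i j"
      by (rule eq_matI) (use insert s in \<open>auto simp: R_def outer_def unit_vec_def\<close>)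
    thus ?case using insert ij by (auto intro!: add smult unit Rc)
  qed
  moreover have "R ({..<n} \<times> {..<n}) = A" by (rule eq_matI) (use A in \<open>auto simp: R_def\<close>)
  ultimately show ?thesis by (metis finite_SigmaI finite_lessThan order_refl)
qed

lemma normalized_multiple:
  assumes "v \<in> cvec n" "v \<noteq> 0\<^sub>v n"
  obtains c u where "u \<in> cvec n" "u \<bullet>c u = 1" "v = c \<cdot>\<^sub>v u" "c \<noteq> (0 :: complex)" "u = (1 / c) \<cdot>\<^sub>v v"
proof -
  obtain a where a: "a > 0" "(complex_of_real a \<cdot>\<^sub>v v) \<bullet>c (complex_of_real a \<cdot>\<^sub>v v) = 1"
    using normalize_vec[OF assms] .
  show thesis
    by (rule that[of "complex_of_real a \<cdot>\<^sub>v v" "1 / complex_of_real a"])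
       (use a assms in \<open>auto simp: smult_smult_assoc\<close>)
qed

text \<open>\<open>U\<close> and \<open>V\<close> carry the two orthonormal pairs as their first two
  columns. They are chosen before \<alpha> and \<beta>, so one pair of unitaries diagonalizes the
  whole span.\<close>

lemma two_term_decomposition:
  assumes n: "n \<ge> 2" and v: "y \<in> cvec n" "z \<in> cvec n" "y' \<in> cvec n" "z' \<in> cvec n"
    and u: "y \<bullet>c y = 1" "z \<bullet>c z = 1" "y' \<bullet>c y' = 1" "z' \<bullet>c z' = 1" "y \<bullet>c z = 0" "y' \<bullet>c z' = 0"
  obtains U V where "U \<in> cmat n" "unitary_mat U" "V \<in> cmat n" "unitary_mat V"
    "\<forall>\<alpha> \<beta>. \<alpha> \<cdot>\<^sub>m outer y y' + \<beta> \<cdot>\<^sub>m outer z z' =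
       U * two_diag n 0 1 \<alpha> \<beta> * adj V"
proof -
  have ex: "\<exists>U \<in> cmat n. unitary_mat U \<and> col U 0 = a \<and> col U 1 = b"
    if "a \<in> cvec n" "b \<in> cvec n" "a \<bullet>c a = 1" "b \<bullet>c b = 1" "a \<bullet>c b = 0" for a b :: "complex vec"
  proof -
    have "\<exists>U\<in>cmat n. unitary_mat U \<and> (\<forall>i<2. col U i = (if i = 0 then a else b))"
      using that cscalar_conj[of a n b] by (intro orthonormal_completion) (use n in auto)
    then obtain U where U: "U \<in> cmat n" "unitary_mat U" "\<forall>i<2. col U i = (if i = 0 then a else b)"
      by blast
    have "col U 0 = a" "col U 1 = b" using U(3)[rule_format, of 0] U(3)[rule_format, of 1] by simp_all
    thus ?thesis using U(1,2) by blast
  qed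
  obtain U where U: "U \<in> cmat n" "unitary_mat U" "col U 0 = y" "col U 1 = z" using ex[of y z] v u by auto
  obtain V where V: "V \<in> cmat n" "unitary_mat V" "col V 0 = y'" "col V 1 = z'" using ex[of y' z'] v u by auto
  show thesis
  proof (rule that[OF U(1,2) V(1,2)], intro allI)
    fix \<alpha> \<beta>
    show "\<alpha> \<cdot>\<^sub>m outer y y' + \<beta> \<cdot>\<^sub>m outer z z' =
       U * two_diag n 0 1 \<alpha> \<beta> * adj V" (is "?L = U * ?D * _")
    proof (rule eq_matI)
      fix i j assume "i < dim_row (U * ?D * adj V)" "j < dim_col (U * ?D * adj V)"
      hence ij: "i < n" "j < n" using U V by auto
      have "(U * ?D * adj V) $$ (i, j) =
          (\<Sum>k<n. U $$ (i, k) * (if k = 0 then \<alpha> else if k = 1 then \<beta> else 0) * cnj (V $$ (j, k)))"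
        using U V ij by (subst diag_sandwich_entry) auto
      also have "\<dots> = (\<Sum>k\<in>{0, 1}. U $$ (i, k) * (if k = 0 then \<alpha> else if k = 1 then \<beta> else 0) * cnj (V $$ (j, k)))"
        using n by (intro sum.mono_neutral_right) auto
      also have "\<dots> = ?L $$ (i, j)"
        unfolding U(3,4)[symmetric] V(3,4)[symmetric] using U(1) V(1) ij n by (simp add: outer_def)
      finally show "?L $$ (i, j) = (U * ?D * adj V) $$ (i, j)" by simp
    qed (use v U V in \<open>auto simp: outer_def\<close>)
  qed
qed

section \<open>Bilinear maps preserving orthogonality of rank one products\<close>

lemma mat_diag_kron:
  "mat_diag m f \<otimes>\<^sub>K mat_diag n g = mat_diag (m * n) (\<lambda>i. f (i div n) * (g (i mod n) :: complex))"
proof (rule eq_matI)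
  fix i j assume "i < dim_row (mat_diag (m * n) (\<lambda>i. f (i div n) * g (i mod n)))"
    "j < dim_col (mat_diag (m * n) (\<lambda>i. f (i div n) * g (i mod n)))"
  hence ij: "i < m * n" "j < m * n" by (auto simp: mat_diag_def)
  have "(i div n = j div n \<and> i mod n = j mod n) \<longleftrightarrow> i = j"
    by (metis div_mult_mod_eq)
  thus "(mat_diag m f \<otimes>\<^sub>K mat_diag n g) $$ (i, j) = mat_diag (m * n) (\<lambda>i. f (i div n) * g (i mod n)) $$ (i, j)"
    using ij by (auto simp: kron_index mat_diag_def div_mod_lt)
qed (auto simp: mat_diag_def)

lemma minus_zero_cmat [simp]: "A \<in> cmat n \<Longrightarrow> A - 0\<^sub>m n n = A"
  by (rule eq_matI) auto

lemma mat_diag_cong: "(\<And>i. i < n \<Longrightarrow> f i = g i) \<Longrightarrow> mat_diag n f = mat_diag n g"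
  by (rule eq_matI) (auto simp: mat_diag_def)

text \<open>The auxiliary vectors \<open>w\<close>, \<open>w'\<close> turn \<open>outer x x'\<close>
  into a two-term sum with second coefficient 0, so both factors are diagonalized by the same lemma.
  In the first order the coefficients sit at the diagonal positions 0 and 1, in the exchanged order
  at 0 and m.\<close>

lemma ky_fan_kron_two:
  assumes mn: "m \<ge> 2" "n \<ge> 2" and k: "2 \<le> k" "k \<le> m * n"
    and x: "x \<in> cvec m" "x' \<in> cvec m" "x \<bullet>c x = 1" "x' \<bullet>c x' = 1"
    and y: "y \<in> cvec n" "z \<in> cvec n" "y' \<in> cvec n" "z' \<in> cvec n"
    and u: "y \<bullet>c y = 1" "z \<bullet>c z = 1" "y' \<bullet>c y' = 1" "z' \<bullet>c z' = 1" "y \<bullet>c z = 0" "y' \<bullet>c z' = 0"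
  shows "ky_fan_norm k (outer x x' \<otimes>\<^sub>K (\<alpha> \<cdot>\<^sub>m outer y y' + \<beta> \<cdot>\<^sub>m outer z z')) = cmod \<alpha> + cmod \<beta>"
    and "k \<le> n * m \<Longrightarrow> ky_fan_norm k ((\<alpha> \<cdot>\<^sub>m outer y y' + \<beta> \<cdot>\<^sub>m outer z z') \<otimes>\<^sub>K outer x x') = cmod \<alpha> + cmod \<beta>"
proof -
  have ex: "\<exists>w. w \<in> cvec m \<and> w \<bullet>c w = 1 \<and> v \<bullet>c w = 0" if "v \<in> cvec m" for v :: "complex vec"
  proof (rule orthonormal_extend[of 1 "\<lambda>_. v" m])
    fix w :: "complex vec" assume w: "w \<in> cvec m" "w \<bullet>c w = 1" "\<And>i :: nat. i < 1 \<Longrightarrow> w \<bullet>c v = 0"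
    have "v \<bullet>c w = 0" using w(3)[of 0] cscalar_conj[OF w(1) that] by simp
    thus ?thesis using w by blast
  qed (use that mn in auto)
  obtain w where w: "w \<in> cvec m" "w \<bullet>c w = 1" "x \<bullet>c w = 0" using ex[OF x(1)] by blast
  obtain w' where w': "w' \<in> cvec m" "w' \<bullet>c w' = 1" "x' \<bullet>c w' = 0" using ex[OF x(2)] by blast
  obtain U1 V1 where U1: "U1 \<in> cmat m" "unitary_mat U1" and V1: "V1 \<in> cmat m" "unitary_mat V1"
    and o1: "\<forall>\<alpha> \<beta>. \<alpha> \<cdot>\<^sub>m outer x x' + \<beta> \<cdot>\<^sub>m outer w w' =
       U1 * two_diag m 0 1 \<alpha> \<beta> * adj V1"
    by (rule two_term_decomposition[OF mn(1) x(1) w(1) x(2) w'(1) x(3) w(2) x(4) w'(2) w(3) w'(3)])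
  obtain U2 V2 where U2: "U2 \<in> cmat n" "unitary_mat U2" and V2: "V2 \<in> cmat n" "unitary_mat V2"
    and o2: "\<forall>\<alpha> \<beta>. \<alpha> \<cdot>\<^sub>m outer y y' + \<beta> \<cdot>\<^sub>m outer z z' =
       U2 * two_diag n 0 1 \<alpha> \<beta> * adj V2"
    by (rule two_term_decomposition[OF mn(2) y u])
  define f where "f = (\<lambda>i :: nat. if i = 0 then 1 else 0 :: complex)"
  define g where "g = (\<lambda>i :: nat. if i = 0 then \<alpha> else if i = 1 then \<beta> else 0)"
  have f: "f = (\<lambda>i. if i = 0 then 1 else if i = 1 then 0 else 0)" by (auto simp: f_def)
  have "outer x x' = 1 \<cdot>\<^sub>m outer x x' + 0 \<cdot>\<^sub>m outer w w'"
    using x w w' by (intro eq_matI) (auto simp: outer_def)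
  also have "\<dots> = U1 * mat_diag m f * adj V1"
    unfolding f by (rule o1[rule_format])
  finally have o1: "outer x x' = U1 * mat_diag m f * adj V1" .
  have o2: "\<alpha> \<cdot>\<^sub>m outer y y' + \<beta> \<cdot>\<^sub>m outer z z' = U2 * mat_diag n g * adj V2"
    unfolding g_def by (rule o2[rule_format])
  have d: "mat_diag m f \<otimes>\<^sub>K mat_diag n g =
      two_diag (m * n) 0 1 \<alpha> \<beta>"
    unfolding mat_diag_kron
  proof (rule mat_diag_cong)
    fix i assume "i < m * n"
    show "f (i div n) * g (i mod n) = (if i = 0 then \<alpha> else if i = 1 then \<beta> else 0)"
      using mn by (cases "i < n") (auto simp: f_def g_def div_eq_0_iff)
  qed
  have e1: "outer x x' \<otimes>\<^sub>K (\<alpha> \<cdot>\<^sub>m outer y y' + \<beta> \<cdot>\<^sub>m outer z z') =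
      (U1 \<otimes>\<^sub>K U2) * (mat_diag m f \<otimes>\<^sub>K mat_diag n g) * adj (V1 \<otimes>\<^sub>K V2)"
    unfolding o1 o2 using U1 U2 V1 V2 by (simp add: kron_mult[of _ m _ _ n] kron_adjoint[of _ m _ n])
  have mn': "0 < m * n" "1 < m * n" using k by linarith+
  show "ky_fan_norm k (outer x x' \<otimes>\<^sub>K (\<alpha> \<cdot>\<^sub>m outer y y' + \<beta> \<cdot>\<^sub>m outer z z')) = cmod \<alpha> + cmod \<beta>"
    unfolding e1 d
    by (rule ky_fan_two[OF _ _ _ _ mn' _ k]) (use U1 U2 V1 V2 in \<open>auto intro: kron_unitary\<close>)
  assume k': "k \<le> n * m"
  have mn': "0 < n * m" "m < n * m" using mn by auto
  have d: "mat_diag n g \<otimes>\<^sub>K mat_diag m f =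
      mat_diag (n * m) (\<lambda>i. if i = 0 then \<alpha> else if i = m then \<beta> else 0)"
    unfolding mat_diag_kron
  proof (rule mat_diag_cong)
    fix i assume "i < n * m"
    show "g (i div m) * f (i mod m) = (if i = 0 then \<alpha> else if i = m then \<beta> else 0)"
      using mn div_mult_mod_eq[of i m] by (cases "i mod m = 0") (auto simp: f_def g_def)
  qed
  have e2: "(\<alpha> \<cdot>\<^sub>m outer y y' + \<beta> \<cdot>\<^sub>m outer z z') \<otimes>\<^sub>K outer x x' =
      (U2 \<otimes>\<^sub>K U1) * (mat_diag n g \<otimes>\<^sub>K mat_diag m f) * adj (V2 \<otimes>\<^sub>K V1)"
    unfolding o1 o2 using U1 U2 V1 V2 by (simp add: kron_mult[of _ n _ _ m] kron_adjoint[of _ n _ m])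
  show "ky_fan_norm k ((\<alpha> \<cdot>\<^sub>m outer y y' + \<beta> \<cdot>\<^sub>m outer z z') \<otimes>\<^sub>K outer x x') = cmod \<alpha> + cmod \<beta>"
    unfolding e2 d
    by (rule ky_fan_two[OF _ _ _ _ mn' _ k(1) k']) (use U1 U2 V1 V2 mn in \<open>auto intro: kron_unitary\<close>)
qed

text \<open>An abstraction of (A, B) \<mapsto> \<open>\<phi> (A \<otimes>\<^sub>K B)\<close>. The
  class is closed under exchanging the arguments and under taking adjoints inside and outside, so
  arguments can be given for one factor and one side.\<close>

locale bilinear_matrix_map =
  fixes m n N :: nat and F :: "complex mat \<Rightarrow> complex mat \<Rightarrow> complex mat"
  assumes carrier [simp]: "A \<in> cmat m \<Longrightarrow> B \<in> cmat n \<Longrightarrow> F A B \<in> cmat N"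
    and add_left: "A \<in> cmat m \<Longrightarrow> A' \<in> cmat m \<Longrightarrow> B \<in> cmat n \<Longrightarrow> F (A + A') B = F A B + F A' B"
    and add_right: "A \<in> cmat m \<Longrightarrow> B \<in> cmat n \<Longrightarrow> B' \<in> cmat n \<Longrightarrow> F A (B + B') = F A B + F A B'"
    and smult_left: "A \<in> cmat m \<Longrightarrow> B \<in> cmat n \<Longrightarrow> F (c \<cdot>\<^sub>m A) B = c \<cdot>\<^sub>m F A B"
    and smult_right: "A \<in> cmat m \<Longrightarrow> B \<in> cmat n \<Longrightarrow> F A (c \<cdot>\<^sub>m B) = c \<cdot>\<^sub>m F A B"
begin

lemma dims [simp]:
  "A \<in> cmat m \<Longrightarrow> B \<in> cmat n \<Longrightarrow> dim_row (F A B) = N"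
  "A \<in> cmat m \<Longrightarrow> B \<in> cmat n \<Longrightarrow> dim_col (F A B) = N"
  using carrier by (blast dest: carrier_matD)+

lemma swap: "bilinear_matrix_map n m N (\<lambda>A B. F B A)"
  by unfold_locales (auto simp: add_left add_right smult_left smult_right)

text \<open>Conjugating twice restores linearity. Passing to this map turns statements about X adj Y
  into statements about adj X Y.\<close>

lemma adjoint: "bilinear_matrix_map m n N (\<lambda>A B. adj (F (adj A) (adj B)))"
  by unfold_locales
     (auto simp: add_left add_right smult_left smult_right mat_adjoint_smult mat_adjoint_add[of _ m m] mat_adjoint_add[of _ n n] mat_adjoint_add[of _ N N])

lemma zero_left: "B \<in> cmat n \<Longrightarrow> F (0\<^sub>m m m) B = 0\<^sub>m N N"
proof -
  assume B: "B \<in> cmat n"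
  have "F (0\<^sub>m m m) B = F (0 \<cdot>\<^sub>m 0\<^sub>m m m) B" by simp
  also have "\<dots> = 0 \<cdot>\<^sub>m F (0\<^sub>m m m) B" using B by (intro smult_left) auto
  also have "\<dots> = 0\<^sub>m N N" using B by (intro eq_matI) auto
  finally show ?thesis .
qed

lemma zero_right: "A \<in> cmat m \<Longrightarrow> F A (0\<^sub>m n n) = 0\<^sub>m N N"
  using bilinear_matrix_map.zero_left[OF swap] .

text \<open>A scalar form, conjugate-linear in the first pair of arguments and linear in the second;
  polarization and span arguments are carried out on such entries.\<close>

definition G :: "nat \<Rightarrow> nat \<Rightarrow> complex mat \<Rightarrow> complex mat \<Rightarrow> complex mat \<Rightarrow> complex mat \<Rightarrow> complex" where
  "G a b A B C D = (adj (F A B) * F C D) $$ (a, b)"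

lemma G_linear:
  assumes "a < N" "b < N" "A \<in> cmat m" "B \<in> cmat n" "C \<in> cmat m" "D \<in> cmat n"
  shows "A' \<in> cmat m \<Longrightarrow> G a b (A + A') B C D = G a b A B C D + G a b A' B C D"
    "C' \<in> cmat m \<Longrightarrow> G a b A B (C + C') D = G a b A B C D + G a b A B C' D"
    "D' \<in> cmat n \<Longrightarrow> G a b A B C (D + D') = G a b A B C D + G a b A B C D'"
    "G a b (c \<cdot>\<^sub>m A) B C D = cnj c * G a b A B C D"
    "G a b A B (c \<cdot>\<^sub>m C) D = c * G a b A B C D"
    "G a b A B C (c \<cdot>\<^sub>m D) = c * G a b A B C D"
  using assms
  by (simp_all add: G_def add_left add_right smult_left smult_right mat_adjoint_smult mat_adjoint_add[of _ N N]
      cmat_bilinear[where N = N] del: index_mult_mat(1))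

lemma G_zero:
  assumes "a < N" "b < N"
  shows "B \<in> cmat n \<Longrightarrow> C \<in> cmat m \<Longrightarrow> D \<in> cmat n \<Longrightarrow> G a b (0\<^sub>m m m) B C D = 0"
    "A \<in> cmat m \<Longrightarrow> B \<in> cmat n \<Longrightarrow> D \<in> cmat n \<Longrightarrow> G a b A B (0\<^sub>m m m) D = 0"
    "A \<in> cmat m \<Longrightarrow> B \<in> cmat n \<Longrightarrow> C \<in> cmat m \<Longrightarrow> G a b A B C (0\<^sub>m n n) = 0"
  using assms by (simp_all add: G_def zero_left zero_right del: index_mult_mat(1))

text \<open>Both images share the first argument, since only sums with a common factor are again
  Kronecker products. The relation with the adjoint on the right-hand matrix is the same property of
  the adjoint map.\<close>

definition rank_one_orthogonal :: bool where
  "rank_one_orthogonal \<longleftrightarrow> (\<forall>x \<in> cvec m. \<forall>x' \<in> cvec m.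
     \<forall>y \<in> cvec n. \<forall>y' \<in> cvec n. \<forall>z \<in> cvec n. \<forall>z' \<in> cvec n.
     y \<bullet>c z = 0 \<longrightarrow> y' \<bullet>c z' = 0 \<longrightarrow>
     adj (F (outer x x') (outer y y')) * F (outer x x') (outer z z') = 0\<^sub>m N N)"

text \<open>Complex polarization in the first factor, performed separately in \<open>x\<close> and \<open>x'\<close>, frees
  the first factor completely: orthogonality only depends on the second one.\<close>
lemma orthogonal_right:
  assumes orth: rank_one_orthogonal
    and y: "y \<in> cvec n" "y' \<in> cvec n" "y \<bullet>c y = 1" "y' \<bullet>c y' = 1"
    and C: "C \<in> cmat n" "adj C *\<^sub>v y = 0\<^sub>v n" "C *\<^sub>v y' = 0\<^sub>v n"
    and A: "A1 \<in> cmat m" "A2 \<in> cmat m"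
  shows "adj (F A1 (outer y y')) * F A2 C = 0\<^sub>m N N"
proof -
  \<comment> \<open>A sesquilinear form with zero diagonal vanishes. The scalar \<open>s\<close> by
    which \<i> leaves the first argument is -\<i> when x is polarized and \<i> when x' is, because
    \<open>outer\<close> conjugates its second vector.\<close>
  have sesq: "e u v = 0" if u: "u \<in> cvec m" "v \<in> cvec m"
    and z: "\<And>u. u \<in> cvec m \<Longrightarrow> e u u = 0"
    and add1: "\<And>u u' v. u \<in> cvec m \<Longrightarrow> u' \<in> cvec m \<Longrightarrow> v \<in> cvec m \<Longrightarrow> e (u + u') v = e u v + e u' v"
    and add2: "\<And>u u' v. u \<in> cvec m \<Longrightarrow> u' \<in> cvec m \<Longrightarrow> v \<in> cvec m \<Longrightarrow> e v (u + u') = e v u + e v u'"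
    and sm: "\<And>u v. u \<in> cvec m \<Longrightarrow> v \<in> cvec m \<Longrightarrow> e (\<i> \<cdot>\<^sub>v u) v = s * e u v"
      "\<And>u v. u \<in> cvec m \<Longrightarrow> v \<in> cvec m \<Longrightarrow> e u (\<i> \<cdot>\<^sub>v v) = - s * e u v"
    and s: "s \<noteq> 0" for e :: "complex vec \<Rightarrow> complex vec \<Rightarrow> complex" and s u v
  proof -
    have 1: "e u v + e v u = 0"
      using z[of "u + v"] z[of u] z[of v] u by (simp add: add1 add2 add.commute)
    have "e u (\<i> \<cdot>\<^sub>v v) + e (\<i> \<cdot>\<^sub>v v) u = 0"
      using z[of "u + \<i> \<cdot>\<^sub>v v"] z[of u] z[of "\<i> \<cdot>\<^sub>v v"] u by (simp add: add1 add2 add.commute)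
    hence "s * (e v u - e u v) = 0" using u by (simp add: sm algebra_simps)
    thus ?thesis using 1 s by (simp add: eq_neg_iff_add_eq_0)
  qed
  have base: "G a b (outer x1 x1') (outer y y') (outer x2 x2') (outer z z') = 0"
    if ab: "a < N" "b < N" and x: "x1 \<in> cvec m" "x1' \<in> cvec m" "x2 \<in> cvec m" "x2' \<in> cvec m"
      and z: "z \<in> cvec n" "z' \<in> cvec n" "y \<bullet>c z = 0" "y' \<bullet>c z' = 0" for a b x1 x1' x2 x2' z z'
  proof -
    have 1: "G a b (outer u x') (outer y y') (outer v x') (outer z z') = 0"
      if "u \<in> cvec m" "v \<in> cvec m" "x' \<in> cvec m" for u v x'
    proof (rule sesq[OF that(1,2), of _ "- \<i>"])
      fix u :: "complex vec" assume "u \<in> cvec m"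
      thus "G a b (outer u x') (outer y y') (outer u x') (outer z z') = 0"
        using orth ab y z that unfolding rank_one_orthogonal_def G_def by auto
    qed (use ab y z that in \<open>simp_all add: outer_add_left[of _ m] outer_smult_left G_linear\<close>)
    show ?thesis
    proof (rule sesq[OF x(2,4), of _ "\<i>"])
      fix u :: "complex vec" assume "u \<in> cvec m"
      thus "G a b (outer x1 u) (outer y y') (outer x2 u) (outer z z') = 0" using 1 x by auto
    qed (use ab y z x in \<open>simp_all add: outer_add_right[of _ m] outer_smult_right G_linear\<close>)
  qed
  have gen: "G a b A1 (outer y y') A2 (outer z z') = 0"
    if ab: "a < N" "b < N" and z: "z \<in> cvec n" "z' \<in> cvec n" "y \<bullet>c z = 0" "y' \<bullet>c z' = 0" for a b z z'
  proof -
    have unit: "G a b A1 (outer y y') (munit m i j) (outer z z') = 0" if "i < m" "j < m" for i j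
      using A(1) by (induction A1 rule: mat_span_induct) (use that ab y z in \<open>simp_all add: G_linear G_zero base\<close>)
    show ?thesis
      using A(2) by (induction A2 rule: mat_span_induct) (use A ab y z unit in \<open>simp_all add: G_linear G_zero\<close>)
  qed
  \<comment> \<open>Projections onto the complements of \<open>y\<close> and \<open>y'\<close>. The
    hypotheses on \<open>C\<close> mean C = P C Q, and P E_ij Q is a rank one matrix built from
    vectors orthogonal to \<open>y\<close> and \<open>y'\<close>, so linearity in \<open>C\<close>
    reduces the claim to the rank one case.\<close>
  let ?P = "1\<^sub>m n - outer y y" and ?Q = "1\<^sub>m n - outer y' y'"
  have PQ: "?P \<in> cmat n" "?Q \<in> cmat n" "adj ?P = ?P" "adj ?Q = ?Q"
    using y by (auto simp: mat_adjoint_minus[of _ n n] outer_adjoint intro!: minus_carrier_mat)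
  have Py: "?P *\<^sub>v y = 0\<^sub>v n" "?Q *\<^sub>v y' = 0\<^sub>v n"
    using y by (auto simp: minus_mult_distrib_mat_vec[of _ n n] outer_mult_vec[of _ n])
  have "G a b A1 (outer y y') A2 (?P * C * ?Q) = 0" if ab: "a < N" "b < N" for a b
    using C(1)
  proof (induction C rule: mat_span_induct)
    case zero
    show ?case using PQ A y ab by (simp add: G_zero)
  next
    case (add B D)
    have "?P * (B + D) * ?Q = ?P * B * ?Q + ?P * D * ?Q"
      using add PQ by (simp add: cmat_bilinear[where N = n])
    thus ?case using add PQ A y ab by (simp add: G_linear)
  next
    case (smult c B)
    have "?P * (c \<cdot>\<^sub>m B) * ?Q = c \<cdot>\<^sub>m (?P * B * ?Q)"
      using smult PQ by (simp add: cmat_bilinear[where N = n])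
    thus ?case using smult PQ A y ab by (simp add: G_linear)
  next
    case (unit i j)
    let ?u = "?P *\<^sub>v unit_vec n i" and ?v = "?Q *\<^sub>v unit_vec n j"
    have uv: "?u \<in> cvec n" "?v \<in> cvec n" using PQ by auto
    have "?u \<bullet>c y = 0" "?v \<bullet>c y' = 0"
      using PQ y Py by (simp_all add: cscalar_mult_mat_vec[of _ n n])
    hence "y \<bullet>c ?u = 0" "y' \<bullet>c ?v = 0"
      using cscalar_conj[OF uv(1) y(1)] cscalar_conj[OF uv(2) y(2)] by simp_all
    moreover have "?P * munit n i j * ?Q = outer ?u ?v"
      using PQ by (simp add: mult_outer[of _ n] outer_mult[of _ n])
    ultimately show ?case using gen[OF ab uv] by simp
  qed
  moreover have "?P * C * ?Q = C"
  proof -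
    have "outer y y * C = outer y (0\<^sub>v n)" using C y by (simp add: outer_mult[of _ n])
    also have "\<dots> = 0\<^sub>m n n" using y by (intro eq_matI) (auto simp: outer_def)
    finally have "?P * C = C" using C y by (simp add: minus_mult_distrib_mat[of _ n n _ _ n] minus_zero_cmat)
    moreover have "C * outer y' y' = outer (0\<^sub>v n) y'" using C y by (simp add: mult_outer[of _ n])
    moreover have "\<dots> = 0\<^sub>m n n" using y by (intro eq_matI) (auto simp: outer_def)
    ultimately show ?thesis using C y by (simp add: mult_minus_distrib_mat[of _ n n _ n] minus_zero_cmat)
  qed
  ultimately have "(adj (F A1 (outer y y')) * F A2 C) $$ (a, b) = 0" if "a < N" "b < N" for a b
    using that by (simp add: G_def)
  thus ?thesis using A y C carrier[OF A(1), of "outer y y'"] carrier[OF A(2) C(1)]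
    by (intro eq_matI) (auto simp del: index_mult_mat(1))
qed

end

context bilinear_matrix_map
begin

lemma smult_both:
  "A \<in> cmat m \<Longrightarrow> B \<in> cmat n \<Longrightarrow> F (c \<cdot>\<^sub>m A) (d \<cdot>\<^sub>m B) = (c * d) \<cdot>\<^sub>m F A B"
  by (simp add: smult_left smult_right smult_smult_mat mult.commute)

text \<open>Orthogonality is insensitive to scaling, so unit vectors suffice, and a zero vector
  makes one of the two images vanish. The two conclusions are the left and right halves of the same
  norm argument.\<close>

lemma rank_one_orthogonalI:
  assumes k: "1 \<le> k" "k \<le> N"
    and norm: "\<And>x x' y z y' z' \<alpha> \<beta>. \<lbrakk>x \<in> cvec m; x' \<in> cvec m; x \<bullet>c x = 1; x' \<bullet>c x' = 1;
      y \<in> cvec n; z \<in> cvec n; y' \<in> cvec n; z' \<in> cvec n;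
      y \<bullet>c y = 1; z \<bullet>c z = 1; y' \<bullet>c y' = 1; z' \<bullet>c z' = 1; y \<bullet>c z = 0; y' \<bullet>c z' = 0\<rbrakk> \<Longrightarrow>
      ky_fan_norm k (F (outer x x') (\<alpha> \<cdot>\<^sub>m outer y y' + \<beta> \<cdot>\<^sub>m outer z z')) = cmod \<alpha> + cmod \<beta>"
  shows "rank_one_orthogonal"
    and "bilinear_matrix_map.rank_one_orthogonal m n N (\<lambda>A B. adj (F (adj A) (adj B)))"
proof -
  have main: "adj (F (outer x x') (outer y y')) * F (outer x x') (outer z z') = 0\<^sub>m N N \<and>
      F (outer x x') (outer y y') * adj (F (outer x x') (outer z z')) = 0\<^sub>m N N"
    if v: "x \<in> cvec m" "x' \<in> cvec m"
      "y \<in> cvec n" "z \<in> cvec n" "y' \<in> cvec n" "z' \<in> cvec n"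
      and o: "y \<bullet>c z = 0" "y' \<bullet>c z' = 0" for x x' y z y' z'
  proof (cases "x = 0\<^sub>v m \<or> x' = 0\<^sub>v m \<or> y = 0\<^sub>v n \<or> y' = 0\<^sub>v n \<or> z = 0\<^sub>v n \<or> z' = 0\<^sub>v n")
    case True
    have z: "outer (0\<^sub>v p) u = 0\<^sub>m p p \<and> outer u (0\<^sub>v p) = 0\<^sub>m p p" if "u \<in> cvec p" for u p
      using that by (auto simp: outer_def intro!: eq_matI)
    have "F (outer x x') (outer y y') = 0\<^sub>m N N \<or> F (outer x x') (outer z z') = 0\<^sub>m N N"
      using True v by (elim disjE) (simp_all add: z zero_left zero_right)
    thus ?thesis using v
      by (elim disjE) simp_all
  next
    case False
    hence nz: "x \<noteq> 0\<^sub>v m" "x' \<noteq> 0\<^sub>v m" "y \<noteq> 0\<^sub>v n" "z \<noteq> 0\<^sub>v n" "y' \<noteq> 0\<^sub>v n" "z' \<noteq> 0\<^sub>v n" by auto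
    obtain c1 x1 where 1: "x1 \<in> cvec m" "x1 \<bullet>c x1 = 1" "x = c1 \<cdot>\<^sub>v x1" "c1 \<noteq> 0"
      by (rule normalized_multiple[OF v(1) nz(1)]) (rule that)
    obtain c2 x2 where 2: "x2 \<in> cvec m" "x2 \<bullet>c x2 = 1" "x' = c2 \<cdot>\<^sub>v x2" "c2 \<noteq> 0"
      by (rule normalized_multiple[OF v(2) nz(2)]) (rule that)
    obtain d1 y1 where 3: "y1 \<in> cvec n" "y1 \<bullet>c y1 = 1" "y = d1 \<cdot>\<^sub>v y1" "d1 \<noteq> 0"
      by (rule normalized_multiple[OF v(3) nz(3)]) (rule that)
    obtain d2 z1 where 4: "z1 \<in> cvec n" "z1 \<bullet>c z1 = 1" "z = d2 \<cdot>\<^sub>v z1" "d2 \<noteq> 0"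
      by (rule normalized_multiple[OF v(4) nz(4)]) (rule that)
    obtain d3 y2 where 5: "y2 \<in> cvec n" "y2 \<bullet>c y2 = 1" "y' = d3 \<cdot>\<^sub>v y2" "d3 \<noteq> 0"
      by (rule normalized_multiple[OF v(5) nz(5)]) (rule that)
    obtain d4 z2 where 6: "z2 \<in> cvec n" "z2 \<bullet>c z2 = 1" "z' = d4 \<cdot>\<^sub>v z2" "d4 \<noteq> 0"
      by (rule normalized_multiple[OF v(6) nz(6)]) (rule that)
    have o': "y1 \<bullet>c z1 = 0" "y2 \<bullet>c z2 = 0"
      using o 3 4 5 6 by (simp_all add: conjugate_smult_vec)
    let ?X = "F (outer x1 x2) (outer y1 y2)" and ?Y = "F (outer x1 x2) (outer z1 z2)"
    have XY: "?X \<in> cmat N" "?Y \<in> cmat N" using 1 2 3 4 5 6 by auto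
    have eq: "F (outer x x') (outer y y') = (c1 * cnj c2 * (d1 * cnj d3)) \<cdot>\<^sub>m ?X"
      "F (outer x x') (outer z z') = (c1 * cnj c2 * (d2 * cnj d4)) \<cdot>\<^sub>m ?Y"
      unfolding 1(3) 2(3) 3(3) 4(3) 5(3) 6(3) outer_smult using 1 2 3 4 5 6 by (simp_all add: smult_both)
    have n: "ky_fan_norm k (\<alpha> \<cdot>\<^sub>m ?X + \<beta> \<cdot>\<^sub>m ?Y) = cmod \<alpha> + cmod \<beta>" for \<alpha> \<beta>
      using norm[OF 1(1) 2(1) 1(2) 2(2) 3(1) 4(1) 5(1) 6(1) 3(2) 4(2) 5(2) 6(2) o', of \<alpha> \<beta>] 1 2 3 4 5 6
      by (simp add: add_right smult_right)
    show ?thesis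
      unfolding eq using ky_fan_parallel_orthogonal[OF XY k n] XY
      by (simp add: mat_adjoint_smult cmat_bilinear[where N = N])
  qed
  show rank_one_orthogonal
    unfolding rank_one_orthogonal_def by (intro ballI impI conjunct1[OF main])
  show "bilinear_matrix_map.rank_one_orthogonal m n N (\<lambda>A B. adj (F (adj A) (adj B)))"
    unfolding bilinear_matrix_map.rank_one_orthogonal_def[OF adjoint] outer_adjoint mat_adjoint_adjoint
    by (intro ballI impI conjunct2[OF main])
qed

text \<open>The second half is the one-sided result for the adjoint map, in which \<open>y\<close>
  and \<open>y'\<close> trade places and \<open>C\<close> is replaced by its adjoint.\<close>

lemma orthogonal_right':
  assumes orth: rank_one_orthogonal
    "bilinear_matrix_map.rank_one_orthogonal m n N (\<lambda>A B. adj (F (adj A) (adj B)))"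
    and y: "y \<in> cvec n" "y' \<in> cvec n" "y \<bullet>c y = 1" "y' \<bullet>c y' = 1"
    and C: "C \<in> cmat n" "adj C *\<^sub>v y = 0\<^sub>v n" "C *\<^sub>v y' = 0\<^sub>v n"
    and A: "A1 \<in> cmat m" "A2 \<in> cmat m"
  shows "adj (F A1 (outer y y')) * F A2 C = 0\<^sub>m N N \<and>
    F A1 (outer y y') * adj (F A2 C) = 0\<^sub>m N N"
proof
  show "adj (F A1 (outer y y')) * F A2 C = 0\<^sub>m N N"
    using assms by (intro orthogonal_right)
  have "adj (adj (F (adj (adj A1)) (adj (outer y' y)))) *
      adj (F (adj (adj A2)) (adj (adj C))) = 0\<^sub>m N N"
    by (rule bilinear_matrix_map.orthogonal_right[OF adjoint orth(2) y(2,1) y(4,3)]) (use A C in auto)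
  thus "F A1 (outer y y') * adj (F A2 C) = 0\<^sub>m N N" by (simp add: outer_adjoint)
qed

end

text \<open>The form in which the norm condition enters the algebra. Orthogonality in one factor
  suffices whatever stands in the other, the two factors play symmetric roles, and multiplication by
  fixed unitaries preserves the condition.\<close>

locale orthogonal_map = bilinear_matrix_map +
  assumes orth_right: "\<lbrakk>y \<in> cvec n; y' \<in> cvec n; y \<bullet>c y = 1; y' \<bullet>c y' = 1;
      C \<in> cmat n; adj C *\<^sub>v y = 0\<^sub>v n; C *\<^sub>v y' = 0\<^sub>v n; A1 \<in> cmat m; A2 \<in> cmat m\<rbrakk> \<Longrightarrow>
      adj (F A1 (outer y y')) * F A2 C = 0\<^sub>m N N \<and>
      F A1 (outer y y') * adj (F A2 C) = 0\<^sub>m N N"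
    and orth_left: "\<lbrakk>x \<in> cvec m; x' \<in> cvec m; x \<bullet>c x = 1; x' \<bullet>c x' = 1;
      C \<in> cmat m; adj C *\<^sub>v x = 0\<^sub>v m; C *\<^sub>v x' = 0\<^sub>v m; B1 \<in> cmat n; B2 \<in> cmat n\<rbrakk> \<Longrightarrow>
      adj (F (outer x x') B1) * F C B2 = 0\<^sub>m N N \<and>
      F (outer x x') B1 * adj (F C B2) = 0\<^sub>m N N"
begin

lemma swap_orthogonal: "orthogonal_map n m N (\<lambda>A B. F B A)"
proof (intro orthogonal_map.intro orthogonal_map_axioms.intro, goal_cases)
  case 1
  show ?case by (rule swap)
next
  case (2 y y' C A1 A2)
  show ?case by (rule orth_left[OF 2])
next
  case (3 x x' C B1 B2)
  show ?case by (rule orth_right[OF 3])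
qed

lemma unitary_equivalent:
  assumes U: "U \<in> cmat N" "unitary_mat U" and V: "V \<in> cmat N" "unitary_mat V"
  shows "orthogonal_map m n N (\<lambda>A B. adj U * F A B * V)"
proof -
  have p: "adj (adj U * X * V) * (adj U * Y * V) = adj V * (adj X * Y) * V"
    "(adj U * X * V) * adj (adj U * Y * V) = adj U * (X * adj Y) * U"
    if "X \<in> cmat N" "Y \<in> cmat N" for X Y
    using that U V
    by (simp_all add: mat_adjoint_mult[of _ N N _ N] cmat_assoc[where N = N] unitary_cancel[of U N] unitary_cancel[of V N])
  have z: "adj V * 0\<^sub>m N N * V = 0\<^sub>m N N" "adj U * 0\<^sub>m N N * U = 0\<^sub>m N N"
    using U V by simp_all
  show ?thesis
  proof (intro orthogonal_map.intro orthogonal_map_axioms.intro, goal_cases)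
    case 1
    show ?case
      by unfold_locales
         (use U V in \<open>simp_all add: add_left add_right smult_left smult_right cmat_bilinear[where N = N]\<close>)
  next
    case (2 y y' C A1 A2)
    thus ?case using orth_right[OF 2] by (simp add: p z)
  next
    case (3 x x' C B1 B2)
    thus ?case using orth_left[OF 3] by (simp add: p z)
  qed
qed

end

section \<open>Simultaneous diagonalization of a maximal orthogonal family\<close>

lemma zero_cmat_vec [simp]: "v \<in> cvec N \<Longrightarrow> 0\<^sub>m N N *\<^sub>v v = 0\<^sub>v N"
  by (rule eq_vecI) auto

text \<open>\<open>u\<close> is a normalized column of \<open>X\<close>, \<open>v\<close> is the
  normalized vector \<open>adj X *\<^sub>v u\<close>, and \<open>c\<close> is the length of the
  latter. They need not be singular vectors: what counts is that \<open>u\<close> lies in the range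
  of \<open>X\<close> and \<open>v\<close> in that of its adjoint, so both are annihilated (by
  \<open>adj Y\<close> and by \<open>Y\<close>) whenever \<open>Y\<close> is orthogonal to
  \<open>X\<close> on both sides.\<close>

lemma singular_pair_of_nonzero:
  assumes X: "X \<in> cmat N" "X \<noteq> 0\<^sub>m N N"
  shows "\<exists>u v a b c. u \<in> cvec N \<and> v \<in> cvec N \<and> a \<in> cvec N \<and> b \<in> cvec N \<and>
    u \<bullet>c u = 1 \<and> v \<bullet>c v = 1 \<and> u = X *\<^sub>v a \<and> v = adj X *\<^sub>v b \<and>
    (X *\<^sub>v v) \<bullet>c u = complex_of_real c \<and> c > 0"
proof -
  have "\<exists>j<N. col X j \<noteq> 0\<^sub>v N" using X by (rule nonzero_col)
  then obtain j where j: "j < N" "col X j \<noteq> 0\<^sub>v N" by auto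
  have cj: "col X j = X *\<^sub>v unit_vec N j"
    using X(1) j(1) by (intro eq_vecI) (auto simp: scalar_prod_right_unit)
  have cc: "col X j \<in> cvec N" using X(1) by (auto intro: carrier_vecI)
  obtain r where r: "r > 0" "(complex_of_real r \<cdot>\<^sub>v col X j) \<bullet>c (complex_of_real r \<cdot>\<^sub>v col X j) = 1"
    using normalize_vec[OF cc j(2)] .
  define a where "a = complex_of_real r \<cdot>\<^sub>v unit_vec N j"
  define u where "u = X *\<^sub>v a"
  have a: "a \<in> cvec N" by (simp add: a_def)
  have u: "u \<in> cvec N" "u \<bullet>c u = 1"
    using r X(1) cc by (simp_all add: u_def a_def mult_mat_vec[of _ N N] flip: cj)
  have w: "adj X *\<^sub>v u \<in> cvec N" using X u by simp
  have "adj X *\<^sub>v u \<noteq> 0\<^sub>v N"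
  proof
    assume 0: "adj X *\<^sub>v u = 0\<^sub>v N"
    have "(X *\<^sub>v a) \<bullet>c u = a \<bullet>c (adj X *\<^sub>v u)"
      by (rule cscalar_mult_mat_vec[OF X(1) a u(1)])
    also have "\<dots> = 0" using a by (simp add: 0)
    finally show False using u(2) by (simp flip: u_def)
  qed
  then obtain s where s: "s > 0"
    "(complex_of_real s \<cdot>\<^sub>v (adj X *\<^sub>v u)) \<bullet>c (complex_of_real s \<cdot>\<^sub>v (adj X *\<^sub>v u)) = 1"
    by (rule normalize_vec[OF w])
  define b where "b = complex_of_real s \<cdot>\<^sub>v u"
  define v where "v = adj X *\<^sub>v b"
  have b: "b \<in> cvec N" using u by (simp add: b_def)
  have vs: "v = complex_of_real s \<cdot>\<^sub>v (adj X *\<^sub>v u)"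
    using X u by (simp add: v_def b_def mult_mat_vec[of _ N N])
  have v: "v \<in> cvec N" "v \<bullet>c v = 1" using s w unfolding vs by simp_all
  have inv: "adj X *\<^sub>v u = complex_of_real (1 / s) \<cdot>\<^sub>v v"
    unfolding vs using s(1) by (simp add: smult_smult_assoc)
  have "(X *\<^sub>v v) \<bullet>c u = v \<bullet>c (adj X *\<^sub>v u)"
    by (rule cscalar_mult_mat_vec[OF X(1) v(1) u(1)])
  also have "\<dots> = complex_of_real (1 / s)"
    unfolding inv using v by (simp add: conjugate_smult_vec)
  finally have f: "(X *\<^sub>v v) \<bullet>c u = complex_of_real (1 / s)" .
  show ?thesis
    by (rule exI[of _ u], rule exI[of _ v], rule exI[of _ a], rule exI[of _ b], rule exI[of _ "1 / s"],
        intro conjI u v a b f u_def v_def) (use s(1) in simp)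
qed

text \<open>\<open>N\<close> nonzero mutually orthogonal matrices of size \<open>N\<close> exhaust the space, so each has rank one.\<close>
lemma orthogonal_family_diagonalization:
  assumes X: "\<And>p. p < N \<Longrightarrow> X p \<in> cmat N" and N: "2 \<le> k" "k \<le> N"
    and norm: "\<And>p. p < N \<Longrightarrow> ky_fan_norm k (X p) = 1"
    and nz: "\<And>p. p < N \<Longrightarrow> X p \<noteq> 0\<^sub>m N N"
    and orth: "\<And>p q. p < N \<Longrightarrow> q < N \<Longrightarrow> p \<noteq> q \<Longrightarrow> adj (X p) * X q = 0\<^sub>m N N"
      "\<And>p q. p < N \<Longrightarrow> q < N \<Longrightarrow> p \<noteq> q \<Longrightarrow> X p * adj (X q) = 0\<^sub>m N N"
  shows "\<exists>U \<in> cmat N. \<exists>V \<in> cmat N. unitary_mat U \<and> unitary_mat V \<and>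
    (\<forall>p<N. adj U * X p * V = munit N p p)"
proof -
  define Q where "Q p w \<longleftrightarrow> (case w of (u, v, a, b, c) \<Rightarrow>
    u \<in> cvec N \<and> v \<in> cvec N \<and> a \<in> cvec N \<and> b \<in> cvec N \<and>
    u \<bullet>c u = 1 \<and> v \<bullet>c v = 1 \<and> u = X p *\<^sub>v a \<and> v = adj (X p) *\<^sub>v b \<and>
    (X p *\<^sub>v v) \<bullet>c u = complex_of_real c \<and> c > 0)" for p w
  have "\<exists>w. p < N \<longrightarrow> Q p w" for p
    using singular_pair_of_nonzero[OF X[of p] nz[of p]] unfolding Q_def by (cases "p < N") auto
  hence "\<forall>p. \<exists>w. p < N \<longrightarrow> Q p w" by (rule allI)
  from choice[OF this] obtain w where "\<forall>p. p < N \<longrightarrow> Q p (w p)" by (rule exE)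
  hence w: "Q p (w p)" if "p < N" for p using that by simp
  define u where "u p = fst (w p)" for p
  define v where "v p = fst (snd (w p))" for p
  define a where "a p = fst (snd (snd (w p)))" for p
  define b where "b p = fst (snd (snd (snd (w p))))" for p
  define c where "c p = snd (snd (snd (snd (w p))))" for p
  have uc: "u p \<in> cvec N" and vc: "v p \<in> cvec N" and ac: "a p \<in> cvec N"
    and bc: "b p \<in> cvec N" and u1: "u p \<bullet>c u p = 1" and v1: "v p \<bullet>c v p = 1"
    and ua: "u p = X p *\<^sub>v a p" and vb: "v p = adj (X p) *\<^sub>v b p"
    and cp: "(X p *\<^sub>v v p) \<bullet>c u p = complex_of_real (c p)" "c p > 0" if "p < N" for p
    using w[OF that] unfolding Q_def u_def v_def a_def b_def c_def by (auto split: prod.splits)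
  have Xu: "adj (X p) *\<^sub>v u q = 0\<^sub>v N" if pq: "p < N" "q < N" "p \<noteq> q" for p q
  proof -
    have "adj (X p) *\<^sub>v u q = (adj (X p) * X q) *\<^sub>v a q"
      unfolding ua[OF pq(2)] using X pq ac by (simp add: assoc_mult_mat_vec[of _ N N _ N])
    thus ?thesis using orth(1)[OF pq] ac[OF pq(2)] by simp
  qed
  have Xv: "X p *\<^sub>v v q = 0\<^sub>v N" if pq: "p < N" "q < N" "p \<noteq> q" for p q
  proof -
    have "X p *\<^sub>v v q = (X p * adj (X q)) *\<^sub>v b q"
      unfolding vb[OF pq(2)] using X pq bc by (simp add: assoc_mult_mat_vec[of _ N N _ N])
    thus ?thesis using orth(2)[OF pq] bc[OF pq(2)] by simp
  qed
  have uu: "u p \<bullet>c u q = (if p = q then 1 else 0)" if pq: "p < N" "q < N" for p q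
  proof (cases "p = q")
    case False
    have "u p \<bullet>c u q = a p \<bullet>c (adj (X p) *\<^sub>v u q)"
      by (subst ua[OF pq(1)]) (rule cscalar_mult_mat_vec[OF X[OF pq(1)] ac[OF pq(1)] uc[OF pq(2)]])
    thus ?thesis using Xu[OF pq False] ac[OF pq(1)] False by simp
  qed (use u1 pq in auto)
  have vv: "v p \<bullet>c v q = (if p = q then 1 else 0)" if pq: "p < N" "q < N" for p q
  proof (cases "p = q")
    case False
    have "v p \<bullet>c v q = b p \<bullet>c (adj (adj (X p)) *\<^sub>v v q)"
      by (subst vb[OF pq(1)]) (rule cscalar_mult_mat_vec[OF mat_adjoint_carrier[OF X[OF pq(1)]] bc[OF pq(1)] vc[OF pq(2)]])
    thus ?thesis using Xv[OF pq False] bc[OF pq(1)] False by simp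
  qed (use v1 pq in auto)
  let ?U = "mat N N (\<lambda>(i, j). u j $ i)" and ?V = "mat N N (\<lambda>(i, j). v j $ i)"
  have UV: "unitary_mat ?U" "unitary_mat ?V" "?U \<in> cmat N" "?V \<in> cmat N"
    using unitary_of_cols[of N u, OF uc uu] unitary_of_cols[of N v, OF vc vv] by auto
  have cU: "col ?U p = u p" "col ?V p = v p" if "p < N" for p
    using that uc[OF that] vc[OF that] by (auto intro!: eq_vecI)
  \<comment> \<open>In the bases of the \<open>u\<close> and the \<open>v\<close> only the entry (p,
    p) survives. The branch for \<open>q\<close> yields 0 as well; it gives the matrix the shape of
    \<open>two_diag\<close>, whose norm is known.\<close>
  have main: "adj ?U * X p * ?V = mat_diag N (\<lambda>i. if i = p then complex_of_real (c p) else if i = q then 0 else 0)"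
    if p: "p < N" for p q
  proof (rule eq_matI)
    fix i j assume "i < dim_row (mat_diag N (\<lambda>i. if i = p then complex_of_real (c p) else if i = q then 0 else 0))"
      "j < dim_col (mat_diag N (\<lambda>i. if i = p then complex_of_real (c p) else if i = q then 0 else 0))"
    hence ij: "i < N" "j < N" by (auto simp: mat_diag_def)
    have "(adj ?U * X p * ?V) $$ (i, j) = (adj ?U * (X p * ?V)) $$ (i, j)"
      using X[OF p] UV by (simp add: cmat_assoc[where N = N] del: index_mult_mat(1))
    also have "\<dots> = col (X p * ?V) j \<bullet>c col ?U i"
      using ij UV X[OF p] by (intro adjoint_mult_entry) auto
    also have "col (X p * ?V) j = X p *\<^sub>v v j"
      using col_mult2[OF X[OF p] UV(4) ij(2)] cU ij by simp
    finally have e: "(adj ?U * X p * ?V) $$ (i, j) = (X p *\<^sub>v v j) \<bullet>c u i"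
      using cU ij by simp
    have e': "(X p *\<^sub>v v j) \<bullet>c u i = v j \<bullet>c (adj (X p) *\<^sub>v u i)"
      by (rule cscalar_mult_mat_vec[OF X[OF p] vc[OF ij(2)] uc[OF ij(1)]])
    consider "i = p" "j = p" | "i \<noteq> p" | "j \<noteq> p" by blast
    thus "(adj ?U * X p * ?V) $$ (i, j) = mat_diag N (\<lambda>i. if i = p then complex_of_real (c p) else if i = q then 0 else 0) $$ (i, j)"
    proof cases
      case 1
      thus ?thesis using e cp[OF p] ij by (simp add: mat_diag_def)
    next
      case 2
      thus ?thesis using e e' Xu[OF p ij(1)] vc[OF ij(2)] ij by (simp add: mat_diag_def)
    next
      case 3
      thus ?thesis using e Xv[OF p ij(2)] uc[OF ij(1)] ij by (simp add: mat_diag_def)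
    qed
  qed (use UV X[OF p] in \<open>auto simp: mat_diag_def\<close>)
  have c1: "c p = 1" if p: "p < N" for p
  proof -
    obtain q where q: "q < N" "p \<noteq> q"
    proof (cases "p = 0")
      case True thus ?thesis using that[of 1] N by auto
    next
      case False thus ?thesis using that[of 0] N by auto
    qed
    have "X p = ?U * (adj ?U * X p * ?V) * adj ?V"
      using UV X[OF p] by (simp add: cmat_assoc[where N = N] unitary_cancel[of ?U N] unitary_cancel[of ?V N] unitary_matD[of _ N])
    hence "ky_fan_norm k (X p) = cmod (complex_of_real (c p)) + cmod 0"
      unfolding main[OF p, of q] using ky_fan_two[OF UV(3,1,4,2) p q(1,2) N, of "complex_of_real (c p)" 0] by simp
    thus ?thesis using norm[OF p] cp(2)[OF p] by simp
  qed
  have "adj ?U * X p * ?V = munit N p p" if p: "p < N" for p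
    unfolding main[OF p, of p] c1[OF p] by (rule eq_matI) (auto simp: mat_diag_def outer_def unit_vec_def)
  thus ?thesis using UV by blast
qed

section \<open>Matrix units from orthogonality\<close>

text \<open>Differences are written with the scalar -1, so that additivity and homogeneity of the
  maps under study apply as they stand.\<close>

lemma cmat_eqI_diff:
  assumes "X + (- 1) \<cdot>\<^sub>m Y = 0\<^sub>m N N" "X \<in> cmat N" "Y \<in> cmat N"
  shows "X = (Y :: complex mat)"
proof (rule eq_matI)
  fix i j assume ij: "i < dim_row Y" "j < dim_col Y"
  have "(X + (- 1) \<cdot>\<^sub>m Y) $$ (i, j) = 0" unfolding assms(1) using ij assms(3) by simp
  thus "X $$ (i, j) = Y $$ (i, j)" using ij assms(2,3) by simp
qed (use assms in auto)

text \<open>The matrices \<open>outer y y\<close> span everything: by polarization E_ij is a quarter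
  of the combination, with weights 1, \<i>, -1, -\<i>, of the matrices \<open>outer v v\<close> for
  v = e_i + c e_j with the same four values of c.\<close>

lemma mat_span_induct_hermitian [consumes 1, case_names zero add smult unit]:
  assumes A: "(A :: complex mat) \<in> cmat n"
    and zero: "P (0\<^sub>m n n)"
    and add: "\<And>A B. A \<in> cmat n \<Longrightarrow> B \<in> cmat n \<Longrightarrow> P A \<Longrightarrow> P B \<Longrightarrow> P (A + B)"
    and smult: "\<And>c A. A \<in> cmat n \<Longrightarrow> P A \<Longrightarrow> P (c \<cdot>\<^sub>m A)"
    and unit: "\<And>y. y \<in> cvec n \<Longrightarrow> y \<bullet>c y = 1 \<Longrightarrow> P (outer y y)"
  shows "P A"
  using A
proof (induction A rule: mat_span_induct)
  case (unit i j)
  have all: "P (outer v v)" if v: "v \<in> cvec n" for v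
  proof (cases "v = 0\<^sub>v n")
    case True
    have "outer v v = 0\<^sub>m n n" unfolding True by (rule eq_matI) (auto simp: outer_def)
    thus ?thesis using zero by simp
  next
    case False
    obtain c u where u: "u \<in> cvec n" "u \<bullet>c u = 1" "v = c \<cdot>\<^sub>v u"
      by (rule normalized_multiple[OF v False]) (rule that)
    have "outer v v = (c * cnj c) \<cdot>\<^sub>m outer u u" unfolding u(3) by (rule outer_smult)
    thus ?thesis using smult[OF _ assms(5)[OF u(1,2)]] u by simp
  qed
  let ?a = "unit_vec n i :: complex vec" and ?b = "unit_vec n j :: complex vec"
  have eq: "outer ?a ?b = (1 / 4) \<cdot>\<^sub>m outer (?a + ?b) (?a + ?b) + ((\<i> / 4) \<cdot>\<^sub>m outer (?a + \<i> \<cdot>\<^sub>v ?b) (?a + \<i> \<cdot>\<^sub>v ?b)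
      + ((- 1 / 4) \<cdot>\<^sub>m outer (?a + (- 1) \<cdot>\<^sub>v ?b) (?a + (- 1) \<cdot>\<^sub>v ?b) + (- \<i> / 4) \<cdot>\<^sub>m outer (?a + (- \<i>) \<cdot>\<^sub>v ?b) (?a + (- \<i>) \<cdot>\<^sub>v ?b)))"
    by (rule eq_matI) (auto simp: outer_def field_simps)
  show ?case unfolding eq by (intro add smult all) simp_all
qed (use assms in auto)

lemma zero_smult_cvec: "v \<in> cvec n \<Longrightarrow> (0 :: complex) \<cdot>\<^sub>v v = 0\<^sub>v n"
  by (rule eq_vecI) auto

lemma kron_outer_unit:
  assumes "i < m" "j < m" "r < n" "s < n"
  shows "munit m i j \<otimes>\<^sub>K munit n r s =
    outer (unit_vec (m * n) (i * n + r)) (unit_vec (m * n) (j * n + s))"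
proof (rule eq_matI)
  fix a b assume "a < dim_row (outer (unit_vec (m * n) (i * n + r)) (unit_vec (m * n) (j * n + s)))"
    "b < dim_col (outer (unit_vec (m * n) (i * n + r)) (unit_vec (m * n) (j * n + s)))"
  hence ab: "a < m * n" "b < m * n" by (auto simp: outer_def)
  have *: "(c div n = i' \<and> c mod n = r') \<longleftrightarrow> c = i' * n + r'" if "r' < n" for c i' r'
    using that by auto
  show "(munit m i j \<otimes>\<^sub>K munit n r s) $$ (a, b) =
      outer (unit_vec (m * n) (i * n + r)) (unit_vec (m * n) (j * n + s)) $$ (a, b)"
    using ab div_mod_lt[OF ab(1)] div_mod_lt[OF ab(2)] *[OF assms(3), of a i] *[OF assms(4), of b j]
    by (auto simp: kron_index outer_def unit_vec_def)
qed (auto simp: outer_def)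

text \<open>In the application \<open>p\<close> is \<open>A \<mapsto> T(A, I)\<close> or \<open>B \<mapsto> T(I, B)\<close>.\<close>
locale orthogonal_star_map =
  fixes n N :: nat and p :: "complex mat \<Rightarrow> complex mat"
  assumes carrier [simp]: "A \<in> cmat n \<Longrightarrow> p A \<in> cmat N"
    and add: "A \<in> cmat n \<Longrightarrow> B \<in> cmat n \<Longrightarrow> p (A + B) = p A + p B"
    and smult: "A \<in> cmat n \<Longrightarrow> p (c \<cdot>\<^sub>m A) = c \<cdot>\<^sub>m p A"
    and one: "p (1\<^sub>m n) = 1\<^sub>m N"
    and adjoint: "A \<in> cmat n \<Longrightarrow> adj (p A) = p (adj A)"
    and orth_unit: "a \<in> cvec n \<Longrightarrow> b \<in> cvec n \<Longrightarrow> a \<bullet>c a = 1 \<Longrightarrow> b \<bullet>c b = 1 \<Longrightarrow> C \<in> cmat n \<Longrightarrow>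
      C *\<^sub>v a = 0\<^sub>v n \<Longrightarrow> adj C *\<^sub>v b = 0\<^sub>v n \<Longrightarrow> p (outer a b) * p C = 0\<^sub>m N N"
begin

lemma dims [simp]: "A \<in> cmat n \<Longrightarrow> dim_row (p A) = N" "A \<in> cmat n \<Longrightarrow> dim_col (p A) = N"
  using carrier by (blast dest: carrier_matD)+

lemma zero: "p (0\<^sub>m n n) = 0\<^sub>m N N"
proof -
  have "p (0\<^sub>m n n) = p (0 \<cdot>\<^sub>m 0\<^sub>m n n)" by simp
  also have "\<dots> = 0 \<cdot>\<^sub>m p (0\<^sub>m n n)" by (intro smult) auto
  also have "\<dots> = 0\<^sub>m N N" by (intro eq_matI) auto
  finally show ?thesis .
qed

lemma orth:
  assumes ab: "a \<in> cvec n" "b \<in> cvec n" and C: "C \<in> cmat n" "C *\<^sub>v a = 0\<^sub>v n" "adj C *\<^sub>v b = 0\<^sub>v n"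
  shows "p (outer a b) * p C = 0\<^sub>m N N"
proof (cases "a = 0\<^sub>v n \<or> b = 0\<^sub>v n")
  case True
  hence "outer a b = 0\<^sub>m n n" using ab by (auto simp: outer_def intro!: eq_matI)
  thus ?thesis using C by (simp add: zero)
next
  case False
  hence nz: "a \<noteq> 0\<^sub>v n" "b \<noteq> 0\<^sub>v n" by auto
  obtain c u where u: "u \<in> cvec n" "u \<bullet>c u = 1" "a = c \<cdot>\<^sub>v u" "c \<noteq> 0"
    by (rule normalized_multiple[OF ab(1) nz(1)]) (rule that)
  obtain d v where v: "v \<in> cvec n" "v \<bullet>c v = 1" "b = d \<cdot>\<^sub>v v" "d \<noteq> 0"
    by (rule normalized_multiple[OF ab(2) nz(2)]) (rule that)
  have sm0: "w = 0\<^sub>v n" if "c \<cdot>\<^sub>v w = 0\<^sub>v n" "c \<noteq> 0" "w \<in> cvec n" for c :: complex and w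
  proof (rule eq_vecI)
    fix i assume i: "i < dim_vec (0\<^sub>v n :: complex vec)"
    have "c * w $ i = (c \<cdot>\<^sub>v w) $ i" using that(3) i by simp
    also have "\<dots> = 0" unfolding that(1) using i by simp
    finally show "w $ i = 0\<^sub>v n $ i" using that(2) i by simp
  qed (use that in auto)
  have "c \<cdot>\<^sub>v (C *\<^sub>v u) = 0\<^sub>v n"
    using C(2) mult_mat_vec[OF C(1) u(1), of c] unfolding u(3) by simp
  hence Cu: "C *\<^sub>v u = 0\<^sub>v n" by (rule sm0) (use u C in simp_all)
  have "d \<cdot>\<^sub>v (adj C *\<^sub>v v) = 0\<^sub>v n"
    using C(3) mult_mat_vec[OF mat_adjoint_carrier[OF C(1)] v(1), of d] unfolding v(3) by simp
  hence Cv: "adj C *\<^sub>v v = 0\<^sub>v n" by (rule sm0) (use v C in simp_all)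
  have "p (outer u v) * p C = 0\<^sub>m N N" by (rule orth_unit[OF u(1) v(1) u(2) v(2) C(1) Cu Cv])
  thus ?thesis
    unfolding u(3) v(3) outer_smult using u v C by (simp add: smult mult_smult_assoc_mat[of _ N N _ N])
qed

text \<open>A scalar entry of the product, so that expanding an orthogonality relation becomes
  arithmetic of complex numbers.\<close>

definition g :: "nat \<Rightarrow> nat \<Rightarrow> complex mat \<Rightarrow> complex mat \<Rightarrow> complex" where
  "g a b A B = (p A * p B) $$ (a, b)"

lemma g_add:
  assumes "a < N" "b < N" "A \<in> cmat n" "B \<in> cmat n" "C \<in> cmat n"
  shows "g a b (A + B) C = g a b A C + g a b B C" "g a b A (B + C) = g a b A B + g a b A C"
  using assms by (simp_all add: g_def add cmat_bilinear[where N = N] del: index_mult_mat(1))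

lemma g_smult:
  assumes "a < N" "b < N" "A \<in> cmat n" "B \<in> cmat n"
  shows "g a b (c \<cdot>\<^sub>m A) B = c * g a b A B" "g a b A (c \<cdot>\<^sub>m B) = c * g a b A B"
  using assms by (simp_all add: g_def smult cmat_bilinear[where N = N] del: index_mult_mat(1))

lemma g_eqI:
  assumes "\<And>a b. a < N \<Longrightarrow> b < N \<Longrightarrow> g a b A B = g a b C D" "A \<in> cmat n" "B \<in> cmat n" "C \<in> cmat n" "D \<in> cmat n"
  shows "p A * p B = p C * p D"
  using assms by (intro eq_matI) (auto simp: g_def simp del: index_mult_mat(1))

definition E :: "nat \<Rightarrow> nat \<Rightarrow> complex mat" where
  "E i j = munit n i j"

definition Z :: "nat \<Rightarrow> nat \<Rightarrow> complex mat" where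
  "Z i j = p (E i j)"

lemma E_carrier [simp]: "E i j \<in> cmat n"
  by (simp add: E_def)

lemma Z_carrier [simp]: "Z i j \<in> cmat N"
  by (simp add: Z_def)

lemma Z_dims [simp]: "dim_row (Z i j) = N" "dim_col (Z i j) = N"
  using carrier_matD[OF Z_carrier] by auto

lemma Z_adjoint: "adj (Z i j) = Z j i"
  by (simp add: Z_def adjoint E_def outer_adjoint)

text \<open>Orthogonality of \<open>b\<close> and \<open>c\<close> annihilates the product of the
  two rank one matrices, that of \<open>a\<close> and \<open>d\<close> annihilates the product in
  reversed order. Both are assumed, so every relation derived from this is compatible with
  multiplicative and antimultiplicative maps.\<close>

lemma orth_outer:
  assumes "a \<in> cvec n" "b \<in> cvec n" "c \<in> cvec n" "d \<in> cvec n"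
    and "a \<bullet>c d = 0" "b \<bullet>c c = 0"
  shows "p (outer a b) * p (outer c d) = 0\<^sub>m N N"
  using assms by (intro orth) (simp_all add: outer_mult_vec[of _ n] outer_adjoint zero_smult_cvec)

lemma g_zero:
  assumes "i < n" "j < n" "k < n" "l < n" "i \<noteq> l" "j \<noteq> k" "a < N" "b < N"
  shows "g a b (E i j) (E k l) = 0"
  unfolding g_def E_def using assms by (subst orth_outer) (auto simp: unit_vec_c)

lemma Z_orth: "\<lbrakk>i < n; j < n; k < n; l < n; i \<noteq> l; j \<noteq> k\<rbrakk> \<Longrightarrow> Z i j * Z k l = 0\<^sub>m N N"
  unfolding Z_def E_def by (rule orth_outer) (auto simp: unit_vec_c)

lemma g_orth:
  assumes "a' \<in> cvec n" "b' \<in> cvec n" "c \<in> cvec n" "d \<in> cvec n"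
    and "a' \<bullet>c d = 0" "b' \<bullet>c c = 0" "a < N" "b < N"
  shows "g a b (outer a' b') (outer c d) = 0"
  unfolding g_def using assms by (subst orth_outer) auto

lemma E_outer:
  "outer (unit_vec n i + (- 1) \<cdot>\<^sub>v unit_vec n j) (unit_vec n k) = E i k + (- 1) \<cdot>\<^sub>m E j k"
  "outer (unit_vec n k) (unit_vec n i + (- 1) \<cdot>\<^sub>v unit_vec n j) = E k i + (- 1) \<cdot>\<^sub>m E k j"
  "outer (unit_vec n i + unit_vec n j) (unit_vec n k) = E i k + E j k"
  "outer (unit_vec n k) (unit_vec n i + unit_vec n j) = E k i + E k j"
  by (simp_all add: E_def outer_add_left[of _ n] outer_add_right[of _ n] outer_smult_left outer_smult_right)

lemma unit_pm:
  assumes "i < n" "j < n" "k < n"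
  shows "(unit_vec n i + (- 1) \<cdot>\<^sub>v unit_vec n j) \<bullet>c (unit_vec n k :: complex vec) = (if i = k then 1 else 0) - (if j = k then 1 else 0)"
    "(unit_vec n k :: complex vec) \<bullet>c (unit_vec n i + (- 1) \<cdot>\<^sub>v unit_vec n j) = (if i = k then 1 else 0) - (if j = k then 1 else 0)"
    "(unit_vec n i + unit_vec n j) \<bullet>c (unit_vec n k :: complex vec) = (if i = k then 1 else 0) + (if j = k then 1 else 0)"
    "(unit_vec n k :: complex vec) \<bullet>c (unit_vec n i + unit_vec n j) = (if i = k then 1 else 0) + (if j = k then 1 else 0)"
    "i \<noteq> j \<Longrightarrow> (unit_vec n i + (- 1) \<cdot>\<^sub>v unit_vec n j :: complex vec) \<bullet>c (unit_vec n i + unit_vec n j) = 0"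
    "i \<noteq> j \<Longrightarrow> (unit_vec n i + unit_vec n j :: complex vec) \<bullet>c (unit_vec n i + (- 1) \<cdot>\<^sub>v unit_vec n j) = 0"
proof -
  show "(unit_vec n i + (- 1) \<cdot>\<^sub>v unit_vec n j) \<bullet>c (unit_vec n k :: complex vec) = (if i = k then 1 else 0) - (if j = k then 1 else 0)"
    "(unit_vec n i + unit_vec n j) \<bullet>c (unit_vec n k :: complex vec) = (if i = k then 1 else 0) + (if j = k then 1 else 0)"
    using assms by (auto simp: add_scalar_prod_distrib[of _ n] unit_vec_c)
  show "(unit_vec n k :: complex vec) \<bullet>c (unit_vec n i + (- 1) \<cdot>\<^sub>v unit_vec n j) = (if i = k then 1 else 0) - (if j = k then 1 else 0)"
    "(unit_vec n k :: complex vec) \<bullet>c (unit_vec n i + unit_vec n j) = (if i = k then 1 else 0) + (if j = k then 1 else 0)"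
    using assms by (auto simp: conjugate_add_vec[of _ n] conjugate_smult_vec scalar_prod_add_distrib[of _ n] unit_vec_c)
  show "i \<noteq> j \<Longrightarrow> (unit_vec n i + (- 1) \<cdot>\<^sub>v unit_vec n j :: complex vec) \<bullet>c (unit_vec n i + unit_vec n j) = 0"
    "i \<noteq> j \<Longrightarrow> (unit_vec n i + unit_vec n j :: complex vec) \<bullet>c (unit_vec n i + (- 1) \<cdot>\<^sub>v unit_vec n j) = 0"
    using assms by (auto simp: add_scalar_prod_distrib[of _ n] conjugate_add_vec[of _ n] conjugate_smult_vec scalar_prod_add_distrib[of _ n] unit_vec_c)
qed

text \<open>Expand the vanishing product for the vectors e_i, e_i - e_j and e_i + e_j, e_j; two of
  the four terms vanish by \<open>g_zero\<close>. Both sides are Z i j for a multiplicative map and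
  0 for an antimultiplicative one. \<open>Z_shift_right\<close> is the mirror image.\<close>

lemma Z_shift_left:
  assumes "i < n" "j < n" "i \<noteq> j"
  shows "Z i i * Z i j = Z i j * Z j j"
proof -
  have "g a b (E i i) (E i j) = g a b (E i j) (E j j)" if ab: "a < N" "b < N" for a b
  proof -
    have "g a b (outer (unit_vec n i) (unit_vec n i + (- 1) \<cdot>\<^sub>v unit_vec n j))
        (outer (unit_vec n i + unit_vec n j) (unit_vec n j)) = 0"
      using assms ab by (intro g_orth) (auto simp: unit_vec_c unit_pm)
    thus ?thesis using assms ab by (simp add: E_outer g_add g_smult g_zero)
  qed
  thus ?thesis unfolding Z_def by (intro g_eqI) auto
qed

lemma Z_shift_right:
  assumes "i < n" "j < n" "i \<noteq> j"
  shows "Z j j * Z i j = Z i j * Z i i"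
proof -
  have "g a b (E j j) (E i j) = g a b (E i j) (E i i)" if ab: "a < N" "b < N" for a b
  proof -
    have "g a b (outer (unit_vec n i + (- 1) \<cdot>\<^sub>v unit_vec n j) (unit_vec n j))
        (outer (unit_vec n i) (unit_vec n i + unit_vec n j)) = 0"
      using assms ab by (intro g_orth) (auto simp: unit_vec_c unit_pm)
    thus ?thesis using assms ab by (simp add: E_outer g_add g_smult g_zero)
  qed
  thus ?thesis unfolding Z_def by (intro g_eqI) auto
qed

text \<open>The test vectors are e_i, e_j - e_i and e_j + e_i, e_k. A product through the
  intermediate index j thus yields the multiplicative part of Z i k; \<open>Z_mult_right\<close>
  yields the antimultiplicative part.\<close>

lemma Z_mult_left:
  assumes "i < n" "j < n" "k < n" "i \<noteq> j" "j \<noteq> k" "i \<noteq> k"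
  shows "Z i j * Z j k = Z i i * Z i k"
proof -
  have "g a b (E i j) (E j k) = g a b (E i i) (E i k)" if ab: "a < N" "b < N" for a b
  proof -
    have "g a b (outer (unit_vec n i) (unit_vec n j + (- 1) \<cdot>\<^sub>v unit_vec n i))
        (outer (unit_vec n j + unit_vec n i) (unit_vec n k)) = 0"
      using assms ab by (intro g_orth) (auto simp: unit_vec_c unit_pm)
    thus ?thesis using assms ab by (simp add: E_outer g_add g_smult g_zero)
  qed
  thus ?thesis unfolding Z_def by (intro g_eqI) auto
qed

lemma Z_mult_right:
  assumes "i < n" "j < n" "k < n" "i \<noteq> j" "j \<noteq> k" "i \<noteq> k"
  shows "Z j k * Z i j = Z k k * Z i k"
proof -
  have "g a b (E j k) (E i j) = g a b (E k k) (E i k)" if ab: "a < N" "b < N" for a b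
  proof -
    have "g a b (outer (unit_vec n j + (- 1) \<cdot>\<^sub>v unit_vec n k) (unit_vec n k))
        (outer (unit_vec n i) (unit_vec n j + unit_vec n k)) = 0"
      using assms ab by (intro g_orth) (auto simp: unit_vec_c unit_pm)
    thus ?thesis using assms ab by (simp add: E_outer g_add g_smult g_zero)
  qed
  thus ?thesis unfolding Z_def by (intro g_eqI) auto
qed

lemma Z_idem:
  assumes "i < n"
  shows "Z i i * Z i i = Z i i"
proof -
  have C: "1\<^sub>m n + (- 1) \<cdot>\<^sub>m E i i \<in> cmat n" by simp
  have "p (munit n i i) * p (1\<^sub>m n + (- 1) \<cdot>\<^sub>m E i i) = 0\<^sub>m N N"
  proof (rule orth)
    have "adj (1\<^sub>m n + (- 1) \<cdot>\<^sub>m E i i) = 1\<^sub>m n + (- 1) \<cdot>\<^sub>m E i i"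
      by (subst mat_adjoint_add[of _ n n]) (auto simp: mat_adjoint_smult E_def outer_adjoint)
    moreover show "(1\<^sub>m n + (- 1) \<cdot>\<^sub>m E i i) *\<^sub>v unit_vec n i = 0\<^sub>v n"
      using assms by (intro eq_vecI) (auto simp: E_def outer_def unit_vec_def scalar_prod_def sum.delta if_distrib cong: if_cong)
    ultimately show "adj (1\<^sub>m n + (- 1) \<cdot>\<^sub>m E i i) *\<^sub>v unit_vec n i = 0\<^sub>v n" by simp
  qed (use C in auto)
  hence "Z i i * (1\<^sub>m N + (- 1) \<cdot>\<^sub>m Z i i) = 0\<^sub>m N N"
    by (simp add: add smult one Z_def E_def)
  hence z: "Z i i + (- 1) \<cdot>\<^sub>m (Z i i * Z i i) = 0\<^sub>m N N"
    by (simp add: cmat_bilinear[where N = N])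
  show ?thesis by (rule cmat_eqI_diff[OF z, symmetric]) simp_all
qed

text \<open>Testing E_ij against 1 - E_ii - E_jj confines Z i j to the two diagonal blocks involved.
  The first summand is the multiplicative part of Z i j, the second its antimultiplicative
  part.\<close>

lemma Z_support:
  assumes ij: "i < n" "j < n" "i \<noteq> j"
  shows "Z i j = Z i i * Z i j + Z j j * Z i j"
proof -
  let ?C = "1\<^sub>m n + (- 1) \<cdot>\<^sub>m (E i i + E j j)"
  have C: "?C \<in> cmat n" by simp
  have "p (munit n i j) * p ?C = 0\<^sub>m N N"
  proof (rule orth)
    show "?C *\<^sub>v unit_vec n i = 0\<^sub>v n"
      using assms by (intro eq_vecI) (auto simp: E_def outer_def unit_vec_def scalar_prod_def sum.delta if_distrib cong: if_cong)
    have "adj ?C = ?C"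
      by (rule eq_matI) (auto simp: E_def outer_def)
    moreover have "?C *\<^sub>v unit_vec n j = 0\<^sub>v n"
      using assms by (intro eq_vecI) (auto simp: E_def outer_def unit_vec_def scalar_prod_def sum.delta if_distrib cong: if_cong)
    ultimately show "adj ?C *\<^sub>v unit_vec n j = 0\<^sub>v n" by simp
  qed (use C in auto)
  hence "Z i j * (1\<^sub>m N + (- 1) \<cdot>\<^sub>m (Z i i + Z j j)) = 0\<^sub>m N N"
    by (simp add: add smult one Z_def E_def)
  hence z: "Z i j + (- 1) \<cdot>\<^sub>m (Z i j * (Z i i + Z j j)) = 0\<^sub>m N N"
    by (simp add: cmat_bilinear[where N = N])
  have "Z i j = Z i j * (Z i i + Z j j)" by (rule cmat_eqI_diff[OF z]) simp_all
  also have "\<dots> = Z j j * Z i j + Z i i * Z i j"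
    unfolding Z_shift_left[OF ij] Z_shift_right[OF ij] by (simp add: cmat_bilinear[where N = N])
  also have "\<dots> = Z i i * Z i j + Z j j * Z i j" by (rule comm_add_mat[of _ N N]) simp_all
  finally show ?thesis .
qed

text \<open>Obtained from the pair of orthogonal vectors e_i + e_j and e_i - e_j; the terms with a
  single off-diagonal factor cancel by the shift relations. The result is invariant under reversing
  products, so it holds before the type of the map is known.\<close>

lemma Z_square:
  assumes ij: "i < n" "j < n" "i \<noteq> j"
  shows "Z i j * Z j i + Z j i * Z i j = Z i i + Z j j"
proof -
  have "g a b (E i j) (E j i) + g a b (E j i) (E i j) = Z i i $$ (a, b) + Z j j $$ (a, b)" if ab: "a < N" "b < N" for a b
  proof -
    let ?y = "unit_vec n i + unit_vec n j :: complex vec" and ?z = "unit_vec n i + (- 1) \<cdot>\<^sub>v unit_vec n j :: complex vec"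
    have "g a b (outer ?y ?y) (outer ?z ?z) = 0"
      using ij ab by (intro g_orth) (auto simp: unit_pm)
    moreover have "outer ?y ?y = (E i i + E j i) + (E i j + E j j)"
      by (simp add: outer_add_right[of _ n] E_outer)
    moreover have "outer ?z ?z = (E i i + (- 1) \<cdot>\<^sub>m E j i) + (- 1) \<cdot>\<^sub>m (E i j + (- 1) \<cdot>\<^sub>m E j j)"
      by (simp add: outer_add_right[of _ n] outer_smult_right E_outer)
    ultimately have "g a b (E i i) (E i i) + g a b (E j j) (E j j) - g a b (E i i) (E i j) + g a b (E j i) (E i i)
       - g a b (E i i) (E j i) + g a b (E i j) (E i i) - g a b (E j i) (E i j) - g a b (E i j) (E j i)
       + g a b (E j i) (E j j) + g a b (E i j) (E j j) - g a b (E j j) (E j i) - g a b (E j j) (E i j) = 0"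
      using ij ab by (simp add: g_add g_smult g_zero algebra_simps)
    moreover have "g a b (E i i) (E i i) = Z i i $$ (a, b)" "g a b (E j j) (E j j) = Z j j $$ (a, b)"
      using Z_idem ij by (simp_all add: g_def Z_def)
    moreover have "g a b (E i i) (E i j) = g a b (E i j) (E j j)" "g a b (E j j) (E i j) = g a b (E i j) (E i i)"
      "g a b (E j j) (E j i) = g a b (E j i) (E i i)" "g a b (E i i) (E j i) = g a b (E j i) (E j j)"
      using Z_shift_left[OF ij] Z_shift_right[OF ij] Z_shift_left[OF ij(2,1)] Z_shift_right[OF ij(2,1)] ij
      by (simp_all add: g_def Z_def)
    ultimately show ?thesis by (simp add: algebra_simps)
  qed
  thus ?thesis
    by (intro eq_matI) (auto simp: g_def Z_def simp del: index_mult_mat(1))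
qed

end

text \<open>The relation that takes an argument is W_ij W_ji = W_ii. Multiplying the symmetric
  relation \<open>sq\<close> by W_ii from the left isolates it, because W_ii annihilates
  W_ji.\<close>

lemma matrix_unitsI:
  fixes W :: "nat \<Rightarrow> nat \<Rightarrow> complex mat"
  assumes W: "\<And>i j. W i j \<in> cmat N"
    and diag: "\<And>i j. i < n \<Longrightarrow> j < n \<Longrightarrow> i \<noteq> j \<Longrightarrow> W i i * W j j = 0\<^sub>m N N"
    and left: "\<And>i j. i < n \<Longrightarrow> j < n \<Longrightarrow> W i i * W i j = W i j"
    and right: "\<And>i j. i < n \<Longrightarrow> j < n \<Longrightarrow> W i j * W j j = W i j"
    and comp: "\<And>i j k. \<lbrakk>i < n; j < n; k < n; i \<noteq> j; j \<noteq> k; i \<noteq> k\<rbrakk> \<Longrightarrow> W i j * W j k = W i k"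
    and sq: "\<And>i j. i < n \<Longrightarrow> j < n \<Longrightarrow> i \<noteq> j \<Longrightarrow> W i j * W j i + W j i * W i j = W i i + W j j"
    and ij: "i < n" "j < n" "k < n" "l < n"
  shows "W i j * W k l = (if j = k then W i l else 0\<^sub>m N N)"
proof -
  note ac = cmat_assoc[where N = N]
  have ne: "W i j * W k l = 0\<^sub>m N N" if "i < n" "j < n" "k < n" "l < n" "j \<noteq> k" for i j k l
  proof -
    have "W i j * W k l = (W i j * W j j) * (W k k * W k l)" using left right that by simp
    also have "\<dots> = W i j * (W j j * W k k) * W k l" using W by (simp add: ac)
    also have "\<dots> = 0\<^sub>m N N"
      unfolding diag[OF that(2,3,5)] using W by simp
    finally show ?thesis .
  qed
  have eq: "W i j * W j l = W i l" if a: "i < n" "j < n" "l < n" for i j l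
  proof -
    consider "i = j" | "j = l" | "i \<noteq> j" "j \<noteq> l" "i \<noteq> l" | "i = l" "i \<noteq> j" by blast
    thus ?thesis
    proof cases
      case 4
      have "W i j * W j i = W i i * (W i j * W j i)"
        using left[OF a(1,2)] W by (simp flip: ac)
      also have "\<dots> = W i i * (W i j * W j i) + W i i * W j i * W i j"
        using ne[of i i j i] a 4 W by simp
      also have "\<dots> = W i i * (W i j * W j i + W j i * W i j)"
        using W by (simp add: mult_add_distrib_mat[of _ N N _ N] ac)
      also have "\<dots> = W i i * W i i + W i i * W j j"
        unfolding sq[OF a(1,2) 4(2)] using W by (simp add: mult_add_distrib_mat[of _ N N _ N])
      also have "\<dots> = W i i"
        using left[OF a(1,1)] diag[OF a(1,2) 4(2)] W by simp
      finally show ?thesis using 4 by simp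
    qed (use left right comp a in auto)
  qed
  show ?thesis using ne eq ij by (cases "j = k") auto
qed

context orthogonal_star_map
begin

text \<open>\<open>Z_square\<close> and the shift relations give Z r r = Z 0 r Z 0 0 Z r 0 + Z r 0 Z
  0 0 Z 0 r. As \<open>c\<close> commutes with all these, its vanishing against Z 0 0 spreads to
  every Z r r, by \<open>Z_support\<close> to every Z r s, and so to the identity.\<close>

lemma central_zero:
  assumes n: "0 < n" and c: "c \<in> cmat N" "\<And>A. A \<in> cmat n \<Longrightarrow> c * p A = p A * c" and c0: "c * Z 0 0 = 0\<^sub>m N N"
  shows "c = 0\<^sub>m N N"
proof -
  note ac = cmat_assoc[where N = N]
  note p_linear = zero add smult
  have cZ: "c * Z r s = Z r s * c" for r s unfolding Z_def by (rule c(2)) simp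
  have cQ: "c * Z r r = 0\<^sub>m N N" if r: "r < n" for r
  proof (cases "r = 0")
    case False
    have "Z r r = (Z 0 0 + Z r r) * Z r r"
      using Z_orth[of 0 0 r r] Z_idem[OF r] r n False by (simp add: add_mult_distrib_mat[of _ N N _ _ N])
    also have "Z 0 0 + Z r r = Z 0 r * Z r 0 + Z r 0 * Z 0 r" using Z_square[OF n r] False by simp
    also have "(Z 0 r * Z r 0 + Z r 0 * Z 0 r) * Z r r = Z 0 r * (Z r 0 * Z r r) + Z r 0 * (Z 0 r * Z r r)"
      by (simp add: add_mult_distrib_mat[of _ N N _ _ N] ac)
    also have "\<dots> = Z 0 r * (Z 0 0 * Z r 0) + Z r 0 * (Z 0 0 * Z 0 r)"
      using Z_shift_left[OF n r] Z_shift_right[OF r n] False by simp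
    finally have "c * Z r r = c * Z 0 r * Z 0 0 * Z r 0 + c * Z r 0 * Z 0 0 * Z 0 r"
      using c(1) by (simp add: mult_add_distrib_mat[of _ N N _ N] ac)
    also have "\<dots> = Z 0 r * (c * Z 0 0) * Z r 0 + Z r 0 * (c * Z 0 0) * Z 0 r"
      unfolding cZ[of 0 r] cZ[of r 0] using c(1) by (simp add: ac)
    finally show ?thesis unfolding c0 by simp
  qed (use c0 in simp)
  have "c * p A = 0\<^sub>m N N" if "A \<in> cmat n" for A
    using that
  proof (induction A rule: mat_span_induct)
    case zero
    show ?case using c(1) by (simp add: p_linear)
  next
    case (add A B)
    thus ?case using c(1) by (simp add: p_linear mult_add_distrib_mat[of _ N N _ N])
  next
    case (smult d A)
    thus ?case using c(1) by (simp add: p_linear mult_smult_distrib[of _ N N _ N])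
  next
    case (unit r s)
    have "c * Z r s = 0\<^sub>m N N"
    proof (cases "r = s")
      case False
      have "c * Z r s = c * (Z r r * Z r s + Z s s * Z r s)"
        using Z_support[OF unit False] by simp
      also have "\<dots> = c * Z r r * Z r s + c * Z s s * Z r s"
        using c(1) by (simp add: mult_add_distrib_mat[of _ N N _ N] ac)
      finally show ?thesis unfolding cQ[OF unit(1)] cQ[OF unit(2)] by simp
    qed (use cQ unit in simp)
    thus ?case by (simp add: Z_def E_def)
  qed
  from this[of "1\<^sub>m n"] show ?thesis using c(1) by (simp add: one)
qed

text \<open>If Z i j had only its multiplicative part and Z j k only its antimultiplicative part,
  both parts of Z i k would vanish, whereas \<open>Z_square\<close> keeps Z i k nonzero. The type
  therefore spreads along pairs that share an index, and with the symmetry provided by adjoints it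
  reaches all pairs.\<close>

lemma dichotomy:
  assumes d: "\<And>i j. i < n \<Longrightarrow> j < n \<Longrightarrow> i \<noteq> j \<Longrightarrow> Z i i * Z i j = 0\<^sub>m N N \<or> Z j j * Z i j = 0\<^sub>m N N"
    and nz: "\<And>i. i < n \<Longrightarrow> Z i i \<noteq> 0\<^sub>m N N"
  shows "(\<forall>i<n. \<forall>j<n. i \<noteq> j \<longrightarrow> Z j j * Z i j = 0\<^sub>m N N) \<or> (\<forall>i<n. \<forall>j<n. i \<noteq> j \<longrightarrow> Z i i * Z i j = 0\<^sub>m N N)"
proof -
  note ac = cmat_assoc[where N = N]
  \<comment> \<open>The antimultiplicative part of Z i j vanishes.\<close>
  define B where "B i j \<longleftrightarrow> Z j j * Z i j = 0\<^sub>m N N" for i j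
  have Znz: "Z i j \<noteq> 0\<^sub>m N N" if ij: "i < n" "j < n" "i \<noteq> j" for i j
  proof
    assume 0: "Z i j = 0\<^sub>m N N"
    have "Z i i + Z j j = 0\<^sub>m N N" using Z_square[OF ij] by (simp add: 0)
    hence "Z i i * (Z i i + Z j j) = 0\<^sub>m N N" by simp
    hence "Z i i = 0\<^sub>m N N"
      using Z_orth[of i i j j] Z_idem[OF ij(1)] ij by (simp add: mult_add_distrib_mat[of _ N N _ N])
    thus False using nz ij by simp
  qed
  have sym: "B j i" if ij: "i < n" "j < n" "i \<noteq> j" "B i j" for i j
  proof -
    have "Z i j * Z i i = 0\<^sub>m N N" using ij Z_shift_right[OF ij(1-3)] by (simp add: B_def)
    hence "adj (Z i j * Z i i) = 0\<^sub>m N N" by simp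
    thus ?thesis by (simp add: B_def mat_adjoint_mult[of _ N N _ N] Z_adjoint)
  qed
  have trans: "B j k" if ijk: "i < n" "j < n" "k < n" "i \<noteq> j" "j \<noteq> k" "i \<noteq> k" and B: "B i j" for i j k
  proof (rule ccontr)
    assume "\<not> B j k"
    hence jk: "Z j j * Z j k = 0\<^sub>m N N" using d[OF ijk(2,3,5)] by (simp add: B_def)
    have 1: "Z i j = Z i i * Z i j" using Z_support[OF ijk(1,2,4)] B by (simp add: B_def)
    hence 1: "Z i j = Z i j * Z j j" "Z i j = Z i i * Z i j" using Z_shift_left[OF ijk(1,2,4)] by simp_all
    have "Z j k = Z k k * Z j k" using Z_support[OF ijk(2,3,5)] jk by simp
    hence 2: "Z j k = Z k k * Z j k" "Z j k = Z j k * Z j j" using Z_shift_right[OF ijk(2,3,5)] by simp_all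
    have "Z i i * Z i k = Z i j * Z j j * (Z k k * Z j k)"
      using Z_mult_left[OF ijk(1-6)] 1 2 by simp
    also have "\<dots> = Z i j * (Z j j * Z k k) * Z j k" by (simp add: ac)
    finally have a: "Z i i * Z i k = 0\<^sub>m N N" using Z_orth[of j j k k] ijk by simp
    have "Z k k * Z i k = Z j k * Z j j * (Z i i * Z i j)"
      using Z_mult_right[OF ijk(1-6)] 1(2) 2(2) by simp
    also have "\<dots> = Z j k * (Z j j * Z i i) * Z i j" by (simp add: ac)
    finally have "Z k k * Z i k = 0\<^sub>m N N" using Z_orth[of j j i i] ijk by simp
    hence "Z i k = 0\<^sub>m N N" using Z_support[OF ijk(1,3,6)] a by simp
    thus False using Znz ijk by blast
  qed
  have all: "B k l" if B: "i < n" "j < n" "i \<noteq> j" "B i j" and kl: "k < n" "l < n" "k \<noteq> l" for i j k l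
  proof -
    note ji = sym[OF B]
    consider "k = i" "l = j" | "k = i" "l \<noteq> j" | "k = j" "l = i" | "k = j" "l \<noteq> i"
      | "k \<noteq> i" "k \<noteq> j" "l = i" | "k \<noteq> i" "k \<noteq> j" "l = j" | "k \<noteq> i" "k \<noteq> j" "l \<noteq> i" "l \<noteq> j" by blast
    thus ?thesis
    proof cases
      case 1 thus ?thesis using B by simp
    next
      case 2 thus ?thesis using trans[of j i l] ji B kl by auto
    next
      case 3 thus ?thesis using ji by simp
    next
      case 4 thus ?thesis using trans[of i j l] B kl by auto
    next
      case 5
      hence "B i k" using trans[of j i k] ji B kl by auto
      thus ?thesis using sym[of i k] 5 B kl by auto
    next
      case 6
      hence "B j k" using trans[of i j k] B kl by auto
      thus ?thesis using sym[of j k] 6 B kl by auto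
    next
      case 7
      hence "B j k" using trans[of i j k] B kl by auto
      thus ?thesis using trans[of j k l] 7 B kl by auto
    qed
  qed
  show ?thesis
  proof (cases "\<exists>i<n. \<exists>j<n. i \<noteq> j \<and> B i j")
    case True
    then obtain i j where "i < n" "j < n" "i \<noteq> j" "B i j" by auto
    note all' = all[OF this]
    show ?thesis by (intro disjI1 allI impI) (use all' in \<open>simp add: B_def\<close>)
  next
    case False
    have "Z i i * Z i j = 0\<^sub>m N N" if "i < n" "j < n" "i \<noteq> j" for i j
      using d[OF that] False that unfolding B_def by blast
    thus ?thesis by (intro disjI2 allI impI)
  qed
qed

lemma matrix_units:
  assumes d: "\<And>i j. i < n \<Longrightarrow> j < n \<Longrightarrow> i \<noteq> j \<Longrightarrow> Z i i * Z i j = 0\<^sub>m N N \<or> Z j j * Z i j = 0\<^sub>m N N"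
    and nz: "\<And>i. i < n \<Longrightarrow> Z i i \<noteq> 0\<^sub>m N N"
  shows "\<exists>f \<in> {\<lambda>X. X, transpose_mat}. \<forall>i<n. \<forall>j<n. \<forall>k<n. \<forall>l<n.
    p (f (E i j)) * p (f (E k l)) = (if j = k then p (f (E i l)) else 0\<^sub>m N N)"
proof -
  have tE: "transpose_mat (E i j) = E j i" for i j
    by (rule eq_matI) (auto simp: E_def outer_def unit_vec_def)
  show ?thesis using dichotomy[OF d nz]
  proof
    assume B: "\<forall>i<n. \<forall>j<n. i \<noteq> j \<longrightarrow> Z j j * Z i j = 0\<^sub>m N N"
    have L: "Z i i * Z i j = Z i j \<and> Z i j * Z j j = Z i j" if ij: "i < n" "j < n" for i j
    proof (cases "i = j")
      case False
      hence "Z i j = Z i i * Z i j" using Z_support[OF ij] B ij by simp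
      thus ?thesis using Z_shift_left[OF ij False] by simp
    qed (use Z_idem ij in simp)
    have "Z i j * Z k l = (if j = k then Z i l else 0\<^sub>m N N)" if "i < n" "j < n" "k < n" "l < n" for i j k l
    proof (rule matrix_unitsI[of Z N n, OF Z_carrier _ _ _ _ _ that])
      fix i j k assume "i < n" "j < n" "k < n" "i \<noteq> j" "j \<noteq> k" "i \<noteq> k"
      thus "Z i j * Z j k = Z i k" using Z_mult_left L by simp
    qed (use Z_orth L Z_square in simp_all)
    thus ?thesis by (intro bexI[of _ "\<lambda>X. X"]) (simp_all add: Z_def)
  next
    assume B: "\<forall>i<n. \<forall>j<n. i \<noteq> j \<longrightarrow> Z i i * Z i j = 0\<^sub>m N N"
    have L: "Z j j * Z i j = Z i j \<and> Z i j * Z i i = Z i j" if ij: "i < n" "j < n" for i j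
    proof (cases "i = j")
      case False
      hence "Z i j = Z j j * Z i j" using Z_support[OF ij] B ij by simp
      thus ?thesis using Z_shift_right[OF ij False] by simp
    qed (use Z_idem ij in simp)
    have "Z j i * Z l k = (if j = k then Z l i else 0\<^sub>m N N)" if "i < n" "j < n" "k < n" "l < n" for i j k l
    proof (rule matrix_unitsI[of "\<lambda>i j. Z j i" N n, OF Z_carrier _ _ _ _ _ that])
      fix i j k assume ijk: "i < n" "j < n" "k < n" "i \<noteq> j" "j \<noteq> k" "i \<noteq> k"
      thus "Z j i * Z k j = Z k i" using Z_mult_right[of k j i] L by simp
    next
      fix i j assume "i < n" "j < n" "i \<noteq> j"
      thus "Z j i * Z i j + Z i j * Z j i = Z i i + Z j j"
        using Z_square[of i j] comm_add_mat[of "Z j i * Z i j" N N "Z i j * Z j i"] by simp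
    qed (use Z_orth L in simp_all)
    thus ?thesis by (intro bexI[of _ transpose_mat]) (simp_all add: Z_def tE)
  qed
qed

end

section \<open>Splitting the normalized map into commuting factors\<close>

lemma outer_mult_outer:
  assumes "a \<in> cvec n" "b \<in> cvec n" "c \<in> cvec n" "d \<in> cvec n"
  shows "outer a b * outer c d = (c \<bullet>c b) \<cdot>\<^sub>m outer a d"
  using assms by (simp add: mult_outer[of _ n] outer_mult_vec[of _ n] outer_smult_left)

lemma transpose_outer_unit: "transpose_mat (munit n i j) = munit n j i"
  by (rule eq_matI) (auto simp: outer_def unit_vec_def)

context orthogonal_map
begin

text \<open>All claims are linear or conjugate-linear in \<open>B\<close>, so \<open>B\<close> may
  be a projection q onto a line. Orthogonality of q and 1 - q, with various first arguments, makes Q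
  = F(1, q) a projection and gives X = Q X = X Q, Q Y = Q X and Y Q = X Q for X = F(A, q) and Y =
  F(A, 1).\<close>

lemma right_factor:
  assumes one: "F (1\<^sub>m m) (1\<^sub>m n) = 1\<^sub>m N" and A: "A \<in> cmat m" and B: "B \<in> cmat n"
  shows "F A (1\<^sub>m n) * F (1\<^sub>m m) B = F A B \<and> F (1\<^sub>m m) B * F A (1\<^sub>m n) = F A B \<and>
    adj (F (1\<^sub>m m) B) = F (1\<^sub>m m) (adj B)"
  using B
proof (induction B rule: mat_span_induct_hermitian)
  case zero
  show ?case using A by (simp add: zero_right)
next
  case (add B C)
  thus ?case using A
    by (simp add: add_right mat_adjoint_add[of _ N N] mat_adjoint_add[of _ n n]
        cmat_bilinear[where N = N])
next
  case (smult c B)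
  thus ?case using A
    by (simp add: smult_right mat_adjoint_smult cmat_bilinear[where N = N])
next
  case (unit y)
  let ?q = "outer y y"
  let ?C = "1\<^sub>m n + (- 1) \<cdot>\<^sub>m ?q"
  define Q where "Q = F (1\<^sub>m m) ?q"
  define X where "X = F A ?q"
  define Y where "Y = F A (1\<^sub>m n)"
  have c: "Q \<in> cmat N" "X \<in> cmat N" "Y \<in> cmat N" "?q \<in> cmat n" using unit A by (simp_all add: Q_def X_def Y_def)
  have Cy: "?C *\<^sub>v y = 0\<^sub>v n"
  proof -
    have "(- 1 \<cdot>\<^sub>m ?q) *\<^sub>v y = outer ((- 1) \<cdot>\<^sub>v y) y *\<^sub>v y" by (simp only: outer_smult_left)
    also have "\<dots> = (- 1) \<cdot>\<^sub>v y" using unit by (subst outer_mult_vec[of _ n]) simp_all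
    finally show ?thesis using unit by (subst add_mult_distrib_mat_vec[of _ n n]) (auto intro!: eq_vecI)
  qed
  have aC: "adj ?C = ?C" using unit by (simp add: mat_adjoint_add[of _ n n] mat_adjoint_smult outer_adjoint)
  have FC: "F D ?C = F D (1\<^sub>m n) + (- 1) \<cdot>\<^sub>m F D ?q" if "D \<in> cmat m" for D
    using that c by (simp add: add_right smult_right)
  note o = orth_right[OF unit(1,1,2,2) _ _ Cy, unfolded aC, OF _ Cy]
  have Cc: "?C \<in> cmat n" using c by simp
  have Qs: "adj Q = adj Q * Q"
  proof (rule cmat_eqI_diff)
    show "adj Q + (- 1) \<cdot>\<^sub>m (adj Q * Q) = 0\<^sub>m N N"
      using o[OF Cc one_carrier_mat one_carrier_mat] c
      by (simp add: FC one cmat_bilinear[where N = N] flip: Q_def)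
  qed (use c in auto)
  have "adj (adj Q) = adj (adj Q * Q)" using Qs by simp
  also have "\<dots> = adj Q * Q" using c by (simp add: mat_adjoint_mult[of _ N N _ N])
  finally have Qh: "adj Q = Q" using Qs by simp
  have 2: "adj X = adj X * Q"
  proof (rule cmat_eqI_diff)
    show "adj X + (- 1) \<cdot>\<^sub>m (adj X * Q) = 0\<^sub>m N N"
      using o[OF Cc A one_carrier_mat] c
      by (simp add: FC one cmat_bilinear[where N = N] flip: Q_def X_def)
  qed (use c in auto)
  have QX: "Q * X = X"
    using arg_cong[OF 2, of adj] c Qh by (simp add: mat_adjoint_mult[of _ N N _ N])
  have XQ: "X = X * Q"
  proof (rule cmat_eqI_diff)
    show "X + (- 1) \<cdot>\<^sub>m (X * Q) = 0\<^sub>m N N"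
      using o[OF Cc A one_carrier_mat] c Qh
      by (simp add: FC one cmat_bilinear[where N = N]
          mat_adjoint_add[of _ N N] mat_adjoint_smult flip: Q_def X_def)
  qed (use c in auto)
  have QY: "Q * Y = Q * X"
  proof (rule cmat_eqI_diff)
    show "Q * Y + (- 1) \<cdot>\<^sub>m (Q * X) = 0\<^sub>m N N"
      using o[OF Cc one_carrier_mat A] c Qh A
      by (simp add: FC one cmat_bilinear[where N = N] flip: Q_def X_def Y_def)
  qed (use c in auto)
  have 5: "Q * adj Y = Q * adj X"
  proof (rule cmat_eqI_diff)
    show "Q * adj Y + (- 1) \<cdot>\<^sub>m (Q * adj X) = 0\<^sub>m N N"
      using o[OF Cc one_carrier_mat A] c A
      by (simp add: FC one cmat_bilinear[where N = N]
          mat_adjoint_add[of _ N N] mat_adjoint_smult flip: Q_def X_def Y_def)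
  qed (use c in auto)
  have YQ: "Y * Q = X * Q"
    using arg_cong[OF 5, of adj] c Qh by (simp add: mat_adjoint_mult[of _ N N _ N])
  show ?case using QX XQ[symmetric] QY YQ Qh by (simp add: outer_adjoint flip: Q_def X_def Y_def)
qed

lemma star_map_right:
  assumes one: "F (1\<^sub>m m) (1\<^sub>m n) = 1\<^sub>m N"
  shows "orthogonal_star_map n N (F (1\<^sub>m m))"
proof
  fix A assume "A \<in> cmat n"
  thus "adj (F (1\<^sub>m m) A) = F (1\<^sub>m m) (adj A)"
    using right_factor[OF one one_carrier_mat] by blast
next
  fix a b C assume a: "a \<in> cvec n" "b \<in> cvec n" "a \<bullet>c a = 1" "b \<bullet>c b = 1" "C \<in> cmat n"
      "C *\<^sub>v a = 0\<^sub>v n" "adj C *\<^sub>v b = 0\<^sub>v n"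
  have "adj (F (1\<^sub>m m) (outer b a)) = F (1\<^sub>m m) (adj (outer b a))"
    using right_factor[OF one one_carrier_mat outer_carrier[OF a(2,1)]] by blast
  thus "F (1\<^sub>m m) (outer a b) * F (1\<^sub>m m) C = 0\<^sub>m N N"
    using orth_right[OF a(2,1,4,3,5,7,6) one_carrier_mat one_carrier_mat] by (simp add: outer_adjoint)
qed (use one in \<open>simp_all add: add_right smult_right\<close>)

end

text \<open>\<open>P\<close> numbers the diagonal units. It is kept abstract because exchanging the
  factors turns the lexicographic numbering i n + r into one that is no longer lexicographic, and
  both versions should be instances.\<close>

locale normalized_map = orthogonal_map +
  fixes P :: "nat \<Rightarrow> nat \<Rightarrow> nat"
  assumes dim_pos: "0 < m" "0 < n"
    and unital: "F (1\<^sub>m m) (1\<^sub>m n) = 1\<^sub>m N"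
    and diagonal_index: "i < m \<Longrightarrow> r < n \<Longrightarrow> P i r < N"
    and diagonal: "i < m \<Longrightarrow> r < n \<Longrightarrow>
      F (munit m i i) (munit n r r) =
        outer (unit_vec N (P i r)) (unit_vec N (P i r))"
begin

lemma swap_normalized: "normalized_map n m N (\<lambda>A B. F B A) (\<lambda>i r. P r i)"
  by (intro normalized_map.intro swap_orthogonal normalized_map_axioms.intro)
     (rule dim_pos unital diagonal_index diagonal; assumption)+

text \<open>Let a and b be the multiplicative and antimultiplicative parts of Z i j. The projection
  Q = F(1, E_00) makes each Z k k Q a diagonal unit, so a Q and b Q are multiples \<alpha>, \<beta>
  of two mutually transposed units. Their product contains the square of Z i j, which is 0, so
  \<alpha> or \<beta> vanishes. The part killed by Q is zero outright by
  \<open>central_zero\<close>, as it commutes with all F(1, B).\<close>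

lemma left_matrix_units:
  "\<exists>f \<in> {\<lambda>X. X, transpose_mat}. \<forall>i<m. \<forall>j<m. \<forall>k<m. \<forall>l<m.
    F (f (munit m i j)) (1\<^sub>m n) * F (f (munit m k l)) (1\<^sub>m n) =
      (if j = k then F (f (munit m i l)) (1\<^sub>m n) else 0\<^sub>m N N)"
proof -
  interpret p1: orthogonal_star_map m N "\<lambda>A. F A (1\<^sub>m n)"
    by (rule orthogonal_map.star_map_right[OF swap_orthogonal unital])
  interpret p2: orthogonal_star_map n N "F (1\<^sub>m m)"
    by (rule star_map_right[OF unital])
  note ac = cmat_assoc[where N = N]
  let ?e = "\<lambda>p. unit_vec N p :: complex vec"
  define Q where "Q = p2.Z 0 0"
  have Q: "Q \<in> cmat N" "Q * Q = Q" using p2.Z_idem[OF dim_pos(2)] by (simp_all add: Q_def)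
  have comm: "p1.Z i j * F (1\<^sub>m m) B = F (1\<^sub>m m) B * p1.Z i j" if "B \<in> cmat n" for i j B
    using right_factor[OF unital p1.E_carrier[of i j] that] unfolding p1.Z_def by simp
  have commQ: "p1.Z i j * Q = Q * p1.Z i j" for i j
    unfolding Q_def p2.Z_def by (rule comm) simp
  have ZQ: "p1.Z i i * Q = outer (?e (P i 0)) (?e (P i 0))" if i: "i < m" for i
    using right_factor[OF unital p1.E_carrier[of i i] p2.E_carrier[of 0 0]] diagonal[OF i dim_pos(2)]
    unfolding p1.Z_def Q_def p2.Z_def p1.E_def p2.E_def by simp
  have sandwich: "outer (?e p) (?e p) * X * outer (?e q) (?e q) = ((X *\<^sub>v ?e q) \<bullet>c ?e p) \<cdot>\<^sub>m outer (?e p) (?e q)"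
    if "X \<in> cmat N" for X p q
    using that by (subst ac) (simp_all add: mult_outer[of X N] outer_mult_outer[of _ N])
  show ?thesis unfolding p1.E_def[symmetric]
  proof (rule p1.matrix_units)
    fix i assume i: "i < m"
    show "p1.Z i i \<noteq> 0\<^sub>m N N"
    proof
      assume "p1.Z i i = 0\<^sub>m N N"
      hence "outer (?e (P i 0)) (?e (P i 0)) = 0\<^sub>m N N" using ZQ[OF i] Q by simp
      hence "outer (?e (P i 0)) (?e (P i 0)) $$ (P i 0, P i 0) = 0" using diagonal_index[OF i dim_pos(2)] by simp
      thus False using diagonal_index[OF i dim_pos(2)] by (simp add: outer_def)
    qed
  next
    fix i j assume ij: "i < m" "j < m" "i \<noteq> j"
    let ?p = "P i 0" and ?q = "P j 0"
    have pq: "?p < N" "?q < N" using diagonal_index ij dim_pos by auto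
    define a where "a = p1.Z i i * p1.Z i j"
    define b where "b = p1.Z j j * p1.Z i j"
    have ab: "a \<in> cmat N" "b \<in> cmat N" by (simp_all add: a_def b_def)
    have a': "a = p1.Z i i * p1.Z i j * p1.Z j j"
    proof -
      have "a = p1.Z i i * (p1.Z i i * p1.Z i j)"
        unfolding a_def using p1.Z_idem[OF ij(1)] by (simp flip: ac)
      also have "p1.Z i i * p1.Z i j = p1.Z i j * p1.Z j j" by (rule p1.Z_shift_left[OF ij])
      also have "p1.Z i i * (p1.Z i j * p1.Z j j) = p1.Z i i * p1.Z i j * p1.Z j j" by (simp add: ac)
      finally show ?thesis .
    qed
    have b': "b = p1.Z j j * p1.Z i j * p1.Z i i"
    proof -
      have "b = p1.Z j j * (p1.Z j j * p1.Z i j)"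
        unfolding b_def using p1.Z_idem[OF ij(2)] by (simp flip: ac)
      also have "p1.Z j j * p1.Z i j = p1.Z i j * p1.Z i i" by (rule p1.Z_shift_right[OF ij])
      also have "p1.Z j j * (p1.Z i j * p1.Z i i) = p1.Z j j * p1.Z i j * p1.Z i i" by (simp add: ac)
      finally show ?thesis .
    qed
    \<comment> \<open>\<open>Q\<close> is idempotent and commutes with the images of the first
      factor, so one copy can be placed next to each outer diagonal factor.\<close>
    have comp: "(X * p1.Z i j * X') * Q = (X * Q) * p1.Z i j * (X' * Q)"
      if "X = p1.Z k k" "X' = p1.Z l l" for X X' k l
    proof -
      have "(X * p1.Z i j * X') * Q = X * p1.Z i j * (X' * Q) * Q"
        using that Q by (simp add: ac)
      also have "X' * Q = Q * X'" using that commQ by simp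
      also have "X * p1.Z i j * (Q * X') * Q = X * (p1.Z i j * Q) * (X' * Q)"
        using that Q by (simp add: ac)
      also have "\<dots> = (X * Q) * p1.Z i j * (X' * Q)"
        unfolding commQ using that Q by (simp add: ac)
      finally show ?thesis .
    qed
    define \<alpha> where "\<alpha> = (p1.Z i j *\<^sub>v ?e ?q) \<bullet>c ?e ?p"
    define \<beta> where "\<beta> = (p1.Z i j *\<^sub>v ?e ?p) \<bullet>c ?e ?q"
    have aQ: "a * Q = \<alpha> \<cdot>\<^sub>m outer (?e ?p) (?e ?q)"
      unfolding a' comp[OF refl refl] ZQ[OF ij(1)] ZQ[OF ij(2)] \<alpha>_def by (rule sandwich) simp
    have bQ: "b * Q = \<beta> \<cdot>\<^sub>m outer (?e ?q) (?e ?p)"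
      unfolding b' comp[OF refl refl] ZQ[OF ij(1)] ZQ[OF ij(2)] \<beta>_def by (rule sandwich) simp
    \<comment> \<open>Moving \<open>Q\<close> to the right and using the shift relation brings the
      two copies of Z i j side by side.\<close>
    have "(a * Q) * (b * Q) = a * (Q * p1.Z j j) * p1.Z i j * Q"
      unfolding b_def using ab Q by (simp add: ac)
    also have "\<dots> = a * (p1.Z j j * Q) * p1.Z i j * Q" by (simp only: commQ)
    also have "\<dots> = a * p1.Z j j * (Q * p1.Z i j) * Q" using ab Q by (simp add: ac)
    also have "\<dots> = a * p1.Z j j * (p1.Z i j * Q) * Q" by (simp only: commQ)
    also have "\<dots> = p1.Z i i * p1.Z i j * (p1.Z j j * p1.Z j j) * p1.Z i j * Q * Q"
      unfolding a' using Q by (simp add: ac)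
    also have "\<dots> = p1.Z i i * (p1.Z i j * p1.Z j j) * p1.Z i j * Q * Q"
      unfolding p1.Z_idem[OF ij(2)] using Q by (simp add: ac)
    also have "\<dots> = p1.Z i i * p1.Z i i * (p1.Z i j * p1.Z i j) * Q * Q"
      unfolding p1.Z_shift_left[OF ij, symmetric] using Q by (simp add: ac)
    also have "\<dots> = 0\<^sub>m N N"
      using p1.Z_orth[of i j i j] ij Q by simp
    finally have "(\<alpha> * \<beta>) \<cdot>\<^sub>m outer (?e ?p) (?e ?p) = 0\<^sub>m N N"
      unfolding aQ bQ using pq
      by (simp add: cmat_bilinear[where N = N] outer_mult_outer[of _ N] smult_smult_mat mult.commute)
    hence "((\<alpha> * \<beta>) \<cdot>\<^sub>m outer (?e ?p) (?e ?p)) $$ (?p, ?p) = 0" using pq by simp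
    hence "\<alpha> = 0 \<or> \<beta> = 0" using pq by (simp add: outer_def)
    moreover have z: "0 \<cdot>\<^sub>m outer (?e p) (?e q) = 0\<^sub>m N N" for p q
      by (rule eq_matI) (auto simp: outer_def)
    ultimately have "a * Q = 0\<^sub>m N N \<or> b * Q = 0\<^sub>m N N" unfolding aQ bQ by auto
    moreover have "c = 0\<^sub>m N N" if c: "c * Q = 0\<^sub>m N N" "c = p1.Z k k * p1.Z i j" for c k
    proof (rule p2.central_zero[OF dim_pos(2)])
      fix B assume B: "B \<in> cmat n"
      have "c * F (1\<^sub>m m) B = p1.Z k k * (p1.Z i j * F (1\<^sub>m m) B)" using B c(2) by (simp add: ac)
      also have "\<dots> = (p1.Z k k * F (1\<^sub>m m) B) * p1.Z i j" unfolding comm[OF B, of i j] using B by (simp add: ac)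
      also have "\<dots> = F (1\<^sub>m m) B * c" unfolding comm[OF B, of k k] using B c(2) by (simp add: ac)
      finally show "c * F (1\<^sub>m m) B = F (1\<^sub>m m) B * c" .
    qed (use c in \<open>simp_all flip: Q_def\<close>)
    ultimately show "p1.Z i i * p1.Z i j = 0\<^sub>m N N \<or> p1.Z j j * p1.Z i j = 0\<^sub>m N N"
      using a_def b_def by blast
  qed
qed

end

section \<open>Assembly\<close>

lemma transpose_choice:
  assumes "f \<in> {\<lambda>X. X, transpose_mat :: complex mat \<Rightarrow> complex mat}"
  shows "A \<in> cmat n \<Longrightarrow> f A \<in> cmat n" "f (f A) = A" "f (0\<^sub>m n n) = 0\<^sub>m n n" "f (c \<cdot>\<^sub>m A) = c \<cdot>\<^sub>m f A"
    "A \<in> cmat n \<Longrightarrow> B \<in> cmat n \<Longrightarrow> f (A + B) = f A + f B"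
    "adj (f (munit n i j)) = f (munit n j i)"
  using assms by (auto simp: transpose_add transpose_outer_unit outer_adjoint intro!: eq_matI)

context normalized_map
begin

lemma kronecker_form:
  assumes N: "N = m * n"
  shows "\<exists>W \<in> cmat N. unitary_mat W \<and> (\<exists>f \<in> {\<lambda>X. X, transpose_mat}. \<exists>h \<in> {\<lambda>X. X, transpose_mat}.
    \<forall>A \<in> cmat m. \<forall>B \<in> cmat n. F A B * W = W * (f A \<otimes>\<^sub>K h B))"
proof -
  note ac = cmat_assoc[where N = N]
  define Em where "Em i j = munit m i j" for i j
  define En where "En i j = munit n i j" for i j
  have Ec: "Em i j \<in> cmat m" "En i j \<in> cmat n" for i j by (simp_all add: Em_def En_def)
  obtain f where f: "f \<in> {\<lambda>X. X, transpose_mat}"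
    and fm0: "\<forall>i<m. \<forall>j<m. \<forall>k<m. \<forall>l<m. F (f (Em i j)) (1\<^sub>m n) * F (f (Em k l)) (1\<^sub>m n) =
      (if j = k then F (f (Em i l)) (1\<^sub>m n) else 0\<^sub>m N N)"
    using left_matrix_units unfolding Em_def by (rule bexE)
  obtain h where h: "h \<in> {\<lambda>X. X, transpose_mat}"
    and hm0: "\<forall>i<n. \<forall>j<n. \<forall>k<n. \<forall>l<n. F (1\<^sub>m m) (h (En i j)) * F (1\<^sub>m m) (h (En k l)) =
      (if j = k then F (1\<^sub>m m) (h (En i l)) else 0\<^sub>m N N)"
    using normalized_map.left_matrix_units[OF swap_normalized] unfolding En_def by (rule bexE)
  note fc = transpose_choice[OF f] and hc = transpose_choice[OF h]
  define e where "e i j = F (f (Em i j)) (1\<^sub>m n)" for i j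
  define g where "g i j = F (1\<^sub>m m) (h (En i j))" for i j
  have eg: "e i j \<in> cmat N" "g i j \<in> cmat N" for i j by (simp_all add: e_def g_def Ec fc(1) hc(1))
  have em: "e i j * e k l = (if j = k then e i l else 0\<^sub>m N N)" if "i < m" "j < m" "k < m" "l < m" for i j k l
    using fm0 that unfolding e_def by blast
  have gm: "g i j * g k l = (if j = k then g i l else 0\<^sub>m N N)" if "i < n" "j < n" "k < n" "l < n" for i j k l
    using hm0 that unfolding g_def by blast
  have egF: "e i j * g r s = F (f (Em i j)) (h (En r s))" "g r s * e i j = F (f (Em i j)) (h (En r s))" for i j r s
    using right_factor[OF unital fc(1)[OF Ec(1)] hc(1)[OF Ec(2)]] by (simp_all add: e_def g_def)
  have ge: "g r s * e i j = e i j * g r s" for i j r s using egF by simp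
  have ea: "adj (e i j) = e j i" for i j
  proof -
    have "adj (F (f (Em i j)) (1\<^sub>m n)) = F (adj (f (Em i j))) (1\<^sub>m n)"
      using orthogonal_map.right_factor[OF swap_orthogonal unital one_carrier_mat fc(1)[OF Ec(1)]] by blast
    thus ?thesis unfolding e_def Em_def fc(6) .
  qed
  have ga: "adj (g i j) = g j i" for i j
  proof -
    have "adj (F (1\<^sub>m m) (h (En i j))) = F (1\<^sub>m m) (adj (h (En i j)))"
      using right_factor[OF unital one_carrier_mat hc(1)[OF Ec(2)]] by blast
    thus ?thesis unfolding g_def En_def hc(6) .
  qed
  define w0 where "w0 = (unit_vec N (P 0 0) :: complex vec)"
  have P0: "P 0 0 < N" using diagonal_index dim_pos by simp
  have w0: "w0 \<in> cvec N" "w0 \<bullet>c w0 = 1"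
    using P0 by (simp_all add: w0_def scalar_prod_c_sum[of _ N] unit_vec_def if_distrib sum.delta cong: if_cong)
  \<comment> \<open>E_00 is symmetric, so the known diagonal value of \<open>F\<close> can be used
    for either choice of \<open>f\<close> and \<open>h\<close>.\<close>
  have t0: "f (Em 0 0) = Em 0 0" "h (En 0 0) = En 0 0"
    using f h by (auto simp: Em_def En_def transpose_outer_unit)
  have e0: "(e 0 0 * g 0 0) *\<^sub>v w0 = w0"
    using diagonal[OF dim_pos] w0 unfolding egF t0 unfolding Em_def En_def w0_def[symmetric]
    by (simp add: outer_mult_vec[of _ N])
  \<comment> \<open>Number p = i n + r carries the vector reached by e i 0 and g r 0, in agreement
    with the flat indexing of the Kronecker product.\<close>
  define v where "v p = (e (p div n) 0 * g (p mod n) 0) *\<^sub>v w0" for p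
  have v: "v p \<in> cvec N" for p using eg w0 by (simp add: v_def)
  have act: "(e i j * g r s) *\<^sub>v v p = (if j = p div n \<and> s = p mod n then v (i * n + r) else 0\<^sub>v N)"
    if ij: "i < m" "j < m" "r < n" "s < n" and p: "p < N" for i j r s p
  proof -
    note pn = div_mod_lt[OF p[unfolded N]]
    have "(e i j * g r s) *\<^sub>v v p = (e i j * g r s * (e (p div n) 0 * g (p mod n) 0)) *\<^sub>v w0"
      unfolding v_def using eg w0 by (simp add: assoc_mult_mat_vec[of _ N N _ N])
    also have "e i j * g r s * (e (p div n) 0 * g (p mod n) 0) = e i j * (g r s * e (p div n) 0) * g (p mod n) 0"
      using eg by (simp add: ac)
    also have "\<dots> = (e i j * e (p div n) 0) * (g r s * g (p mod n) 0)"
      unfolding ge using eg by (simp add: ac)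
    also have "\<dots> = (if j = p div n \<and> s = p mod n then e i 0 * g r 0 else 0\<^sub>m N N)"
      using ij pn dim_pos eg by (simp add: em gm)
    finally show ?thesis using ij w0 by (simp add: v_def split: if_splits)
  qed
  have vv: "v p \<bullet>c v q = (if p = q then 1 else 0)" if pq: "p < N" "q < N" for p q
  proof -
    note pn = div_mod_lt[OF pq(1)[unfolded N]]
    let ?A = "e (p div n) 0 * g (p mod n) 0"
    have A: "?A \<in> cmat N" using eg by simp
    have aA: "adj ?A = e 0 (p div n) * g 0 (p mod n)"
      using eg by (simp add: mat_adjoint_mult[of _ N N _ N] ea ga ge)
    have "v p \<bullet>c v q = w0 \<bullet>c (adj ?A *\<^sub>v v q)"
      by (subst v_def) (rule cscalar_mult_mat_vec[OF A w0(1) v])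
    also have "adj ?A *\<^sub>v v q = (if p div n = q div n \<and> p mod n = q mod n then v 0 else 0\<^sub>v N)"
      unfolding aA using act[OF dim_pos(1) pn(1) dim_pos(2) pn(2) pq(2)] by simp
    also have "v 0 = w0" unfolding v_def using e0 by simp
    also have "(p div n = q div n \<and> p mod n = q mod n) \<longleftrightarrow> p = q"
      by (metis div_mult_mod_eq)
    finally show ?thesis using w0 by simp
  qed
  let ?W = "mat N N (\<lambda>(i, j). v j $ i)"
  have W: "?W \<in> cmat N" "unitary_mat ?W" using unitary_of_cols[of N v, OF v vv] by simp_all
  have colW: "col ?W p = v p" if "p < N" for p using that v[of p] by (auto intro!: eq_vecI)
  \<comment> \<open>Composed with \<open>?W\<close>, both operators send the standard basis vector
    with number j n + s to v (i n + r) and every other one to 0.\<close>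
  have main_unit: "F (f (Em i j)) (h (En r s)) * ?W = ?W * (Em i j \<otimes>\<^sub>K En r s)"
    if ij: "i < m" "j < m" "r < n" "s < n" for i j r s
  proof -
    let ?p = "i * n + r" and ?q = "j * n + s"
    have pq: "?p < N" "?q < N" unfolding N using ij by (auto intro: kron_index_lt)
    have WE: "?W * (Em i j \<otimes>\<^sub>K En r s) = outer (v ?p) (unit_vec N ?q)"
    proof -
      have "Em i j \<otimes>\<^sub>K En r s = outer (unit_vec N ?p) (unit_vec N ?q)"
        unfolding Em_def En_def N by (rule kron_outer_unit[OF ij])
      moreover have "?W *\<^sub>v unit_vec N ?p = v ?p"
        by (rule eq_vecI) (use pq v[of ?p] in \<open>auto simp: scalar_prod_right_unit\<close>)
      ultimately show ?thesis using W by (simp add: mult_outer[of _ N])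
    qed
    have "(e i j * g r s) * ?W = outer (v ?p) (unit_vec N ?q)"
    proof (rule eq_matI)
      fix a b assume "a < dim_row (outer (v ?p) (unit_vec N ?q))" "b < dim_col (outer (v ?p) (unit_vec N ?q))"
      hence ab: "a < N" "b < N" using v[of ?p] by (auto simp: outer_def)
      have egc: "e i j * g r s \<in> cmat N" using eg by simp
      have "(e i j * g r s * ?W) $$ (a, b) = col (e i j * g r s * ?W) b $ a"
        using ab egc by (subst index_col) auto
      also have "col (e i j * g r s * ?W) b = (e i j * g r s) *\<^sub>v v b"
        using col_mult2[OF egc W(1) ab(2)] colW[OF ab(2)] by simp
      also have "\<dots> = (if j = b div n \<and> s = b mod n then v ?p else 0\<^sub>v N)"
        by (rule act[OF ij ab(2)])
      also have "(j = b div n \<and> s = b mod n) \<longleftrightarrow> b = ?q"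
        using ij by auto
      also have "(if b = ?q then v ?p else 0\<^sub>v N) $ a = outer (v ?p) (unit_vec N ?q) $$ (a, b)"
        using ab v[of ?p] by (auto simp: outer_def unit_vec_def)
      finally show "(e i j * g r s * ?W) $$ (a, b) = outer (v ?p) (unit_vec N ?q) $$ (a, b)" .
    qed (use eg v[of ?p] in \<open>auto simp: outer_def\<close>)
    thus ?thesis unfolding WE egF .
  qed
  have main: "F (f A) (h B) * ?W = ?W * (A \<otimes>\<^sub>K B)" if "A \<in> cmat m" "B \<in> cmat n" for A B
    using that(1)
  proof (induction A rule: mat_span_induct)
    case zero
    have "0\<^sub>m m m \<otimes>\<^sub>K B = 0 \<cdot>\<^sub>m (0\<^sub>m m m \<otimes>\<^sub>K B)" using kron_smult_left[of "0\<^sub>m m m" m B n 0] that by simp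
    also have "\<dots> = 0\<^sub>m N N" using that by (intro eq_matI) (auto simp: N)
    finally show ?case using W that by (simp add: fc(3) zero_left hc(1))
  next
    case (add A A')
    have "A \<otimes>\<^sub>K B \<in> cmat N" "A' \<otimes>\<^sub>K B \<in> cmat N" using add that by (simp_all add: N)
    thus ?case using add that W
      by (simp add: fc(5)[of _ m] kron_add_left[of _ m _ _ n] add_left fc(1) hc(1) cmat_bilinear[where N = N])
  next
    case (smult c A)
    have "A \<otimes>\<^sub>K B \<in> cmat N" using smult that by (simp add: N)
    thus ?case using smult that W
      by (simp add: fc(4) kron_smult_left[of _ m _ n] smult_left fc(1) hc(1) cmat_bilinear[where N = N])
  next
    case (unit i j)
    have "F (f (Em i j)) (h B) * ?W = ?W * (Em i j \<otimes>\<^sub>K B)"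
      using that(2)
    proof (induction B rule: mat_span_induct)
      case zero
      have "Em i j \<otimes>\<^sub>K 0\<^sub>m n n = 0 \<cdot>\<^sub>m (Em i j \<otimes>\<^sub>K 0\<^sub>m n n)"
        using kron_smult_right[of "Em i j" m "0\<^sub>m n n" n 0] Ec by simp
      also have "\<dots> = 0\<^sub>m N N" using Ec(1)[of i j] by (intro eq_matI) (auto simp: N)
      finally show ?case using W by (simp add: hc(3) zero_right fc(1) Ec)
    next
      case (add B B')
      have "Em i j \<otimes>\<^sub>K B \<in> cmat N" "Em i j \<otimes>\<^sub>K B' \<in> cmat N" using add Ec by (simp_all add: N)
      thus ?case using add Ec W
        by (simp add: hc(5)[of _ n] kron_add_right[of _ m _ n] add_right fc(1) hc(1) cmat_bilinear[where N = N])
    next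
      case (smult c B)
      have "Em i j \<otimes>\<^sub>K B \<in> cmat N" using smult Ec by (simp add: N)
      thus ?case using smult Ec W
        by (simp add: hc(4) kron_smult_right[of _ m _ n] smult_right fc(1) hc(1) cmat_bilinear[where N = N])
    next
      case (unit r s)
      thus ?case using main_unit[OF \<open>i < m\<close> \<open>j < m\<close>] by (simp add: En_def)
    qed
    thus ?case by (simp add: Em_def)
  qed
  \<comment> \<open>\<open>f\<close> and \<open>h\<close> are involutions, so they can be moved from
    the arguments of \<open>F\<close> to the Kronecker factors.\<close>
  have "F A B * ?W = ?W * (f A \<otimes>\<^sub>K h B)" if "A \<in> cmat m" "B \<in> cmat n" for A B
    using main[of "f A" "h B"] that fc(1,2) hc(1,2) by simp
  hence "\<forall>A \<in> cmat m. \<forall>B \<in> cmat n. F A B * ?W = ?W * (f A \<otimes>\<^sub>K h B)" by (intro ballI)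
  thus ?thesis by (intro bexI[of _ ?W] conjI W bexI[OF _ f] bexI[OF _ h])
qed

end

section \<open>Invariance of the norm under unitaries and under transposing a factor\<close>

lemma ky_fan_unitary:
  assumes X: "X \<in> cmat N" and U: "U \<in> cmat N" "unitary_mat U" and V: "V \<in> cmat N" "unitary_mat V"
  shows "ky_fan_norm k (U * X * V) = ky_fan_norm k X"
proof -
  obtain U0 V0 d where U0: "U0 \<in> cmat N" "unitary_mat U0" and V0: "V0 \<in> cmat N" "unitary_mat V0"
    and "\<forall>i<N. 0 \<le> (d i :: real)" "\<forall>i j. i \<le> j \<longrightarrow> j < N \<longrightarrow> d j \<le> d i"
    and X0: "X = U0 * real_diag N d * adj V0"
    and "singular_values X = map d [0..<N]"
    by (rule singular_value_decomposition[OF X])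
  have "U * X * V = (U * U0) * real_diag N d * adj (adj V * V0)"
    unfolding X0 using U V U0 V0 by (simp add: mat_adjoint_mult[of _ N N _ N] cmat_assoc[where N = N])
  moreover have "unitary_mat (U * U0)" "unitary_mat (adj V * V0)"
    using U V U0 V0 unitary_adjoint[OF V(2)] by (simp_all add: unitary_mult[of _ _ N])
  ultimately have "singular_values (U * X * V) = singular_values X"
    unfolding X0 using U V U0 V0 by (simp add: singular_values_diag)
  thus ?thesis by (simp add: ky_fan_norm_def)
qed

text \<open>If A = U D adj V, then the transpose of A is the conjugate of V times D times the
  transpose of U, since D is diagonal. The unitaries depend on \<open>A\<close>; this suffices
  because norms are compared for one product \<open>A \<otimes>\<^sub>K B\<close> at a time.\<close>

lemma transpose_unitary_equivalent:
  assumes A: "A \<in> cmat n" and f: "f \<in> {\<lambda>X. X, transpose_mat}"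
  shows "\<exists>G \<in> cmat n. \<exists>H \<in> cmat n. unitary_mat G \<and> unitary_mat H \<and> f A = G * A * H"
proof (cases "f = (\<lambda>X. X)")
  case True
  thus ?thesis using A by (intro bexI[of _ "1\<^sub>m n"]) auto
next
  case False
  hence ft: "f = transpose_mat" using f by auto
  obtain U V d where U: "U \<in> cmat n" "unitary_mat U" and V: "V \<in> cmat n" "unitary_mat V"
    and "\<forall>i<n. 0 \<le> (d i :: real)" "\<forall>i j. i \<le> j \<longrightarrow> j < n \<longrightarrow> d j \<le> d i"
    and X: "A = U * real_diag n d * adj V"
    and "singular_values A = map d [0..<n]"
    by (rule singular_value_decomposition[OF A])
  let ?D = "real_diag n d"
  have tu: "unitary_mat (transpose_mat M)" if M: "M \<in> cmat n" "unitary_mat M" for M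
  proof (rule unitary_matI[of _ n])
    have "adj (transpose_mat M) = transpose_mat (adj M)" by (rule eq_matI) auto
    hence "adj (transpose_mat M) * transpose_mat M = transpose_mat (M * adj M)"
      using M by (simp add: transpose_mult[of _ n n _ n])
    thus "adj (transpose_mat M) * transpose_mat M = 1\<^sub>m n"
      using unitary_matD[OF M(2,1)] by simp
  qed (use M in simp)
  have tD: "transpose_mat ?D = ?D" by (rule eq_matI) (auto simp: mat_diag_def)
  let ?G = "transpose_mat (adj V) * adj U" and ?H = "V * transpose_mat U"
  have "transpose_mat A = transpose_mat (adj V) * (?D * transpose_mat U)"
    unfolding X using U V by (simp add: transpose_mult[of _ n n _ n] tD)
  also have "\<dots> = ?G * A * ?H"
    unfolding X using U V
    by (simp add: cmat_assoc[where N = n] unitary_cancel[of U n] unitary_cancel[of V n])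
  finally have "transpose_mat A = ?G * A * ?H" .
  moreover have "unitary_mat ?G" "unitary_mat ?H"
    using U V tu[of U] tu[of "adj V"] unitary_adjoint[OF V(2)] unitary_adjoint[OF U(2)]
    by (simp_all add: unitary_mult[of _ _ n])
  ultimately show ?thesis unfolding ft using U V by (intro bexI[of _ ?G] bexI[of _ ?H]) auto
qed

lemma ky_fan_kron_transpose:
  assumes A: "A \<in> cmat m" and B: "B \<in> cmat n" and f: "f \<in> {\<lambda>X. X, transpose_mat}" "h \<in> {\<lambda>X. X, transpose_mat}"
  shows "ky_fan_norm k (f A \<otimes>\<^sub>K h B) = ky_fan_norm k (A \<otimes>\<^sub>K B)"
proof -
  obtain G H where G: "G \<in> cmat m" "H \<in> cmat m" "unitary_mat G" "unitary_mat H" "f A = G * A * H"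
    using transpose_unitary_equivalent[OF A f(1)] by blast
  obtain G' H' where G': "G' \<in> cmat n" "H' \<in> cmat n" "unitary_mat G'" "unitary_mat H'" "h B = G' * B * H'"
    using transpose_unitary_equivalent[OF B f(2)] by blast
  have "f A \<otimes>\<^sub>K h B = (G \<otimes>\<^sub>K G') * (A \<otimes>\<^sub>K B) * (H \<otimes>\<^sub>K H')"
    unfolding G(5) G'(5) using A B G G' by (simp add: kron_mult[of _ m _ _ n])
  thus ?thesis using A B G G' by (simp add: ky_fan_unitary[of _ "m * n"] kron_unitary[of _ m _ n])
qed

theorem theorem2p6:
  fixes m n k :: nat and \<phi> :: "complex mat \<Rightarrow> complex mat"
  assumes "m \<ge> 2" and "n \<ge> 2" and "2 \<le> k" and "k \<le> m * n"
    and "linear_on_mat (m * n) \<phi>"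
  shows "(\<forall>A \<in> carrier_mat m m. \<forall>B \<in> carrier_mat n n.
            ky_fan_norm k (\<phi> (A \<otimes>\<^sub>K B)) = ky_fan_norm k (A \<otimes>\<^sub>K B))
     \<longleftrightarrow>
         (\<exists>U \<in> carrier_mat (m * n) (m * n). \<exists>V \<in> carrier_mat (m * n) (m * n).
            unitary_mat U \<and> unitary_mat V \<and>
            (\<exists>\<phi>\<^sub>1 \<in> {\<lambda>X. X, transpose_mat}. \<exists>\<phi>\<^sub>2 \<in> {\<lambda>X. X, transpose_mat}.
               \<forall>A \<in> carrier_mat m m. \<forall>B \<in> carrier_mat n n.
                 \<phi> (A \<otimes>\<^sub>K B) = U * (\<phi>\<^sub>1 A \<otimes>\<^sub>K \<phi>\<^sub>2 B) * V))"
 (is "?a \<longleftrightarrow> ?b")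
proof
  assume ?b
  then obtain U V \<phi>1 \<phi>2 where U: "U \<in> cmat (m * n)" "unitary_mat U" and V: "V \<in> cmat (m * n)" "unitary_mat V"
    and \<phi>12: "\<phi>1 \<in> {\<lambda>X. X, transpose_mat}" "\<phi>2 \<in> {\<lambda>X. X, transpose_mat}"
    and eq: "\<forall>A \<in> cmat m. \<forall>B \<in> cmat n. \<phi> (A \<otimes>\<^sub>K B) = U * (\<phi>1 A \<otimes>\<^sub>K \<phi>2 B) * V" by blast
  show ?a
  proof (intro ballI)
    fix A B :: "complex mat" assume AB: "A \<in> cmat m" "B \<in> cmat n"
    have "\<phi>1 A \<otimes>\<^sub>K \<phi>2 B \<in> cmat (m * n)"
      using transpose_choice(1)[OF \<phi>12(1) AB(1)] transpose_choice(1)[OF \<phi>12(2) AB(2)] by simp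
    thus "ky_fan_norm k (\<phi> (A \<otimes>\<^sub>K B)) = ky_fan_norm k (A \<otimes>\<^sub>K B)"
      using eq AB ky_fan_unitary[OF _ U V] ky_fan_kron_transpose[OF AB \<phi>12] by simp
  qed
next
  assume a: ?a
  define N where "N = m * n"
  define F where "F A B = \<phi> (A \<otimes>\<^sub>K B)" for A B
  have k: "1 \<le> k" "2 \<le> k" "k \<le> N" "k \<le> n * m" using assms by (simp_all add: N_def mult.commute)
  have lin: "\<And>X. X \<in> cmat N \<Longrightarrow> \<phi> X \<in> cmat N" "\<And>X Y. X \<in> cmat N \<Longrightarrow> Y \<in> cmat N \<Longrightarrow> \<phi> (X + Y) = \<phi> X + \<phi> Y"
    "\<And>c X. X \<in> cmat N \<Longrightarrow> \<phi> (c \<cdot>\<^sub>m X) = c \<cdot>\<^sub>m \<phi> X"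
    using assms(5) unfolding linear_on_mat_def N_def by blast+
  have kc: "A \<otimes>\<^sub>K B \<in> cmat N" if "A \<in> cmat m" "B \<in> cmat n" for A B using that by (simp add: N_def)
  have norm: "ky_fan_norm k (F A B) = ky_fan_norm k (A \<otimes>\<^sub>K B)" if "A \<in> cmat m" "B \<in> cmat n" for A B
    using a that by (simp add: F_def)
  have F: "bilinear_matrix_map m n N F"
    by unfold_locales
       (simp_all add: F_def lin kc kron_add_left[of _ m _ _ n] kron_add_right[of _ m _ n] kron_smult_left[of _ m _ n] kron_smult_right[of _ m _ n])
  note F' = bilinear_matrix_map.swap[OF F]
  \<comment> \<open>With a rank one matrix fixed in one factor, the two-term sums remain Kronecker
    products, so the hypothesis transfers the value |\<alpha>| + |\<beta>| to \<open>F\<close>; here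
    the first factor is fixed, in \<open>l\<close> the second.\<close>
  have r: "bilinear_matrix_map.rank_one_orthogonal m n N F"
    "bilinear_matrix_map.rank_one_orthogonal m n N (\<lambda>A B. adj (F (adj A) (adj B)))"
    by (rule bilinear_matrix_map.rank_one_orthogonalI[OF F k(1,3)],
        subst norm, simp, simp, rule ky_fan_kron_two(1)[OF assms(1-4)]; assumption)+
  have l: "bilinear_matrix_map.rank_one_orthogonal n m N (\<lambda>A B. F B A)"
    "bilinear_matrix_map.rank_one_orthogonal n m N (\<lambda>A B. adj (F (adj B) (adj A)))"
    by (rule bilinear_matrix_map.rank_one_orthogonalI[OF F' k(1,3)],
        subst norm, simp, simp, rule ky_fan_kron_two(2)[OF assms(2,1) k(2,4) _ _ _ _ _ _ _ _ _ _ _ _ _ _ assms(4)]; assumption)+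
  interpret orthogonal_map m n N F
  proof (intro orthogonal_map.intro[OF F] orthogonal_map_axioms.intro, goal_cases)
    case (1 y y' C A1 A2)
    show ?case by (rule bilinear_matrix_map.orthogonal_right'[OF F r 1])
  next
    case (2 x x' C B1 B2)
    show ?case by (rule bilinear_matrix_map.orthogonal_right'[OF F' l 2])
  qed
  let ?Em = "\<lambda>i. munit m i i" and ?En = "\<lambda>i. munit n i i"
  define X where "X p = F (?Em (p div n)) (?En (p mod n))" for p
  have Xc: "X p \<in> cmat N" for p by (simp add: X_def)
  have N2: "2 \<le> N" using k by linarith
  have Xnorm: "ky_fan_norm k (X p) = 1" if p: "p < N" for p
  proof -
    have "ky_fan_norm k (X p) = ky_fan_norm k (munit N p p)"
      using norm[of "?Em (p div n)" "?En (p mod n)"] div_mod_lt[OF p[unfolded N_def]]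
      by (simp add: X_def kron_outer_unit N_def)
    \<comment> \<open>The second position is an arbitrary index different from p; its entry is
      0.\<close>
    also have "munit N p p = 1\<^sub>m N * mat_diag N (\<lambda>i. if i = p then 1 else if i = (if p = 0 then 1 else 0) then 0 else 0) * adj (1\<^sub>m N)"
      by (rule eq_matI) (auto simp: outer_def mat_diag_def unit_vec_def)
    also have "ky_fan_norm k \<dots> = cmod 1 + cmod 0"
      by (rule ky_fan_two) (use p N2 k in auto)
    finally show ?thesis by simp
  qed
  have Xnz: "X p \<noteq> 0\<^sub>m N N" if p: "p < N" for p
  proof
    assume "X p = 0\<^sub>m N N"
    \<comment> \<open>The norm of the zero matrix is read off from a two-entry diagonal matrix with
      both entries 0.\<close>
    moreover have "two_diag N 0 1 0 0 = (0\<^sub>m N N :: complex mat)"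
      by (rule eq_matI) (auto simp: mat_diag_def)
    moreover have "ky_fan_norm k (1\<^sub>m N * two_diag N 0 1 0 0 * adj (1\<^sub>m N)) = cmod 0 + cmod 0"
      by (rule ky_fan_two) (use N2 k in auto)
    ultimately show False
      using Xnorm[OF p] by simp
  qed
  have perp: "adj (munit q j j) *\<^sub>v unit_vec q i = 0\<^sub>v q"
    "munit q j j *\<^sub>v unit_vec q i = 0\<^sub>v q" if "i < q" "j < q" "i \<noteq> j" for q i j
    using that by (simp_all add: outer_adjoint outer_mult_vec[of _ q] unit_vec_c zero_smult_cvec)
  have Xorth: "adj (X p) * X q = 0\<^sub>m N N \<and> X p * adj (X q) = 0\<^sub>m N N"
    if pq: "p < N" "q < N" "p \<noteq> q" for p q
  proof -
    note pn = div_mod_lt[OF pq(1)[unfolded N_def]] and qn = div_mod_lt[OF pq(2)[unfolded N_def]]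
    \<comment> \<open>Different flat indices differ in quotient or remainder. The factor in which
      they differ supplies orthogonality, and the other factor is arbitrary there.\<close>
    have "p div n \<noteq> q div n \<or> p mod n \<noteq> q mod n" using pq(3) by (metis div_mult_mod_eq)
    thus ?thesis
    proof
      assume "p div n \<noteq> q div n"
      thus ?thesis unfolding X_def
        by (intro orth_left perp) (use pn qn unit_vec_c in auto)
    next
      assume "p mod n \<noteq> q mod n"
      thus ?thesis unfolding X_def
        by (intro orth_right perp) (use pn qn unit_vec_c in auto)
    qed
  qed
  have "\<exists>U \<in> cmat N. \<exists>V \<in> cmat N. unitary_mat U \<and> unitary_mat V \<and>
    (\<forall>p<N. adj U * X p * V = munit N p p)"
    by (rule orthogonal_family_diagonalization[OF Xc k(2,3) Xnorm Xnz]) (use Xorth in simp_all)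
  then obtain U V where U: "U \<in> cmat N" "unitary_mat U" and V: "V \<in> cmat N" "unitary_mat V"
    and UXV: "\<forall>p<N. adj U * X p * V = munit N p p"
    by blast
  define T where "T A B = adj U * F A B * V" for A B
  interpret T: orthogonal_map m n N T
    unfolding T_def by (rule unitary_equivalent[OF U V])
  define P where "P i r = i * n + r" for i r
  have Plt: "P i r < N" if "i < m" "r < n" for i r
    unfolding N_def P_def using that by (rule kron_index_lt)
  have diag: "T (?Em i) (?En r) = outer (unit_vec N (P i r)) (unit_vec N (P i r))" if "i < m" "r < n" for i r
    using UXV[rule_format, OF Plt[OF that]] that by (simp add: X_def T_def P_def)
  \<comment> \<open>The identity is checked on each unit S = T(E_ii, E_rr) rather than by expanding
    a double sum: 1 - E_ii in the first factor gives T(1, 1) S = T(E_ii, 1) S, and 1 - E_rr in the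
    second gives T(E_ii, 1) S = S S = S.\<close>
  have unital: "T (1\<^sub>m m) (1\<^sub>m n) = 1\<^sub>m N"
  proof -
    let ?I = "T (1\<^sub>m m) (1\<^sub>m n)"
    have cI: "?I \<in> cmat N" by simp
    have id: "?I * munit N p p = munit N p p" if p: "p < N" for p
    proof -
      define i where "i = p div n"
      define r where "r = p mod n"
      have ir: "i < m" "r < n" "P i r = p" using div_mod_lt[OF p[unfolded N_def]] by (simp_all add: i_def r_def P_def)
      let ?C = "1\<^sub>m m + (- 1) \<cdot>\<^sub>m ?Em i" and ?D = "1\<^sub>m n + (- 1) \<cdot>\<^sub>m ?En r"
      let ?S = "munit N p p"
      have S: "?S \<in> cmat N" "adj ?S = ?S" "T (?Em i) (?En r) = ?S"
        using diag[OF ir(1,2)] ir(3) by (simp_all add: outer_adjoint)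
      have aC: "adj ?C = ?C" "adj ?D = ?D"
        by (simp_all add: mat_adjoint_add[of _ m m] mat_adjoint_add[of _ n n] mat_adjoint_smult outer_adjoint)
      have kill: "(1\<^sub>m q + (- 1) \<cdot>\<^sub>m munit q j j) *\<^sub>v unit_vec q j = (0\<^sub>v q :: complex vec)" if "j < q" for q j
        using that by (intro eq_vecI) (auto simp: outer_def unit_vec_def scalar_prod_def sum.delta if_distrib cong: if_cong)
      have "T (?Em i) (?En r) * adj (T ?C (1\<^sub>m n)) = 0\<^sub>m N N"
        by (rule conjunct2[OF T.orth_left]) (use ir unit_vec_c[of i m i] kill[OF ir(1)] aC in simp_all)
      hence "adj (?S * adj (T ?C (1\<^sub>m n))) = 0\<^sub>m N N" unfolding S by simp
      hence 1: "T ?C (1\<^sub>m n) * ?S = 0\<^sub>m N N" using S by (simp add: mat_adjoint_mult[of _ N N _ N])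
      have "T (?Em i) (?En r) * adj (T (?Em i) ?D) = 0\<^sub>m N N"
        by (rule conjunct2[OF T.orth_right]) (use ir unit_vec_c[of r n r] kill[OF ir(2)] aC in simp_all)
      hence "adj (?S * adj (T (?Em i) ?D)) = 0\<^sub>m N N" unfolding S by simp
      hence 2: "T (?Em i) ?D * ?S = 0\<^sub>m N N" using S by (simp add: mat_adjoint_mult[of _ N N _ N])
      have "T ?C (1\<^sub>m n) = ?I + (- 1) \<cdot>\<^sub>m T (?Em i) (1\<^sub>m n)" by (simp add: T.add_left T.smult_left)
      hence "?I * ?S + (- 1) \<cdot>\<^sub>m (T (?Em i) (1\<^sub>m n) * ?S) = 0\<^sub>m N N"
        using 1 S by (simp add: cmat_bilinear[where N = N])
      hence 3: "?I * ?S = T (?Em i) (1\<^sub>m n) * ?S" by (rule cmat_eqI_diff) (use S in simp_all)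
      have "T (?Em i) ?D = T (?Em i) (1\<^sub>m n) + (- 1) \<cdot>\<^sub>m ?S" by (simp add: T.add_right T.smult_right S)
      hence "T (?Em i) (1\<^sub>m n) * ?S + (- 1) \<cdot>\<^sub>m (?S * ?S) = 0\<^sub>m N N"
        using 2 S by (simp add: cmat_bilinear[where N = N])
      hence 4: "T (?Em i) (1\<^sub>m n) * ?S = ?S * ?S" by (rule cmat_eqI_diff) (use S in simp_all)
      have "?S * ?S = ?S" using p unit_vec_c[of p N p] by (simp add: outer_mult_outer[of _ N])
      thus ?thesis using 3 4 by simp
    qed
    show ?thesis
    proof (rule eq_matI)
      fix a b assume "a < dim_row (1\<^sub>m N :: complex mat)" "b < dim_col (1\<^sub>m N :: complex mat)"
      hence ab: "a < N" "b < N" by auto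
      have "?I * munit N b b = outer (?I *\<^sub>v unit_vec N b) (unit_vec N b)"
        by (rule mult_outer[OF cI]) auto
      hence "outer (?I *\<^sub>v unit_vec N b) (unit_vec N b) $$ (a, b) = munit N b b $$ (a, b)"
        using id[OF ab(2)] by simp
      thus "?I $$ (a, b) = 1\<^sub>m N $$ (a, b)"
        using ab carrier_matD[OF cI] by (simp add: outer_def scalar_prod_right_unit)
    qed (use carrier_matD[OF cI] in auto)
  qed
  interpret T: normalized_map m n N T P
    by unfold_locales (use assms unital Plt diag in simp_all)
  obtain W f h where W: "W \<in> cmat N" "unitary_mat W" and fh: "f \<in> {\<lambda>X. X, transpose_mat}" "h \<in> {\<lambda>X. X, transpose_mat}"
    and TW: "\<forall>A \<in> cmat m. \<forall>B \<in> cmat n. T A B * W = W * (f A \<otimes>\<^sub>K h B)"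
    using T.kronecker_form[OF N_def] by blast
  have UW: "unitary_mat (U * W)" "unitary_mat (adj W * adj V)"
    using U V W unitary_adjoint[OF W(2)] unitary_adjoint[OF V(2)] by (simp_all add: unitary_mult[of _ _ N])
  have UWc: "U * W \<in> cmat (m * n)" "adj W * adj V \<in> cmat (m * n)"
    using U V W by (simp_all flip: N_def)
  have form: "\<phi> (A \<otimes>\<^sub>K B) = U * W * (f A \<otimes>\<^sub>K h B) * (adj W * adj V)"
    if AB: "A \<in> cmat m" "B \<in> cmat n" for A B
  proof -
    have K: "f A \<otimes>\<^sub>K h B \<in> cmat N" by (intro kc transpose_choice(1)[OF fh(1)] transpose_choice(1)[OF fh(2)] AB)
    have Fc: "F A B \<in> cmat N" using AB by simp
    have "F A B = U * (T A B * W * adj W) * adj V"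
      unfolding T_def using U V W Fc
      by (simp add: cmat_assoc[where N = N] unitary_cancel[of U N] unitary_cancel[of V N] unitary_cancel[of W N]
          unitary_matD[of _ N])
    also have "\<dots> = U * (W * (f A \<otimes>\<^sub>K h B) * adj W) * adj V" using TW AB by simp
    also have "\<dots> = U * W * (f A \<otimes>\<^sub>K h B) * (adj W * adj V)"
      using U V W K by (simp add: cmat_assoc[where N = N])
    finally show ?thesis by (simp add: F_def)
  qed
  show ?b
    by (rule bexI[OF _ UWc(1)], rule bexI[OF _ UWc(2)], intro conjI UW, rule bexI[OF _ fh(1)], rule bexI[OF _ fh(2)])
       (intro ballI form)
qed

end
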